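(* Let $M$ be a $CR$ submanifold, of $CR$ dimension $m$ and $CR$ codimension $d$, of a $\nu$-dimensional complex manifold $X$, let $n=m+d$ and $p_0\in M$. Let $(W;z_1,\dots,z_\nu)$ be a holomorphic coordinate neighborhood in $X$ centered at $p_0$, with the coordinates ordered in such a way that the restrictions to $M$ of $dz_1,\dots,dz_n$ are linearly independent at $p_0$, and let $\phi:p\mapsto(z_1(p),\dots,z_n(p))$ be the resulting generic $CR$-embedding of a neighborhood $U$ of $p_0$ in $M\cap W$ into an open neighborhood of $0$ in $\mathbb{C}^n$. Then for each $a\in\{-\infty,0,\infty\}$ the following are equivalent: (1) the restriction map $\mathcal{O}_{X,(p_0)}\to\mathcal{O}^{a}_{M,(p_0)}$ is onto; (2) the map $\phi^*:\mathcal{O}_{\mathbb{C}^n,(0)}\to\mathcal{O}^{a}_{M,(p_0)}$, where $0=\phi(p_0)$, is an isomorphism.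
   Context: A $CR$ manifold $M$ of $CR$ dimension $m$ and $CR$ codimension $d$ is a smooth real manifold of dimension $2m+d$ with a smooth complex subbundle $T^{0,1}M\subset\mathbb{C}TM$ of complex rank $m$ such that $T^{0,1}M\cap\overline{T^{0,1}M}=\underline{0}$ and $[\Gamma(M,T^{0,1}M),\Gamma(M,T^{0,1}M)]\subset\Gamma(M,T^{0,1}M)$. It is a $CR$ submanifold of a complex manifold $X$ if $M$ is a smooth real submanifold of $X$ and $T^{0,1}M=T^{0,1}X\cap\mathbb{C}TM$. A $CR$-embedding into a complex manifold of dimension $m+d$ is called generic. For $U\subset M$ open and $a=\infty,0,-\infty$, $\mathcal{O}^{a}_M(U)$ denotes the space of complex valued $u$ on $U$ that are respectively $\mathcal{C}^\infty$ functions, continuous functions, distributions, satisfying $Zu=0$ for all $Z\in\Gamma(U,T^{0,1}M)$ (in the weak sense when $a=0,-\infty$). $\mathcal{O}^{a}_{M,(p_0)}$ is the stalk at $p_0$ of the corresponding sheaf of germs. For a complex manifold $Y$, $\mathcal{O}_{Y,(q)}$ is the ring of germs of holomorphic functions at $q\in Y$. *)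

theory Defs
  imports "HOL-Analysis.Analysis"
begin

section \<open>Smooth and holomorphic functions on open sets\<close>

primrec iter_deriv ::
  "'a::real_normed_vector list \<Rightarrow> ('a \<Rightarrow> 'b::real_normed_vector) \<Rightarrow> 'a \<Rightarrow> 'b" where
  "iter_deriv [] f = f"
| "iter_deriv (b # bs) f = (\<lambda>x. frechet_derivative (iter_deriv bs f) (at x) b)"

text \<open>\<open>C\<^sup>\<infinity>\<close>: every iterated partial derivative is (Frechet) differentiable at every point of \<open>S\<close>.
  Only used for open \<open>S\<close>.\<close>

definition smooth_on ::
  "'a::euclidean_space set \<Rightarrow> ('a \<Rightarrow> 'b::real_normed_vector) \<Rightarrow> bool" where
  "smooth_on S f \<longleftrightarrow> (\<forall>bs\<in>lists Basis. \<forall>x\<in>S. iter_deriv bs f differentiable (at x))"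

text \<open>Holomorphy in several variables: the real differential exists and is complex linear.
  Only used for open \<open>S\<close>.\<close>

definition holo_on :: "(complex^'v) set \<Rightarrow> (complex^'v \<Rightarrow> complex) \<Rightarrow> bool" where
  "holo_on S f \<longleftrightarrow>
     (\<forall>x\<in>S. \<exists>f'. (f has_derivative f') (at x) \<and> (\<forall>c v. f' (c *s v) = c * f' v))"

section \<open>Manifolds\<close>

text \<open>A chart is a pair of a domain and a map, which is only meaningful on the domain. A
  manifold is a subset of a topological type with the subspace topology; the theorem takes the
  type to be Hausdorff and second countable.\<close>

type_synonym ('x, 'e) chart = "'x set \<times> ('x \<Rightarrow> 'e)"

definition chart_on ::
  "'x::topological_space set \<Rightarrow> ('x, 'e::topological_space) chart \<Rightarrow> bool" where
  "chart_on M = (\<lambda>(U, \<kappa>). openin (top_of_set M) U \<and> open (\<kappa> ` U) \<and>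
                           homeomorphism U (\<kappa> ` U) \<kappa> (inv_into U \<kappa>))"

definition smooth_atlas ::
  "'x::topological_space set \<Rightarrow> ('x, 'e::euclidean_space) chart set \<Rightarrow> bool" where
  "smooth_atlas M B \<longleftrightarrow>
     (\<forall>c\<in>B. chart_on M c) \<and> M = (\<Union>c\<in>B. fst c) \<and>
     (\<forall>(U, \<kappa>)\<in>B. \<forall>(V, \<eta>)\<in>B. smooth_on (\<kappa> ` (U \<inter> V)) (\<eta> \<circ> inv_into U \<kappa>))"

definition holo_compatible :: "('x, complex^'v) chart \<Rightarrow> ('x, complex^'v) chart \<Rightarrow> bool" where
  "holo_compatible = (\<lambda>(U, z) (V, w).
     (\<forall>j. holo_on (z ` (U \<inter> V)) (\<lambda>x. w (inv_into U z x) $ j)) \<and>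
     (\<forall>j. holo_on (w ` (U \<inter> V)) (\<lambda>x. z (inv_into V w x) $ j)))"

definition complex_manifold ::
  "'x::topological_space set \<Rightarrow> ('x, complex^'v) chart set \<Rightarrow> bool" where
  "complex_manifold X A \<longleftrightarrow>
     (\<forall>c\<in>A. chart_on X c) \<and> X = (\<Union>c\<in>A. fst c) \<and> (\<forall>c\<in>A. \<forall>c'\<in>A. holo_compatible c c')"

definition holo_chart ::
  "'x::topological_space set \<Rightarrow> ('x, complex^'v) chart set \<Rightarrow> ('x, complex^'v) chart \<Rightarrow> bool" where
  "holo_chart X A c \<longleftrightarrow> chart_on X c \<and> (\<forall>c'\<in>A. holo_compatible c c')"

text \<open>Applied to a holomorphic atlas, the next notion refers to the underlying real structure.\<close>

definition smooth_fun ::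
  "('x, 'e::euclidean_space) chart set \<Rightarrow> 'x set \<Rightarrow> ('x \<Rightarrow> complex) \<Rightarrow> bool" where
  "smooth_fun B U f \<longleftrightarrow> (\<forall>(V, \<kappa>)\<in>B. smooth_on (\<kappa> ` (U \<inter> V)) (f \<circ> inv_into V \<kappa>))"

definition holo_fun ::
  "('x, complex^'v) chart set \<Rightarrow> 'x set \<Rightarrow> ('x \<Rightarrow> complex) \<Rightarrow> bool" where
  "holo_fun A U f \<longleftrightarrow> (\<forall>(V, z)\<in>A. holo_on (z ` (U \<inter> V)) (f \<circ> inv_into V z))"

definition nbhd :: "'x::topological_space set \<Rightarrow> 'x \<Rightarrow> 'x set \<Rightarrow> bool" where
  "nbhd M p U \<longleftrightarrow> openin (top_of_set M) U \<and> p \<in> U"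

definition smooth_near ::
  "'x::topological_space set \<Rightarrow> ('x, 'e::euclidean_space) chart set \<Rightarrow> 'x \<Rightarrow> ('x \<Rightarrow> complex) \<Rightarrow> bool" where
  "smooth_near M B p f \<longleftrightarrow> (\<exists>U. nbhd M p U \<and> smooth_fun B U f)"

section \<open>Complexified tangent bundle\<close>

text \<open>Complex tangent vectors at \<open>p\<close> are the complex linear derivations of the algebra of germs of
  complex valued smooth functions. They take the value \<open>0\<close> on functions which are not smooth
  near \<open>p\<close>, so that equality of vectors is equality of HOL functions.\<close>

type_synonym 'x ctan = "('x \<Rightarrow> complex) \<Rightarrow> complex"

definition ctangent ::
  "'x::topological_space set \<Rightarrow> ('x, 'e::euclidean_space) chart set \<Rightarrow> 'x \<Rightarrow> 'x ctan set" where
  "ctangent M B p = {v.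
     (\<forall>f g. smooth_near M B p f \<and> smooth_near M B p g \<longrightarrow>
        v (\<lambda>x. f x + g x) = v f + v g \<and>
        v (\<lambda>x. f x * g x) = f p * v g + g p * v f \<and>
        ((\<exists>U. nbhd M p U \<and> (\<forall>x\<in>U. f x = g x)) \<longrightarrow> v f = v g)) \<and>
     (\<forall>c f. smooth_near M B p f \<longrightarrow> v (\<lambda>x. c * f x) = c * v f) \<and>
     (\<forall>f. \<not> smooth_near M B p f \<longrightarrow> v f = 0)}"

definition conj_ctan :: "'x ctan \<Rightarrow> 'x ctan" where
  "conj_ctan v = (\<lambda>f. cnj (v (\<lambda>x. cnj (f x))))"

definition vector_field ::
  "'x::topological_space set \<Rightarrow> ('x, 'e::euclidean_space) chart set \<Rightarrow> 'x set
    \<Rightarrow> ('x \<Rightarrow> 'x ctan) \<Rightarrow> bool" where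
  "vector_field M B U Z \<longleftrightarrow> (\<forall>q\<in>U. Z q \<in> ctangent M B q) \<and>
     (\<forall>V f. openin (top_of_set M) V \<and> V \<subseteq> U \<and> smooth_fun B V f \<longrightarrow> smooth_fun B V (\<lambda>q. Z q f))"

definition bundle_sections ::
  "'x::topological_space set \<Rightarrow> ('x, 'e::euclidean_space) chart set \<Rightarrow> ('x \<Rightarrow> 'x ctan set) \<Rightarrow> 'x set
    \<Rightarrow> ('x \<Rightarrow> 'x ctan) set" where
  "bundle_sections M B T U = {Z. vector_field M B U Z \<and> (\<forall>q\<in>U. Z q \<in> T q)}"

definition bracket ::
  "'x::topological_space set \<Rightarrow> ('x, 'e::euclidean_space) chart set
    \<Rightarrow> ('x \<Rightarrow> 'x ctan) \<Rightarrow> ('x \<Rightarrow> 'x ctan) \<Rightarrow> 'x \<Rightarrow> 'x ctan" where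
  "bracket M B Z Y = (\<lambda>q f. if smooth_near M B q f
     then Z q (\<lambda>r. Y r f) - Y q (\<lambda>r. Z r f) else 0)"

text \<open>Smooth complex subbundle of rank \<open>m\<close>: locally spanned by \<open>m\<close> pointwise linearly independent
  smooth complex vector fields.\<close>

definition smooth_subbundle ::
  "'x::topological_space set \<Rightarrow> ('x, 'e::euclidean_space) chart set \<Rightarrow> nat
    \<Rightarrow> ('x \<Rightarrow> 'x ctan set) \<Rightarrow> bool" where
  "smooth_subbundle M B m T \<longleftrightarrow> (\<forall>p\<in>M. \<exists>U Z. nbhd M p U \<and>
     (\<forall>i<m. vector_field M B U (Z i)) \<and>
     (\<forall>q\<in>U. T q = {v. \<exists>c. v = (\<lambda>f. \<Sum>i<m. c i * Z i q f)} \<and>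
        (\<forall>c. (\<forall>f. (\<Sum>i<m. c i * Z i q f) = 0) \<longrightarrow> (\<forall>i<m. c i = 0))))"

section \<open>CR manifolds\<close>

definition cr_manifold ::
  "'x::topological_space set \<Rightarrow> ('x, real^'k) chart set \<Rightarrow> ('x \<Rightarrow> 'x ctan set)
    \<Rightarrow> nat \<Rightarrow> nat \<Rightarrow> bool" where
  "cr_manifold M B T m d \<longleftrightarrow>
     smooth_atlas M B \<and> CARD('k) = 2 * m + d \<and>
     smooth_subbundle M B m T \<and>
     (\<forall>p\<in>M. T p \<inter> conj_ctan ` T p = {\<lambda>f. 0}) \<and>
     (\<forall>Z\<in>bundle_sections M B T M. \<forall>Y\<in>bundle_sections M B T M.
        bracket M B Z Y \<in> bundle_sections M B T M)"

text \<open>The derivation \<open>(\<partial>/\<partial>x\<^sub>j + \<i> \<partial>/\<partial>y\<^sub>j)/2\<close> at \<open>p\<close>, where \<open>z\<^sub>j = x\<^sub>j + \<i> y\<^sub>j\<close>.\<close>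

definition dzbar :: "('x, complex^'v) chart \<Rightarrow> 'x \<Rightarrow> 'v \<Rightarrow> 'x ctan" where
  "dzbar = (\<lambda>(W, z) p j f.
     let D = frechet_derivative (f \<circ> inv_into W z) (at (z p))
     in (D (axis j 1) + \<i> * D (axis j \<i>)) / 2)"

definition antiholo_tangent ::
  "'x::topological_space set \<Rightarrow> ('x, complex^'v) chart set \<Rightarrow> 'x \<Rightarrow> 'x ctan set" where
  "antiholo_tangent X A p = {w. \<exists>\<zeta>\<in>A. p \<in> fst \<zeta> \<and> (\<exists>c.
     w = (\<lambda>f. if smooth_near X A p f then \<Sum>j\<in>UNIV. c j * dzbar \<zeta> p j f else 0))}"

text \<open>Differential of the inclusion of a submanifold: a function on \<open>X\<close> is restricted to \<open>M\<close>,
  which is invisible since functions are total; only the convention for non-smooth functions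
  has to be adapted.\<close>

definition push_incl ::
  "'x::topological_space set \<Rightarrow> ('x, complex^'v) chart set \<Rightarrow> 'x \<Rightarrow> 'x ctan \<Rightarrow> 'x ctan" where
  "push_incl X A p v = (\<lambda>f. if smooth_near X A p f then v f else 0)"

definition cr_bundle ::
  "'x::topological_space set \<Rightarrow> ('x, complex^'v) chart set \<Rightarrow> 'x set \<Rightarrow> ('x, real^'k) chart set
    \<Rightarrow> 'x \<Rightarrow> 'x ctan set" where
  "cr_bundle X A M B p = {v \<in> ctangent M B p. push_incl X A p v \<in> antiholo_tangent X A p}"

text \<open>The inclusion is a smooth immersion; it is a topological embedding because \<open>M\<close> carries the
  subspace topology.\<close>

definition smooth_submanifold ::
  "'x::topological_space set \<Rightarrow> ('x, complex^'v) chart set \<Rightarrow> 'x set \<Rightarrow> ('x, real^'k) chart set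
    \<Rightarrow> bool" where
  "smooth_submanifold X A M B \<longleftrightarrow> M \<subseteq> X \<and> smooth_atlas M B \<and>
     (\<forall>(U, \<kappa>)\<in>B. \<forall>(W, z)\<in>A.
        smooth_on (\<kappa> ` (U \<inter> W)) (z \<circ> inv_into U \<kappa>) \<and>
        (\<forall>x\<in>\<kappa> ` (U \<inter> W). inj (frechet_derivative (z \<circ> inv_into U \<kappa>) (at x))))"

definition cr_submanifold ::
  "'x::topological_space set \<Rightarrow> ('x, complex^'v) chart set \<Rightarrow> 'x set \<Rightarrow> ('x, real^'k) chart set
    \<Rightarrow> nat \<Rightarrow> nat \<Rightarrow> bool" where
  "cr_submanifold X A M B m d \<longleftrightarrow>
     complex_manifold X A \<and> smooth_submanifold X A M B \<and>
     cr_manifold M B (cr_bundle X A M B) m d"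

section \<open>Distributions\<close>

definition test_fun :: "(real^'k) set \<Rightarrow> (real^'k \<Rightarrow> complex) set" where
  "test_fun \<Omega> = {\<psi>. smooth_on UNIV \<psi> \<and> compact (closure {x. \<psi> x \<noteq> 0}) \<and>
                     closure {x. \<psi> x \<noteq> 0} \<subseteq> \<Omega>}"

definition distribution_on ::
  "(real^'k) set \<Rightarrow> ((real^'k \<Rightarrow> complex) \<Rightarrow> complex) \<Rightarrow> bool" where
  "distribution_on \<Omega> u \<longleftrightarrow>
     (\<forall>\<psi>\<in>test_fun \<Omega>. \<forall>\<eta>\<in>test_fun \<Omega>. u (\<lambda>x. \<psi> x + \<eta> x) = u \<psi> + u \<eta>) \<and>
     (\<forall>c. \<forall>\<psi>\<in>test_fun \<Omega>. u (\<lambda>x. c * \<psi> x) = c * u \<psi>) \<and>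
     (\<forall>K. compact K \<and> K \<subseteq> \<Omega> \<longrightarrow> (\<exists>C N. \<forall>\<psi>\<in>test_fun K. \<forall>b.
        (\<forall>bs\<in>lists Basis. length bs \<le> N \<longrightarrow> (\<forall>x. cmod (iter_deriv bs \<psi> x) \<le> b)) \<longrightarrow>
        cmod (u \<psi>) \<le> C * b))"

text \<open>A distribution on a manifold (in the sense generalizing functions) is a family of
  distributions in the chart images, transforming like functions under changes of
  coordinates.\<close>

type_synonym ('x, 'k) mdistr = "('x, real^'k) chart \<Rightarrow> (real^'k \<Rightarrow> complex) \<Rightarrow> complex"

definition transport_test ::
  "'x set \<Rightarrow> ('x, real^'k) chart \<Rightarrow> ('x, real^'k) chart \<Rightarrow> (real^'k \<Rightarrow> complex) \<Rightarrow> real^'k \<Rightarrow> complex" where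
  "transport_test U = (\<lambda>(V, \<kappa>) (V', \<kappa>') \<psi> x.
     let \<tau> = \<kappa>' \<circ> inv_into V \<kappa> in
     if x \<in> \<kappa> ` (U \<inter> V \<inter> V')
     then \<psi> (\<tau> x) * of_real \<bar>det (matrix (frechet_derivative \<tau> (at x)))\<bar> else 0)"

definition mdistribution :: "('x, real^'k) chart set \<Rightarrow> 'x set \<Rightarrow> ('x, 'k) mdistr \<Rightarrow> bool" where
  "mdistribution B U u \<longleftrightarrow>
     (\<forall>(V, \<kappa>)\<in>B. distribution_on (\<kappa> ` (U \<inter> V)) (u (V, \<kappa>))) \<and>
     (\<forall>(V, \<kappa>)\<in>B. \<forall>(V', \<kappa>')\<in>B. \<forall>\<psi>\<in>test_fun (\<kappa>' ` (U \<inter> V \<inter> V')).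
        u (V', \<kappa>') \<psi> = u (V, \<kappa>) (transport_test U (V, \<kappa>) (V', \<kappa>') \<psi>))"

definition mdistr_of_fun :: "('x \<Rightarrow> complex) \<Rightarrow> ('x, 'k::finite) mdistr" where
  "mdistr_of_fun f = (\<lambda>(V, \<kappa>) \<psi>. LINT x|lborel. f (inv_into V \<kappa> x) * \<psi> x)"

text \<open>\<open>Z u = 0\<close> weakly: with \<open>Z = \<Sum> a\<^sub>j \<partial>\<^sub>j\<close> in a chart, where \<open>a\<^sub>j\<close> is \<open>Z\<close> applied to the \<open>j\<close>-th
  coordinate function, \<open>u\<close> annihilates \<open>\<Sum> \<partial>\<^sub>j (a\<^sub>j \<psi>)\<close> for all test functions \<open>\<psi>\<close>.\<close>

definition weakly_annihilates ::
  "('x, real^'k) chart set \<Rightarrow> 'x set \<Rightarrow> ('x \<Rightarrow> 'x ctan) \<Rightarrow> ('x, 'k) mdistr \<Rightarrow> bool" where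
  "weakly_annihilates B U Z u \<longleftrightarrow>
     (\<forall>(V, \<kappa>)\<in>B. \<forall>\<psi>\<in>test_fun (\<kappa> ` (U \<inter> V)).
        u (V, \<kappa>) (\<lambda>x. \<Sum>j\<in>UNIV. frechet_derivative
           (\<lambda>y. Z (inv_into V \<kappa> y) (\<lambda>q. of_real (\<kappa> q $ j)) * \<psi> y) (at x) (axis j 1)) = 0)"

section \<open>CR functions and CR distributions\<close>

text \<open>The three values stand for \<open>a = \<infinity>\<close>, \<open>a = 0\<close>, \<open>a = -\<infinity>\<close>.\<close>

datatype regularity = Smooth | Continuous | Distributional

datatype ('x, 'k::finite) gsection = Fn "'x \<Rightarrow> complex" | Ds "('x, 'k) mdistr"

fun cr_sections ::
  "'x::topological_space set \<Rightarrow> ('x, complex^'v) chart set \<Rightarrow> 'x set \<Rightarrow> ('x, real^'k) chart set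
    \<Rightarrow> regularity \<Rightarrow> 'x set \<Rightarrow> ('x, 'k) gsection set" where
  "cr_sections X A M B Smooth U = {Fn f |f. smooth_fun B U f \<and>
     (\<forall>Z\<in>bundle_sections M B (cr_bundle X A M B) U. \<forall>q\<in>U. Z q f = 0)}"
| "cr_sections X A M B Continuous U = {Fn f |f. continuous_on U f \<and>
     (\<forall>Z\<in>bundle_sections M B (cr_bundle X A M B) U. weakly_annihilates B U Z (mdistr_of_fun f))}"
| "cr_sections X A M B Distributional U = {Ds u |u. mdistribution B U u \<and>
     (\<forall>Z\<in>bundle_sections M B (cr_bundle X A M B) U. weakly_annihilates B U Z u)}"

text \<open>Equality of the restrictions to \<open>W\<close>.\<close>

definition fun_agree :: "'x set \<Rightarrow> ('x \<Rightarrow> complex) \<Rightarrow> ('x \<Rightarrow> complex) \<Rightarrow> bool" where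
  "fun_agree W f g \<longleftrightarrow> (\<forall>x\<in>W. f x = g x)"

fun sec_agree ::
  "('x, real^'k) chart set \<Rightarrow> 'x set \<Rightarrow> ('x, 'k) gsection \<Rightarrow> ('x, 'k) gsection \<Rightarrow> bool" where
  "sec_agree B W (Fn f) (Fn g) \<longleftrightarrow> fun_agree W f g"
| "sec_agree B W (Ds u) (Ds v) \<longleftrightarrow>
     (\<forall>(V, \<kappa>)\<in>B. \<forall>\<psi>\<in>test_fun (\<kappa> ` (W \<inter> V)). u (V, \<kappa>) \<psi> = v (V, \<kappa>) \<psi>)"
| "sec_agree B W _ _ \<longleftrightarrow> False"

fun sec_of_fun :: "regularity \<Rightarrow> ('x \<Rightarrow> complex) \<Rightarrow> ('x, 'k::finite) gsection" where
  "sec_of_fun Distributional f = Ds (mdistr_of_fun f)"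
| "sec_of_fun _ f = Fn f"

fun sec_add :: "('x, 'k::finite) gsection \<Rightarrow> ('x, 'k) gsection \<Rightarrow> ('x, 'k) gsection" where
  "sec_add (Fn f) (Fn g) = Fn (\<lambda>x. f x + g x)"
| "sec_add (Ds u) (Ds v) = Ds (\<lambda>\<kappa> \<psi>. u \<kappa> \<psi> + v \<kappa> \<psi>)"
| "sec_add _ _ = undefined"

fun sec_scale :: "complex \<Rightarrow> ('x, 'k::finite) gsection \<Rightarrow> ('x, 'k) gsection" where
  "sec_scale c (Fn f) = Fn (\<lambda>x. c * f x)"
| "sec_scale c (Ds u) = Ds (\<lambda>\<kappa> \<psi>. c * u \<kappa> \<psi>)"

fun sec_mult :: "('x, 'k::finite) gsection \<Rightarrow> ('x, 'k) gsection \<Rightarrow> ('x, 'k) gsection" where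
  "sec_mult (Fn f) (Fn g) = Fn (\<lambda>x. f x * g x)"
| "sec_mult _ _ = undefined"

section \<open>Germs\<close>

text \<open>\<open>S U\<close> is the set of sections over \<open>U\<close>, and \<open>ag W s t\<close> says that \<open>s\<close> and \<open>t\<close> have the same
  restriction to \<open>W\<close>. The stalk is the quotient of the set of local sections near \<open>p\<close> by
  equality near \<open>p\<close>.\<close>

type_synonym ('y, 's) germ = "('y set \<times> 's) set"

definition local_sections ::
  "'y::topological_space set \<Rightarrow> ('y set \<Rightarrow> 's set) \<Rightarrow> 'y \<Rightarrow> ('y set \<times> 's) set" where
  "local_sections Y S p = {(U, s). nbhd Y p U \<and> s \<in> S U}"

definition germ_rel ::
  "'y::topological_space set \<Rightarrow> ('y set \<Rightarrow> 's set) \<Rightarrow> ('y set \<Rightarrow> 's \<Rightarrow> 's \<Rightarrow> bool) \<Rightarrow> 'y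
    \<Rightarrow> ('y set \<times> 's) rel" where
  "germ_rel Y S ag p = {((U, s), (V, t)).
     (U, s) \<in> local_sections Y S p \<and> (V, t) \<in> local_sections Y S p \<and>
     (\<exists>W. nbhd Y p W \<and> W \<subseteq> U \<inter> V \<and> ag W s t)}"

definition stalk ::
  "'y::topological_space set \<Rightarrow> ('y set \<Rightarrow> 's set) \<Rightarrow> ('y set \<Rightarrow> 's \<Rightarrow> 's \<Rightarrow> bool) \<Rightarrow> 'y
    \<Rightarrow> ('y, 's) germ set" where
  "stalk Y S ag p = local_sections Y S p // germ_rel Y S ag p"

text \<open>Maps and operations on germs defined on representatives (\<open>R\<close> is the germ relation of the
  target).\<close>

definition germ_map ::
  "('z set \<times> 't) rel \<Rightarrow> ('y set \<Rightarrow> 'z set) \<Rightarrow> ('s \<Rightarrow> 't) \<Rightarrow> ('y, 's) germ \<Rightarrow> ('z, 't) germ" where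
  "germ_map R \<alpha> \<beta> G = (\<Union>(U, s)\<in>G. R `` {(\<alpha> U, \<beta> s)})"

definition germ_op ::
  "('y set \<times> 's) rel \<Rightarrow> ('s \<Rightarrow> 's \<Rightarrow> 's) \<Rightarrow> ('y, 's) germ \<Rightarrow> ('y, 's) germ \<Rightarrow> ('y, 's) germ" where
  "germ_op R opn G H = (\<Union>(U, s)\<in>G. \<Union>(V, t)\<in>H. R `` {(U \<inter> V, opn s t)})"

definition cr_germ_rel ::
  "'x::topological_space set \<Rightarrow> ('x, complex^'v) chart set \<Rightarrow> 'x set \<Rightarrow> ('x, real^'k) chart set
    \<Rightarrow> regularity \<Rightarrow> 'x \<Rightarrow> ('x set \<times> ('x, 'k) gsection) rel" where
  "cr_germ_rel X A M B a p = germ_rel M (cr_sections X A M B a) (sec_agree B) p"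

definition cr_stalk ::
  "'x::topological_space set \<Rightarrow> ('x, complex^'v) chart set \<Rightarrow> 'x set \<Rightarrow> ('x, real^'k) chart set
    \<Rightarrow> regularity \<Rightarrow> 'x \<Rightarrow> ('x, ('x, 'k) gsection) germ set" where
  "cr_stalk X A M B a p = stalk M (cr_sections X A M B a) (sec_agree B) p"

definition holo_stalk ::
  "'x::topological_space set \<Rightarrow> ('x, complex^'v) chart set \<Rightarrow> 'x
    \<Rightarrow> ('x, 'x \<Rightarrow> complex) germ set" where
  "holo_stalk X A p = stalk X (\<lambda>U. {f. holo_fun A U f}) fun_agree p"

definition Cn_germ_rel ::
  "complex^'n \<Rightarrow> ((complex^'n) set \<times> (complex^'n \<Rightarrow> complex)) rel" where
  "Cn_germ_rel q = germ_rel UNIV (\<lambda>D. {g. holo_on D g}) fun_agree q"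

definition Cn_stalk ::
  "complex^'n \<Rightarrow> (complex^'n, complex^'n \<Rightarrow> complex) germ set" where
  "Cn_stalk q = stalk UNIV (\<lambda>D. {g. holo_on D g}) fun_agree q"

section \<open>The maps compared in the theorem\<close>

text \<open>Linear independence over the complex numbers of the differentials at \<open>p\<close> of the restrictions
  to \<open>M\<close> of the functions \<open>h i\<close>.\<close>

definition differentials_independent ::
  "'x::topological_space set \<Rightarrow> ('x, real^'k) chart set \<Rightarrow> 'x \<Rightarrow> ('n::finite \<Rightarrow> 'x \<Rightarrow> complex) \<Rightarrow> bool" where
  "differentials_independent M B p h \<longleftrightarrow>
     (\<forall>c. (\<forall>v\<in>ctangent M B p. (\<Sum>i\<in>UNIV. c i * v (h i)) = 0) \<longrightarrow> (\<forall>i. c i = 0))"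

text \<open>The coordinates \<open>z\<^sub>1, ..., z\<^sub>n\<close>: an injection \<open>\<sigma>\<close> tells which coordinates come first in the
  chosen ordering.\<close>

definition coord_proj :: "('x \<Rightarrow> complex^'v) \<Rightarrow> ('n::finite \<Rightarrow> 'v::finite) \<Rightarrow> 'x \<Rightarrow> complex^'n" where
  "coord_proj z \<sigma> p = (\<chi> i. z p $ \<sigma> i)"

definition restriction_map ::
  "'x::topological_space set \<Rightarrow> ('x, complex^'v) chart set \<Rightarrow> 'x set \<Rightarrow> ('x, real^'k) chart set
    \<Rightarrow> regularity \<Rightarrow> 'x \<Rightarrow> ('x, 'x \<Rightarrow> complex) germ \<Rightarrow> ('x, ('x, 'k) gsection) germ" where
  "restriction_map X A M B a p =
     germ_map (cr_germ_rel X A M B a p) (\<lambda>W. M \<inter> W) (sec_of_fun a)"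

definition pullback_map ::
  "'x::topological_space set \<Rightarrow> ('x, complex^'v) chart set \<Rightarrow> 'x set \<Rightarrow> ('x, real^'k) chart set
    \<Rightarrow> regularity \<Rightarrow> 'x \<Rightarrow> 'x set \<Rightarrow> ('x \<Rightarrow> complex^'n)
    \<Rightarrow> (complex^'n, complex^'n \<Rightarrow> complex) germ \<Rightarrow> ('x, ('x, 'k) gsection) germ" where
  "pullback_map X A M B a p U \<phi> =
     germ_map (cr_germ_rel X A M B a p) (\<lambda>D. U \<inter> \<phi> -` D) (\<lambda>g. sec_of_fun a (g \<circ> \<phi>))"

text \<open>Isomorphism of complex vector spaces, and of rings when the target is a ring, that is,
  except for distributions.\<close>

definition pullback_iso ::
  "'x::topological_space set \<Rightarrow> ('x, complex^'v) chart set \<Rightarrow> 'x set \<Rightarrow> ('x, real^'k) chart set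
    \<Rightarrow> regularity \<Rightarrow> 'x \<Rightarrow> 'x set \<Rightarrow> ('x \<Rightarrow> complex^'n) \<Rightarrow> bool" where
  "pullback_iso X A M B a p U \<phi> \<longleftrightarrow>
     (let R = cr_germ_rel X A M B a p; Q = Cn_germ_rel (\<phi> p); Hol = Cn_stalk (\<phi> p);
          \<Phi> = pullback_map X A M B a p U \<phi>
      in bij_betw \<Phi> Hol (cr_stalk X A M B a p) \<and>
         (\<forall>G\<in>Hol. \<forall>H\<in>Hol. \<Phi> (germ_op Q (\<lambda>f g x. f x + g x) G H) = germ_op R sec_add (\<Phi> G) (\<Phi> H)) \<and>
         (\<forall>c. \<forall>G\<in>Hol. \<Phi> (germ_map Q (\<lambda>D. D) (\<lambda>f x. c * f x) G)
                     = germ_map R (\<lambda>U. U) (sec_scale c) (\<Phi> G)) \<and>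
         (a \<noteq> Distributional \<longrightarrow>
           (\<forall>G\<in>Hol. \<forall>H\<in>Hol. \<Phi> (germ_op Q (\<lambda>f g x. f x * g x) G H)
                          = germ_op R sec_mult (\<Phi> G) (\<Phi> H))))"

end

theory Submission
  imports Defs "HOL-Complex_Analysis.Cauchy_Integral_Formula"
begin

text \<open>That \<open>\<phi>\<^sup>*\<close> onto implies restriction onto is clear, and \<open>\<phi>\<^sup>*\<close> is injective because the components of
  \<open>d\<phi>\<close> are linearly independent on \<open>M\<close>: if \<open>g \<circ> \<phi> = 0\<close> then all first partial derivatives of \<open>g\<close>, and
  inductively all derivatives, vanish on \<open>\<phi>(M)\<close>.

  Conversely let restriction be onto. Write \<open>dz\<^sub>l = \<Sum>\<^sub>j c\<^sub>j\<^sub>l d\<phi>\<^sub>j\<close> on \<open>M\<close>. From \<open>d\<^sup>2 = 0\<close> the coefficients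
  \<open>c\<^sub>j\<^sub>l\<close> are smooth CR functions, so by hypothesis they are restrictions of holomorphic functions \<open>F\<^sub>j\<^sub>l\<close>.
  With \<open>D\<^sub>j = \<Sum>\<^sub>l F\<^sub>j\<^sub>l \<partial>/\<partial>z\<^sub>l\<close> every holomorphic \<open>f\<close> satisfies \<open>d(f|M) = \<Sum>\<^sub>j (D\<^sub>j f)|M d\<phi>\<^sub>j\<close>, and the
  \<open>D\<^sub>j\<close> commute along \<open>M\<close>. Cauchy estimates bound the iterated \<open>D\<^sub>J f\<close> by \<open>C\<^sup>k k!\<close>, where \<open>k = |J|\<close>, so that
  \<open>h(\<zeta>) = \<Sum>\<^sub>k 1/k! \<Sum>\<^bsub>|J| = k\<^esub> D\<^sub>J f(p\<^sub>0) \<zeta>\<^sup>J\<close> converges near \<open>0\<close>. Moving the centre of this Taylor expansion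
  from \<open>p\<^sub>0\<close> along \<open>M\<close> to a nearby point \<open>q\<close>, while evaluating at the fixed point \<open>\<phi>(q)\<close>, does not change
  its value, because the differentials of its terms telescope; hence \<open>f(q) = h(\<phi>(q))\<close>.\<close>

text \<open>The three values of \<open>a\<close> can be treated together because surjectivity is
  applied only to the given germ and to the coefficients \<open>c_jl\<close>, which are smooth: a
  smooth CR function defines a section for every \<open>a\<close>, and two smooth functions defining
  the same section agree pointwise. For distributions this rests on integration by parts, the change
  of variables formula and bump functions. The Taylor argument is shaped by the fact that the
  \<open>D_j\<close> are known to commute only at points of \<open>M\<close>. So the centre moves
  only along \<open>M\<close>, while the bounds come from Cauchy estimates on balls of the ambient
  space. The factor \<open>k!\<close> arises because \<open>k\<close> nested estimates share one
  radius, each using a part of size proportional to \<open>1/k\<close>, and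
  \<open>k^k \<le> k! e^k\<close>. For a partial sum, moving the centre is not exact: telescoping
  leaves the differential of the highest term. It is of size \<open>2^-N\<close> near
  \<open>p\<^sub>0\<close>, so the mean value inequality on a convex ball and the limit give the
  equality. With the centre at \<open>q\<close> itself the sum is just \<open>f(q)\<close>.\<close>

unbundle no fps_syntax

section \<open>Calculus of smooth functions\<close>

abbreviation ddir :: "('a::real_normed_vector \<Rightarrow> 'b::real_normed_vector) \<Rightarrow> 'a \<Rightarrow> 'a \<Rightarrow> 'b" where
  "ddir f b \<equiv> (\<lambda>x. frechet_derivative f (at x) b)"

lemma has_derivative_frechet:
  "f differentiable (at x) \<Longrightarrow> (f has_derivative (\<lambda>v. ddir f v x)) (at x)"
  using frechet_derivative_works by fastforce

lemma ddir_eq: "(f has_derivative f') (at x) \<Longrightarrow> ddir f v x = f' v"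
  using frechet_derivative_at by force

lemma iter_deriv_snoc: "iter_deriv (bs @ [b]) f = iter_deriv bs (ddir f b)"
  by (induction bs) auto

lemma lists_snoc_cases:
  assumes "bs \<in> lists A" "bs \<noteq> []"
  obtains cs b where "bs = cs @ [b]" "cs \<in> lists A" "b \<in> A"
  using assms by (metis append_in_lists_conv lists.cases list.distinct(1) list.inject rev_exhaust)

section \<open>Finite orders of differentiability and their closure properties\<close>

text \<open>\<open>iter_deriv\<close> adds derivatives on the outside, whereas here the innermost
  derivative is split off first; \<open>iter_deriv_snoc\<close> reconciles the two. This order
  permits induction on \<open>n\<close> for all functions at once, since the derivative of a sum,
  product or composite is again built from functions of the same kind.\<close>

primrec diff_times :: "nat \<Rightarrow> 'a::euclidean_space set \<Rightarrow> ('a \<Rightarrow> 'b::real_normed_vector) \<Rightarrow> bool" where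
  "diff_times 0 S f \<longleftrightarrow> (\<forall>x\<in>S. f differentiable (at x))"
| "diff_times (Suc n) S f \<longleftrightarrow>
     (\<forall>x\<in>S. f differentiable (at x)) \<and> (\<forall>b\<in>Basis. diff_times n S (ddir f b))"

lemma diff_times_iff:
  "diff_times n S f \<longleftrightarrow>
     (\<forall>bs\<in>lists Basis. length bs \<le> n \<longrightarrow> (\<forall>x\<in>S. iter_deriv bs f differentiable (at x)))"
proof (induction n arbitrary: f)
  case (Suc n)
  show ?case (is "?L \<longleftrightarrow> ?R")
  proof
    assume L: ?L
    show ?R
    proof (intro ballI impI)
      fix bs :: "'a list" and x assume bs: "bs \<in> lists Basis" "length bs \<le> Suc n" "x \<in> S"
      show "iter_deriv bs f differentiable (at x)"
      proof (cases "bs = []")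
        case False
        then obtain cs b where cs: "bs = cs @ [b]" "cs \<in> lists Basis" "b \<in> Basis"
          using bs lists_snoc_cases by metis
        then show ?thesis using L Suc.IH[of "ddir f b"] bs by (auto simp: iter_deriv_snoc)
      qed (use L bs in auto)
    qed
  next
    assume R: ?R
    have "diff_times n S (ddir f b)" if "b \<in> Basis" for b
      unfolding Suc.IH
    proof (intro ballI impI)
      fix bs :: "'a list" and x assume bs: "bs \<in> lists Basis" "length bs \<le> n" "x \<in> S"
      then show "iter_deriv bs (ddir f b) differentiable (at x)"
        using R[rule_format, of "bs @ [b]" x] that by (auto simp: iter_deriv_snoc)
    qed
    moreover have "f differentiable (at x)" if "x \<in> S" for x
      using R[rule_format, of "[]" x] that by auto
    ultimately show ?L by auto
  qed
qed auto

lemma smooth_on_iff: "smooth_on S f \<longleftrightarrow> (\<forall>n. diff_times n S f)"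
  unfolding smooth_on_def diff_times_iff by blast

lemma smooth_on_differentiable: "smooth_on S f \<Longrightarrow> x \<in> S \<Longrightarrow> f differentiable (at x)"
  unfolding smooth_on_iff by (metis diff_times.simps(1))

lemma smooth_on_ddir: "smooth_on S f \<Longrightarrow> b \<in> Basis \<Longrightarrow> smooth_on S (ddir f b)"
  unfolding smooth_on_iff by (metis diff_times.simps(2))

lemma smooth_on_continuous_on: "smooth_on S f \<Longrightarrow> continuous_on S f"
  by (meson continuous_at_imp_continuous_on differentiable_imp_continuous_within
      smooth_on_differentiable)

lemma smooth_on_subset: "smooth_on S f \<Longrightarrow> T \<subseteq> S \<Longrightarrow> smooth_on T f"
  unfolding smooth_on_def by blast

lemma smooth_on_local:
  assumes "\<And>x. x \<in> S \<Longrightarrow> \<exists>T. x \<in> T \<and> smooth_on T f"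
  shows "smooth_on S f"
  unfolding smooth_on_def by (metis assms smooth_on_def)

lemma diff_times_lower: "diff_times (Suc n) S f \<Longrightarrow> diff_times n S f"
  unfolding diff_times_iff by simp

lemma ddir_cong:
  assumes "open S" "x \<in> S" "\<And>y. y \<in> S \<Longrightarrow> f y = g y"
  shows "ddir f b x = ddir g b x"
proof -
  have "(f has_derivative f') (at x) \<longleftrightarrow> (g has_derivative f') (at x)" for f'
    using assms by (metis has_derivative_transform_within_open)
  then show ?thesis unfolding frechet_derivative_def by simp
qed

lemma differentiable_cong_open:
  assumes "open S" "x \<in> S" "\<And>y. y \<in> S \<Longrightarrow> f y = g y" "f differentiable (at x)"
  shows "g differentiable (at x)"
  using assms unfolding differentiable_def by (metis has_derivative_transform_within_open)

lemma diff_times_cong: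
  assumes "open S" "\<And>y. y \<in> S \<Longrightarrow> f y = g y" "diff_times n S f"
  shows "diff_times n S g"
  using assms(2,3)
proof (induction n arbitrary: f g)
  case 0
  then show ?case using differentiable_cong_open[OF \<open>open S\<close>, of _ f g] by auto
next
  case (Suc n)
  have "diff_times n S (ddir g b)" if "b \<in> Basis" for b
  proof (rule Suc.IH[of "ddir f b"])
    show "ddir f b y = ddir g b y" if "y \<in> S" for y
      using ddir_cong[OF \<open>open S\<close> that, of f g b] Suc.prems(1) by simp
    show "diff_times n S (ddir f b)" using Suc.prems(2) that by simp
  qed
  then show ?case using Suc.prems differentiable_cong_open[OF \<open>open S\<close>, of _ f g] by simp
qed

lemma smooth_on_cong:
  "open S \<Longrightarrow> (\<And>y. y \<in> S \<Longrightarrow> f y = g y) \<Longrightarrow> smooth_on S f \<Longrightarrow> smooth_on S g"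
  unfolding smooth_on_iff using diff_times_cong by blast

text \<open>The induction step in most closure proofs: \<open>f'\<close> may be any formula for the
  differential, and only its values on \<open>Basis\<close> have to be examined at order
  \<open>n\<close>.\<close>

lemma diff_times_SucI:
  assumes S: "open S" and D: "\<And>x. x \<in> S \<Longrightarrow> (f has_derivative f' x) (at x)"
    and n: "\<And>b. b \<in> Basis \<Longrightarrow> diff_times n S (\<lambda>x. f' x b)"
  shows "diff_times (Suc n) S f"
proof -
  have "diff_times n S (ddir f b)" if "b \<in> Basis" for b
    by (rule diff_times_cong[OF S _ n[OF that]]) (simp add: ddir_eq[OF D])
  then show ?thesis using D by (auto simp: differentiable_def)
qed

lemma diff_times_const: "diff_times n S (\<lambda>x. c)"
  by (induction n arbitrary: c) auto

lemma smooth_on_const [simp]: "smooth_on S (\<lambda>x. c)"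
  by (simp add: smooth_on_iff diff_times_const)

lemma diff_times_add:
  assumes "open S" "diff_times n S f" "diff_times n S g"
  shows "diff_times n S (\<lambda>x. f x + g x)"
  using assms(2,3)
proof (induction n arbitrary: f g)
  case (Suc n)
  then have "((\<lambda>x. f x + g x) has_derivative (\<lambda>v. ddir f v x + ddir g v x)) (at x)" if "x \<in> S" for x
    using that by (auto intro!: has_derivative_add has_derivative_frechet)
  then show ?case by (rule diff_times_SucI[OF assms(1)]) (use Suc in auto)
qed auto

lemma smooth_on_add:
  "open S \<Longrightarrow> smooth_on S f \<Longrightarrow> smooth_on S g \<Longrightarrow> smooth_on S (\<lambda>x. f x + g x)"
  by (simp add: smooth_on_iff diff_times_add)

lemma smooth_on_sum:
  "open S \<Longrightarrow> (\<And>i. i \<in> I \<Longrightarrow> smooth_on S (f i)) \<Longrightarrow> smooth_on S (\<lambda>x. \<Sum>i\<in>I. f i x)"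
  by (induction I rule: infinite_finite_induct) (auto intro: smooth_on_add)

lemma diff_times_bounded_linear:
  assumes "open S" "bounded_linear L" "diff_times n S f"
  shows "diff_times n S (\<lambda>x. L (f x))"
  using assms(3)
proof (induction n arbitrary: f)
  case 0
  then show ?case
    using bounded_linear.has_derivative[OF assms(2)] unfolding diff_times.simps differentiable_def by blast
next
  case (Suc n)
  then have "((\<lambda>x. L (f x)) has_derivative (\<lambda>v. L (ddir f v x))) (at x)" if "x \<in> S" for x
    using that by (auto intro!: bounded_linear.has_derivative[OF assms(2)] has_derivative_frechet)
  then show ?case by (rule diff_times_SucI[OF assms(1)]) (use Suc in auto)
qed

lemma smooth_on_bounded_linear_comp:
  "open S \<Longrightarrow> bounded_linear L \<Longrightarrow> smooth_on S f \<Longrightarrow> smooth_on S (\<lambda>x. L (f x))"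
  by (simp add: smooth_on_iff diff_times_bounded_linear)

lemma diff_times_ident: "diff_times n S (\<lambda>x. x)"
  by (cases n) (auto intro: diff_times_const)

lemma smooth_on_ident [simp]: "smooth_on S (\<lambda>x. x)"
  by (simp add: smooth_on_iff diff_times_ident)

lemma diff_times_bilinear:
  assumes "open S" and B: "bounded_bilinear B" and "diff_times n S f" "diff_times n S g"
  shows "diff_times n S (\<lambda>x. B (f x) (g x))"
  using assms(3,4)
proof (induction n arbitrary: f g)
  case 0
  show ?case unfolding diff_times.simps
  proof
    fix x assume "x \<in> S"
    then have "((\<lambda>x. B (f x) (g x)) has_derivative
         (\<lambda>v. B (f x) (ddir g v x) + B (ddir f v x) (g x))) (at x)"
      using 0 by (auto intro!: bounded_bilinear.FDERIV[OF B] has_derivative_frechet)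
    then show "(\<lambda>x. B (f x) (g x)) differentiable (at x)"
      unfolding differentiable_def by blast
  qed
next
  case (Suc n)
  then have "((\<lambda>x. B (f x) (g x)) has_derivative
         (\<lambda>v. B (f x) (ddir g v x) + B (ddir f v x) (g x))) (at x)" if "x \<in> S" for x
    using that by (auto intro!: bounded_bilinear.FDERIV[OF B] has_derivative_frechet)
  then show ?case
  proof (rule diff_times_SucI[OF assms(1)])
    fix b :: 'a assume b: "b \<in> Basis"
    \<comment> \<open>The product rule also contains the undifferentiated factors, so these are
      needed at order \<open>n\<close> as well.\<close>
    have "diff_times n S f" "diff_times n S g" using Suc.prems diff_times_lower by blast+
    then show "diff_times n S (\<lambda>x. B (f x) (ddir g b x) + B (ddir f b x) (g x))"
      using Suc b by (intro diff_times_add[OF assms(1)] Suc.IH) auto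
  qed
qed

lemma smooth_on_bilinear:
  "open S \<Longrightarrow> bounded_bilinear B \<Longrightarrow> smooth_on S f \<Longrightarrow> smooth_on S g
    \<Longrightarrow> smooth_on S (\<lambda>x. B (f x) (g x))"
  by (simp add: smooth_on_iff diff_times_bilinear)

lemma smooth_on_mult:
  fixes f g :: "'a::euclidean_space \<Rightarrow> 'b::real_normed_algebra"
  shows "open S \<Longrightarrow> smooth_on S f \<Longrightarrow> smooth_on S g \<Longrightarrow> smooth_on S (\<lambda>x. f x * g x)"
  by (rule smooth_on_bilinear[OF _ bounded_bilinear_mult])

lemma smooth_on_prod:
  fixes f :: "'i \<Rightarrow> 'a::euclidean_space \<Rightarrow> 'b::real_normed_field"
  shows "open S \<Longrightarrow> (\<And>i. i \<in> I \<Longrightarrow> smooth_on S (f i)) \<Longrightarrow> smooth_on S (\<lambda>x. \<Prod>i\<in>I. f i x)"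
  by (induction I rule: infinite_finite_induct) (auto intro: smooth_on_mult)

lemma smooth_on_minus:
  "open S \<Longrightarrow> smooth_on S f \<Longrightarrow> smooth_on S (\<lambda>x. - f x)"
  by (rule smooth_on_bounded_linear_comp[OF _ bounded_linear_minus[OF bounded_linear_ident]])

lemma smooth_on_diff:
  "open S \<Longrightarrow> smooth_on S f \<Longrightarrow> smooth_on S g \<Longrightarrow> smooth_on S (\<lambda>x. f x - g x)"
  using smooth_on_add[OF _ _ smooth_on_minus] by fastforce

lemma ddir_sum_Basis:
  assumes "f differentiable (at x)"
  shows "ddir f v x = (\<Sum>e\<in>Basis. (v \<bullet> e) *\<^sub>R ddir f e x)"
proof -
  have "linear (\<lambda>v. ddir f v x)" using linear_frechet_derivative[OF assms] by simp
  then have "ddir f (\<Sum>e\<in>Basis. (v \<bullet> e) *\<^sub>R e) x = (\<Sum>e\<in>Basis. (v \<bullet> e) *\<^sub>R ddir f e x)"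
    by (simp add: linear_sum linear_cmul)
  then show ?thesis by (simp add: euclidean_representation)
qed

lemma ddir_compose:
  assumes "g differentiable (at x)" "f differentiable (at (g x))"
  shows "ddir (\<lambda>x. f (g x)) v x = ddir f (ddir g v x) (g x)"
  by (rule ddir_eq)
     (rule has_derivative_compose[OF has_derivative_frechet[OF assms(1)]
        has_derivative_frechet[OF assms(2)]])

text \<open>\<open>diff_times\<close> controls partial derivatives along \<open>Basis\<close> only,
  so the chain rule is written as a sum of products of scalar components of the differential of
  \<open>g\<close> with \<open>ddir f e\<close> composed with \<open>g\<close>. The induction
  hypothesis applies to the latter, with the same \<open>g\<close> at lower order.\<close>

lemma diff_times_compose:
  fixes g :: "'a::euclidean_space \<Rightarrow> 'c::euclidean_space" and f :: "'c \<Rightarrow> 'b::real_normed_vector"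
  assumes S: "open S" and gT: "g ` S \<subseteq> T" and g: "diff_times n S g" and f: "diff_times n T f"
  shows "diff_times n S (\<lambda>x. f (g x))"
  using g f
proof (induction n arbitrary: f)
  case 0
  show ?case unfolding diff_times.simps
  proof
    fix x assume "x \<in> S"
    then show "(\<lambda>x. f (g x)) differentiable (at x)"
      using differentiable_chain_at[of g x f] 0 gT by (auto simp: o_def)
  qed
next
  case (Suc n)
  have D: "((\<lambda>x. f (g x)) has_derivative
       (\<lambda>v. \<Sum>e\<in>Basis. (ddir g v x \<bullet> e) *\<^sub>R ddir f e (g x))) (at x)" if x: "x \<in> S" for x
  proof -
    have d: "g differentiable (at x)" "f differentiable (at (g x))" using Suc.prems x gT by auto
    show ?thesis
      using has_derivative_compose[OF has_derivative_frechet[OF d(1)] has_derivative_frechet[OF d(2)]]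
      by (simp add: ddir_sum_Basis[OF d(2), of "ddir g _ x"])
  qed
  show ?case
  proof (rule diff_times_SucI[OF S D])
    fix b :: 'a assume b: "b \<in> Basis"
    have *: "diff_times n S (\<lambda>x. (ddir g b x \<bullet> e) *\<^sub>R ddir f e (g x))" if e: "e \<in> Basis" for e
    proof (rule diff_times_bilinear[OF S bounded_bilinear_scaleR])
      show "diff_times n S (\<lambda>x. ddir g b x \<bullet> e)"
        by (rule diff_times_bounded_linear[OF S bounded_linear_inner_left]) (use Suc.prems b in simp)
      show "diff_times n S (\<lambda>x. ddir f e (g x))"
        by (rule Suc.IH) (use Suc.prems e diff_times_lower in auto)
    qed
    have "diff_times n S (\<lambda>x. \<Sum>e\<in>E. (ddir g b x \<bullet> e) *\<^sub>R ddir f e (g x))"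
      if "finite E" "E \<subseteq> Basis" for E
      using that by (induction E) (auto intro!: diff_times_add[OF S] * diff_times_const)
    then show "diff_times n S (\<lambda>x. \<Sum>e\<in>Basis. (ddir g b x \<bullet> e) *\<^sub>R ddir f e (g x))"
      by simp
  qed
qed

lemma smooth_on_compose:
  fixes g :: "'a::euclidean_space \<Rightarrow> 'c::euclidean_space" and f :: "'c \<Rightarrow> 'b::real_normed_vector"
  shows "open S \<Longrightarrow> g ` S \<subseteq> T \<Longrightarrow> smooth_on S g \<Longrightarrow> smooth_on T f \<Longrightarrow> smooth_on S (\<lambda>x. f (g x))"
  by (simp add: smooth_on_iff diff_times_compose)

text \<open>The derivative of \<open>inverse\<close> is a polynomial in \<open>inverse\<close>, so
  the induction feeds on itself.\<close>

lemma smooth_on_inverse: "smooth_on (- {0}) (inverse :: complex \<Rightarrow> complex)"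
proof -
  have op: "open (- {0::complex})" by (simp add: open_Compl)
  have D: "((inverse :: complex \<Rightarrow> complex) has_derivative (\<lambda>v. - (inverse x * v * inverse x))) (at x)"
    if "x \<in> - {0}" for x
    using that has_derivative_inverse'[of x UNIV] by simp
  have "diff_times n (- {0}) (inverse :: complex \<Rightarrow> complex)" for n
  proof (induction n)
    case 0
    then show ?case using D by (auto simp: differentiable_def)
  next
    case (Suc n)
    show ?case
    proof (rule diff_times_SucI[OF op D])
      fix b :: complex
      have "bounded_linear (\<lambda>x. - (x * b))"
        by (rule bounded_linear_minus[OF bounded_linear_mult_left])
      from diff_times_bounded_linear[OF op this diff_times_bilinear[OF op bounded_bilinear_mult Suc Suc]]
      show "diff_times n (- {0}) (\<lambda>x. - (inverse x * b * inverse x))"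
        by (simp add: mult_ac)
    qed auto
  qed
  then show ?thesis by (simp add: smooth_on_iff)
qed

lemma smooth_on_divide:
  fixes f g :: "'a::euclidean_space \<Rightarrow> complex"
  assumes "open S" "smooth_on S f" "smooth_on S g" "\<And>x. x \<in> S \<Longrightarrow> g x \<noteq> 0"
  shows "smooth_on S (\<lambda>x. f x / g x)"
proof -
  have "smooth_on S (\<lambda>x. inverse (g x))"
    by (rule smooth_on_compose[OF _ _ _ smooth_on_inverse]) (use assms in auto)
  then show ?thesis using smooth_on_mult[OF assms(1,2)] by (simp add: divide_inverse)
qed

lemma bounded_linear_axis: "bounded_linear (axis i :: 'b::real_normed_vector \<Rightarrow> 'b^'n)"
proof (rule bounded_linear_intro[where K=1])
  show "norm (axis i x :: 'b^'n) \<le> norm x * 1" for x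
  proof -
    have "norm (axis i x :: 'b^'n) \<le> (\<Sum>j\<in>UNIV. norm ((axis i x :: 'b^'n) $ j))"
      unfolding norm_vec_def by (rule L2_set_le_sum) simp
    also have "\<dots> = (\<Sum>j\<in>UNIV. if j = i then norm x else 0)"
      by (rule sum.cong) (auto simp: axis_def)
    finally show ?thesis by simp
  qed
qed (auto simp: vec_eq_iff axis_def)

lemma smooth_on_vec_nth:
  "open S \<Longrightarrow> smooth_on S f \<Longrightarrow> smooth_on S (\<lambda>x. f x $ i)"
  by (rule smooth_on_bounded_linear_comp[OF _ bounded_linear_vec_nth])

lemma vec_sum_axis: "(\<Sum>i\<in>UNIV. axis i (y $ i)) = (y :: 'b::real_normed_vector^'n)"
  by (simp add: vec_eq_iff axis_def)

lemma smooth_on_vecI: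
  fixes f :: "'a::euclidean_space \<Rightarrow> 'b::euclidean_space^'n"
  assumes "open S" "\<And>i. smooth_on S (\<lambda>x. f x $ i)"
  shows "smooth_on S f"
proof -
  have "smooth_on S (\<lambda>x. \<Sum>i\<in>UNIV. axis i (f x $ i))"
    by (intro smooth_on_sum smooth_on_bounded_linear_comp[OF _ bounded_linear_axis] assms)
  then show ?thesis by (simp add: vec_sum_axis)
qed

lemma smooth_on_det:
  fixes f :: "'a::euclidean_space \<Rightarrow> 'b::{real_normed_field,euclidean_space}^'n^'n"
  assumes "open S" "\<And>i j. smooth_on S (\<lambda>x. f x $ i $ j)"
  shows "smooth_on S (\<lambda>x. det (f x))"
  unfolding det_def
  by (intro smooth_on_sum smooth_on_mult smooth_on_prod smooth_on_const assms)

text \<open>Both iterated derivatives are limits of the same second difference quotient.\<close>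

lemma second_difference_bound:
  fixes f :: "'a::real_normed_vector \<Rightarrow> 'b::real_normed_vector"
  assumes S: "open S" and x: "x \<in> S" and f: "\<And>y. y \<in> S \<Longrightarrow> f differentiable (at y)"
    and d: "ddir f a differentiable (at x)" and e: "e > 0"
  shows "\<forall>\<^sub>F h in at_right 0. norm (f (x + h *\<^sub>R a + h *\<^sub>R b) - f (x + h *\<^sub>R a) - f (x + h *\<^sub>R b) + f x
            - (h * h) *\<^sub>R ddir (ddir f a) b x) \<le> e * (h * h)"
proof -
  \<comment> \<open>Dominates the displacement \<open>2 * norm a + norm b\<close> per unit of
    \<open>h\<close> that the two error terms below add up to; the summand \<open>1\<close> keeps it
    positive when \<open>a = b = 0\<close>.\<close>
  define K where "K = 2 * norm a + 2 * norm b + 1"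
  have K: "K > 0" by (auto simp: K_def add_nonneg_pos)
  define D where "D = (\<lambda>v. ddir (ddir f a) v x)"
  have Dd: "(ddir f a has_derivative D) (at x)" unfolding D_def by (rule has_derivative_frechet[OF d])
  then have lin: "linear D" by (rule has_derivative_linear)
  obtain r where r: "r > 0" "ball x r \<subseteq> S" using S x openE by blast
  have "e / K > 0" using e K by simp
  then obtain s where s: "s > 0" "\<And>y. norm (y - x) < s \<Longrightarrow>
      norm (ddir f a y - ddir f a x - D (y - x)) \<le> e / K * norm (y - x)"
    using Dd unfolding has_derivative_at_alt by blast
  define \<delta> where "\<delta> = min r s / K"
  have \<delta>: "\<delta> > 0" using r s K by (simp add: \<delta>_def)
  have main: "norm (f (x + h *\<^sub>R a + h *\<^sub>R b) - f (x + h *\<^sub>R a) - f (x + h *\<^sub>R b) + f x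
            - (h * h) *\<^sub>R D b) \<le> e * (h * h)" if h: "0 < h" "h < \<delta>" for h
  proof -
    have nb: "norm (u *\<^sub>R a + h *\<^sub>R b) \<le> h * (norm a + norm b)" "norm (u *\<^sub>R a) \<le> h * norm a"
      if u: "u \<in> {0..h}" for u
    proof -
      show "norm (u *\<^sub>R a) \<le> h * norm a" using u by (auto intro: mult_right_mono)
      then show "norm (u *\<^sub>R a + h *\<^sub>R b) \<le> h * (norm a + norm b)"
        using norm_triangle_ineq[of "u *\<^sub>R a" "h *\<^sub>R b"] h by (simp add: algebra_simps)
    qed
    have hK: "h * K < min r s" using h K by (simp add: \<delta>_def field_simps)
    have le: "h * (norm a + norm b) \<le> h * K" "h * norm a \<le> h * K"
      using h by (auto simp: K_def intro!: mult_left_mono)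
    have in_r: "norm (u *\<^sub>R a + h *\<^sub>R b) < r" "norm (u *\<^sub>R a + h *\<^sub>R b) < s"
      "norm (u *\<^sub>R a) < r" "norm (u *\<^sub>R a) < s" if "u \<in> {0..h}" for u
      using nb[OF that] hK le by linarith+
    have inS: "x + u *\<^sub>R a + h *\<^sub>R b \<in> S" "x + u *\<^sub>R a \<in> S" if "u \<in> {0..h}" for u
    proof -
      have "x + u *\<^sub>R a + h *\<^sub>R b \<in> ball x r"
        using in_r(1)[OF that] norm_minus_cancel[of "u *\<^sub>R a + h *\<^sub>R b"]
        by (simp add: dist_norm add.assoc)
      moreover have "x + u *\<^sub>R a \<in> ball x r" using in_r(3)[OF that] by (simp add: dist_norm)
      ultimately show "x + u *\<^sub>R a + h *\<^sub>R b \<in> S" "x + u *\<^sub>R a \<in> S" using r by auto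
    qed
    \<comment> \<open>\<open>g h - g 0\<close> is the second difference minus
      \<open>(h * h) *\<^sub>R D b\<close>. Its derivative \<open>g' u\<close> compares
      \<open>ddir f a\<close> at two points, and both values are known up to \<open>o(h)\<close>
      from differentiability at \<open>x\<close> alone.\<close>
    define g where "g = (\<lambda>u. f (x + u *\<^sub>R a + h *\<^sub>R b) - f (x + u *\<^sub>R a) - (u * h) *\<^sub>R D b)"
    define g' where "g' = (\<lambda>u. ddir f a (x + u *\<^sub>R a + h *\<^sub>R b) - ddir f a (x + u *\<^sub>R a) - h *\<^sub>R D b)"
    have gd: "(g has_derivative (\<lambda>v. v *\<^sub>R g' u)) (at u within {0..h})" if u: "u \<in> {0..h}" for u
    proof -
      have lf: "linear (\<lambda>v. ddir f v y)" if "y \<in> S" for y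
        using linear_frechet_derivative[OF f[OF that]] by simp
      have 1: "((\<lambda>u. f (x + u *\<^sub>R a + h *\<^sub>R b)) has_derivative
              (\<lambda>v. ddir f (v *\<^sub>R a) (x + u *\<^sub>R a + h *\<^sub>R b))) (at u within {0..h})"
        by (rule has_derivative_compose[where g=f and f="\<lambda>u. x + u *\<^sub>R a + h *\<^sub>R b",
              OF _ has_derivative_frechet[OF f[OF inS(1)[OF u]]]])
           (auto intro!: derivative_eq_intros)
      have 2: "((\<lambda>u. f (x + u *\<^sub>R a)) has_derivative
              (\<lambda>v. ddir f (v *\<^sub>R a) (x + u *\<^sub>R a))) (at u within {0..h})"
        by (rule has_derivative_compose[where g=f and f="\<lambda>u. x + u *\<^sub>R a",
              OF _ has_derivative_frechet[OF f[OF inS(2)[OF u]]]])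
           (auto intro!: derivative_eq_intros)
      have 3: "((\<lambda>u. (u * h) *\<^sub>R D b) has_derivative (\<lambda>v. (v * h) *\<^sub>R D b)) (at u within {0..h})"
        by (auto intro!: derivative_eq_intros)
      show ?thesis
        unfolding g_def
        using has_derivative_diff[OF has_derivative_diff[OF 1 2] 3] lf[OF inS(1)[OF u]] lf[OF inS(2)[OF u]]
        by (simp add: linear_cmul g'_def scaleR_diff_right)
    qed
    have g'b: "norm (g' u) \<le> e * h" if u: "u \<in> {0..h}" for u
    proof -
      have A: "norm (ddir f a (x + u *\<^sub>R a + h *\<^sub>R b) - ddir f a x - D (u *\<^sub>R a + h *\<^sub>R b))
             \<le> e / K * norm (u *\<^sub>R a + h *\<^sub>R b)"
        using s(2)[of "x + u *\<^sub>R a + h *\<^sub>R b"] in_r(2)[OF u] by (simp add: add.assoc)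
      have B: "norm (ddir f a (x + u *\<^sub>R a) - ddir f a x - D (u *\<^sub>R a)) \<le> e / K * norm (u *\<^sub>R a)"
        using s(2)[of "x + u *\<^sub>R a"] in_r(4)[OF u] by simp
      have eq: "g' u = (ddir f a (x + u *\<^sub>R a + h *\<^sub>R b) - ddir f a x - D (u *\<^sub>R a + h *\<^sub>R b))
            - (ddir f a (x + u *\<^sub>R a) - ddir f a x - D (u *\<^sub>R a))"
        using lin by (simp add: g'_def linear_add linear_cmul)
      have "norm (g' u) \<le> e / K * norm (u *\<^sub>R a + h *\<^sub>R b) + e / K * norm (u *\<^sub>R a)"
        unfolding eq using norm_triangle_ineq4 A B by (meson add_mono order_trans)
      also have "\<dots> \<le> e / K * (h * (norm a + norm b)) + e / K * (h * norm a)"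
        using nb[OF u] e K by (intro add_mono mult_left_mono) auto
      also have "\<dots> = e / K * h * (2 * norm a + norm b)" by (simp add: algebra_simps)
      also have "\<dots> \<le> e / K * h * K" using e K h by (intro mult_left_mono) (auto simp: K_def)
      also have "\<dots> = e * h" using K by simp
      finally show ?thesis .
    qed
    have "norm (g h - g 0) \<le> e * h * norm (h - 0)"
    proof (rule differentiable_bound[OF _ gd])
      show "onorm (\<lambda>v. v *\<^sub>R g' u) \<le> e * h" if "u \<in> {0..h}" for u
        using mult_left_mono[OF g'b[OF that], of "\<bar>x\<bar>" for x]
        by (intro onorm_le) (simp add: mult_ac)
    qed (use h in auto)
    then show ?thesis using h by (simp add: g_def algebra_simps)
  qed
  show ?thesis
    unfolding eventually_at_right_field using \<delta> main unfolding D_def by (auto intro!: exI[of _ \<delta>])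
qed

lemma ddir_commute:
  fixes f :: "'a::real_normed_vector \<Rightarrow> 'b::real_normed_vector"
  assumes S: "open S" and x: "x \<in> S" and f: "\<And>y. y \<in> S \<Longrightarrow> f differentiable (at y)"
    and d: "ddir f a differentiable (at x)" "ddir f b differentiable (at x)"
  shows "ddir (ddir f a) b x = ddir (ddir f b) a x"
proof (rule ccontr)
  assume ne: "\<not> ?thesis"
  define w where "w = ddir (ddir f a) b x - ddir (ddir f b) a x"
  \<comment> \<open>The common difference quotient lies within \<open>e\<close> of each mixed
    derivative, whence \<open>norm w \<le> 2 * e\<close>; a quarter of \<open>norm w\<close> makes
    this impossible.\<close>
  define e where "e = norm w / 4"
  have e: "e > 0" using ne by (simp add: e_def w_def)
  have ev: "\<forall>\<^sub>F h in at_right (0::real). h > 0" by (simp add: eventually_at_right_less)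
  have "\<forall>\<^sub>F h in at_right 0. h > 0 \<and>
     norm (f (x + h *\<^sub>R a + h *\<^sub>R b) - f (x + h *\<^sub>R a) - f (x + h *\<^sub>R b) + f x
            - (h * h) *\<^sub>R ddir (ddir f a) b x) \<le> e * (h * h) \<and>
     norm (f (x + h *\<^sub>R b + h *\<^sub>R a) - f (x + h *\<^sub>R b) - f (x + h *\<^sub>R a) + f x
            - (h * h) *\<^sub>R ddir (ddir f b) a x) \<le> e * (h * h)"
    by (intro eventually_conj ev second_difference_bound[OF S x _ d(1) e]
        second_difference_bound[OF S x _ d(2) e] f)
  then obtain h where h: "h > 0"
     "norm (f (x + h *\<^sub>R a + h *\<^sub>R b) - f (x + h *\<^sub>R a) - f (x + h *\<^sub>R b) + f x
            - (h * h) *\<^sub>R ddir (ddir f a) b x) \<le> e * (h * h)"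
     "norm (f (x + h *\<^sub>R b + h *\<^sub>R a) - f (x + h *\<^sub>R b) - f (x + h *\<^sub>R a) + f x
            - (h * h) *\<^sub>R ddir (ddir f b) a x) \<le> e * (h * h)"
    using eventually_happens[of _ "at_right (0::real)"] by auto
  define u where "u = f (x + h *\<^sub>R a + h *\<^sub>R b) - f (x + h *\<^sub>R a) - f (x + h *\<^sub>R b) + f x"
  have u2: "u = f (x + h *\<^sub>R b + h *\<^sub>R a) - f (x + h *\<^sub>R b) - f (x + h *\<^sub>R a) + f x"
    by (simp add: u_def algebra_simps)
  have "(h * h) * norm w = norm ((u - (h * h) *\<^sub>R ddir (ddir f b) a x) - (u - (h * h) *\<^sub>R ddir (ddir f a) b x))"
    using h(1) by (simp add: w_def flip: scaleR_diff_right)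
  also have "\<dots> \<le> e * (h * h) + e * (h * h)"
    using h(2,3) norm_triangle_ineq4 unfolding u_def[symmetric] u2[symmetric] by (meson add_mono order_trans)
  finally have "norm w \<le> 2 * e" using h(1) by simp
  then show False using e by (simp add: e_def)
qed

lemma smooth_on_ddir_commute:
  assumes "open S" "smooth_on S f" "x \<in> S" "a \<in> Basis" "b \<in> Basis"
  shows "ddir (ddir f a) b x = ddir (ddir f b) a x"
  using assms by (intro ddir_commute[of S])
    (auto intro: smooth_on_differentiable smooth_on_ddir)

section \<open>Integrals along segments and Hadamard's lemma\<close>

text \<open>The weight \<open>t ^ k\<close> makes the family closed under differentiation: the chain
  rule produces one further factor \<open>t\<close>, so the derivative has the same shape with
  \<open>Suc k\<close> and \<open>ddir F v\<close>.\<close>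

lemma has_derivative_segment_integral:
  fixes F :: "'a::euclidean_space \<Rightarrow> 'b::euclidean_space"
  assumes S: "open S" "convex S" and x0: "x0 \<in> S" and x: "x \<in> S"
    and F: "\<And>y. y \<in> S \<Longrightarrow> F differentiable (at y)"
    and cF: "\<And>e. e \<in> Basis \<Longrightarrow> continuous_on S (ddir F e)"
  shows "((\<lambda>x. integral {0..1} (\<lambda>t. t ^ k *\<^sub>R F (x0 + t *\<^sub>R (x - x0)))) has_derivative
          (\<lambda>v. integral {0..1} (\<lambda>t. t ^ Suc k *\<^sub>R ddir F v (x0 + t *\<^sub>R (x - x0))))) (at x)"
proof -
  \<comment> \<open>\<open>leibniz_rule\<close> asks for a differential that varies continuously in
    the space of bounded linear maps; it is assembled from the continuous partial
    derivatives.\<close>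
  define Bl where "Bl = (\<lambda>y. \<Sum>e\<in>Basis. blinfun_scaleR_left (ddir F e y) o\<^sub>L blinfun_inner_left e)"
  have Bl: "blinfun_apply (Bl y) v = ddir F v y" if "y \<in> S" for y v
    by (simp add: Bl_def blinfun.sum_left ddir_sum_Basis[OF F[OF that], of v])
  have cBl: "continuous_on S Bl"
    unfolding Bl_def by (intro continuous_intros bounded_linear_intros cF
        bounded_linear.continuous_on[OF bounded_linear_blinfun_scaleR_left])
  have seg: "x0 + t *\<^sub>R (y - x0) \<in> S" if "y \<in> S" "t \<in> {0..1}" for y t
  proof -
    have "x0 + t *\<^sub>R (y - x0) = (1 - t) *\<^sub>R x0 + t *\<^sub>R y" by (simp add: algebra_simps)
    then show ?thesis using convexD[OF S(2) x0 that(1), of "1 - t" t] that by simp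
  qed
  have cf: "continuous_on S F"
    by (meson F continuous_at_imp_continuous_on differentiable_imp_continuous_within)
  have contF: "continuous_on (cbox 0 1) (\<lambda>t. t ^ k *\<^sub>R F (x0 + t *\<^sub>R (y - x0)))" if "y \<in> S" for y
    by (intro continuous_intros continuous_on_compose2[OF cf]) (use seg[OF that] in auto)
  have contB: "continuous_on (S \<times> cbox 0 1) (\<lambda>(y, t). t ^ Suc k *\<^sub>R Bl (x0 + t *\<^sub>R (y - x0)))"
    unfolding split_beta
    by (intro continuous_intros continuous_on_compose2[OF cBl]) (use seg in auto)
  have "((\<lambda>x. integral (cbox 0 1) (\<lambda>t. t ^ k *\<^sub>R F (x0 + t *\<^sub>R (x - x0)))) has_derivative
     blinfun_apply (integral (cbox 0 1) (\<lambda>t. t ^ Suc k *\<^sub>R Bl (x0 + t *\<^sub>R (x - x0))))) (at x within S)"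
  proof (rule leibniz_rule[OF _ _ contB x S(2)])
    fix y and t :: real assume yt: "y \<in> S" "t \<in> cbox 0 1"
    let ?p = "x0 + t *\<^sub>R (y - x0)"
    have p: "?p \<in> S" using seg yt by simp
    have lin: "linear (\<lambda>v. ddir F v ?p)" using linear_frechet_derivative[OF F[OF p]] by simp
    have "((\<lambda>y. F (x0 + t *\<^sub>R (y - x0))) has_derivative (\<lambda>v. ddir F (t *\<^sub>R v) ?p)) (at y within S)"
      by (rule has_derivative_compose[where g=F and f="\<lambda>y. x0 + t *\<^sub>R (y - x0)",
            OF _ has_derivative_frechet[OF F[OF p]]])
         (auto intro!: derivative_eq_intros)
    then have "((\<lambda>y. t ^ k *\<^sub>R F (x0 + t *\<^sub>R (y - x0))) has_derivative
        (\<lambda>v. t ^ k *\<^sub>R ddir F (t *\<^sub>R v) ?p)) (at y within S)"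
      by (rule has_derivative_scaleR_right)
    moreover have "(\<lambda>v. t ^ k *\<^sub>R ddir F (t *\<^sub>R v) ?p) = blinfun_apply (t ^ Suc k *\<^sub>R Bl ?p)"
      by (rule ext) (simp add: blinfun.scaleR_left Bl[OF p] linear_cmul[OF lin])
    ultimately show "((\<lambda>y. t ^ k *\<^sub>R F (x0 + t *\<^sub>R (y - x0))) has_derivative
        blinfun_apply (t ^ Suc k *\<^sub>R Bl ?p)) (at y within S)" by simp
  qed (use contF in \<open>auto intro: integrable_continuous_interval\<close>)
  moreover have eq: "blinfun_apply (integral (cbox 0 1) (\<lambda>t. t ^ Suc k *\<^sub>R Bl (x0 + t *\<^sub>R (x - x0)))) v
      = integral (cbox 0 1) (\<lambda>t. t ^ Suc k *\<^sub>R ddir F v (x0 + t *\<^sub>R (x - x0)))" for v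
  proof -
    have "continuous_on (cbox 0 1) (\<lambda>t. t ^ Suc k *\<^sub>R Bl (x0 + t *\<^sub>R (x - x0)))"
      by (intro continuous_intros continuous_on_compose2[OF cBl]) (use seg[OF x] in auto)
    then have "blinfun_apply (integral (cbox 0 1) (\<lambda>t. t ^ Suc k *\<^sub>R Bl (x0 + t *\<^sub>R (x - x0)))) v
      = integral (cbox 0 1) (\<lambda>t. blinfun_apply (t ^ Suc k *\<^sub>R Bl (x0 + t *\<^sub>R (x - x0))) v)"
      by (intro blinfun_apply_integral integrable_continuous)
    also have "\<dots> = integral (cbox 0 1) (\<lambda>t. t ^ Suc k *\<^sub>R ddir F v (x0 + t *\<^sub>R (x - x0)))"
      by (intro Henstock_Kurzweil_Integration.integral_cong)
         (use Bl seg[OF x] in \<open>auto simp: blinfun.scaleR_left\<close>)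
    finally show ?thesis .
  qed
  ultimately have "((\<lambda>x. integral (cbox 0 1) (\<lambda>t. t ^ k *\<^sub>R F (x0 + t *\<^sub>R (x - x0)))) has_derivative
     (\<lambda>v. integral (cbox 0 1) (\<lambda>t. t ^ Suc k *\<^sub>R ddir F v (x0 + t *\<^sub>R (x - x0))))) (at x within S)"
    by (rule has_derivative_eq_rhs[OF _ ext])
  then show ?thesis unfolding at_within_open[OF x S(1)] cbox_interval .
qed

lemma smooth_on_segment_integral:
  fixes F :: "'a::euclidean_space \<Rightarrow> 'b::euclidean_space"
  assumes S: "open S" "convex S" and x0: "x0 \<in> S" and F: "smooth_on S F"
  shows "smooth_on S (\<lambda>x. integral {0..1} (\<lambda>t. t ^ k *\<^sub>R F (x0 + t *\<^sub>R (x - x0))))"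
proof -
  note D = has_derivative_segment_integral[OF S x0]
  have "diff_times n S (\<lambda>x. integral {0..1} (\<lambda>t. t ^ k *\<^sub>R F (x0 + t *\<^sub>R (x - x0))))" for n
    using F
  proof (induction n arbitrary: F k)
    case 0
    have "((\<lambda>x. integral {0..1} (\<lambda>t. t ^ k *\<^sub>R F (x0 + t *\<^sub>R (x - x0)))) differentiable (at x))"
      if "x \<in> S" for x
      using D[OF that smooth_on_differentiable[OF 0] smooth_on_continuous_on[OF smooth_on_ddir[OF 0]]]
      unfolding differentiable_def by blast
    then show ?case by simp
  next
    case (Suc n)
    show ?case
    proof (rule diff_times_SucI[OF S(1)])
      fix x assume "x \<in> S"
      from D[OF this smooth_on_differentiable[OF Suc.prems]
          smooth_on_continuous_on[OF smooth_on_ddir[OF Suc.prems]]]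
      show "((\<lambda>x. integral {0..1} (\<lambda>t. t ^ k *\<^sub>R F (x0 + t *\<^sub>R (x - x0)))) has_derivative
          (\<lambda>v. integral {0..1} (\<lambda>t. t ^ Suc k *\<^sub>R ddir F v (x0 + t *\<^sub>R (x - x0))))) (at x)"
        by blast
    next
      fix b :: 'a assume "b \<in> Basis"
      then show "diff_times n S (\<lambda>x. integral {0..1} (\<lambda>t. t ^ Suc k *\<^sub>R ddir F b (x0 + t *\<^sub>R (x - x0))))"
        by (rule Suc.IH[OF smooth_on_ddir[OF Suc.prems]])
    qed
  qed
  then show ?thesis by (simp add: smooth_on_iff)
qed

text \<open>The functions \<open>g e\<close> are averages of \<open>ddir F e\<close> over the
  segment from \<open>x0\<close> to \<open>x\<close>, and the identity is the fundamental theorem of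
  calculus on that segment. It will show that a derivation is determined by its values on coordinate
  functions.\<close>

lemma Hadamard_lemma:
  fixes F :: "'a::euclidean_space \<Rightarrow> 'b::euclidean_space"
  assumes S: "open S" "convex S" and x0: "x0 \<in> S" and F: "smooth_on S F"
  obtains g where "\<And>e. e \<in> Basis \<Longrightarrow> smooth_on S (g e)"
    "\<And>x. x \<in> S \<Longrightarrow> F x = F x0 + (\<Sum>e\<in>Basis. ((x - x0) \<bullet> e) *\<^sub>R g e x)"
    "\<And>e. e \<in> Basis \<Longrightarrow> g e x0 = ddir F e x0"
proof
  define g where "g = (\<lambda>e x. integral {0..1} (\<lambda>t. t ^ 0 *\<^sub>R ddir F e (x0 + t *\<^sub>R (x - x0))))"
  show "smooth_on S (g e)" if "e \<in> Basis" for e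
    unfolding g_def by (rule smooth_on_segment_integral[OF S x0 smooth_on_ddir[OF F that]])
  show "g e x0 = ddir F e x0" if "e \<in> Basis" for e by (simp add: g_def)
  fix x assume x: "x \<in> S"
  have seg: "x0 + t *\<^sub>R (x - x0) \<in> S" if "t \<in> {0..1}" for t
  proof -
    have "x0 + t *\<^sub>R (x - x0) = (1 - t) *\<^sub>R x0 + t *\<^sub>R x" by (simp add: algebra_simps)
    then show ?thesis using convexD[OF S(2) x0 x, of "1 - t" t] that by simp
  qed
  note dF = smooth_on_differentiable[OF F seg]
  have "((\<lambda>t. F (x0 + t *\<^sub>R (x - x0))) has_vector_derivative
      ddir F (x - x0) (x0 + t *\<^sub>R (x - x0))) (at t within {0..1})" if t: "t \<in> {0..1}" for t
  proof -
    have lin: "linear (\<lambda>v. ddir F v (x0 + t *\<^sub>R (x - x0)))"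
      using linear_frechet_derivative[OF dF[OF t]] by simp
    have "((\<lambda>t. F (x0 + t *\<^sub>R (x - x0))) has_derivative
        (\<lambda>v. ddir F (v *\<^sub>R (x - x0)) (x0 + t *\<^sub>R (x - x0)))) (at t within {0..1})"
      by (rule has_derivative_compose[where g=F and f="\<lambda>t. x0 + t *\<^sub>R (x - x0)",
            OF _ has_derivative_frechet[OF dF[OF t]]])
         (auto intro!: derivative_eq_intros)
    then show ?thesis by (simp add: has_vector_derivative_def linear_cmul[OF lin])
  qed
  then have "((\<lambda>t. ddir F (x - x0) (x0 + t *\<^sub>R (x - x0))) has_integral F x - F x0) {0..1}"
    using fundamental_theorem_of_calculus[of 0 1 "\<lambda>t. F (x0 + t *\<^sub>R (x - x0))"] by simp
  then have "F x - F x0 = integral {0..1} (\<lambda>t. ddir F (x - x0) (x0 + t *\<^sub>R (x - x0)))"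
    by (simp add: integral_unique)
  also have "\<dots> = integral {0..1} (\<lambda>t. \<Sum>e\<in>Basis. ((x - x0) \<bullet> e) *\<^sub>R ddir F e (x0 + t *\<^sub>R (x - x0)))"
    by (intro Henstock_Kurzweil_Integration.integral_cong ddir_sum_Basis dF)
  also have "\<dots> = (\<Sum>e\<in>Basis. integral {0..1} (\<lambda>t. ((x - x0) \<bullet> e) *\<^sub>R ddir F e (x0 + t *\<^sub>R (x - x0))))"
  proof (rule Henstock_Kurzweil_Integration.integral_sum)
    fix e :: 'a assume e: "e \<in> Basis"
    show "(\<lambda>t. ((x - x0) \<bullet> e) *\<^sub>R ddir F e (x0 + t *\<^sub>R (x - x0))) integrable_on {0..1}"
      by (intro integrable_continuous_interval continuous_intros
          continuous_on_compose2[OF smooth_on_continuous_on[OF smooth_on_ddir[OF F e]]])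
         (use seg in auto)
  qed simp
  also have "\<dots> = (\<Sum>e\<in>Basis. ((x - x0) \<bullet> e) *\<^sub>R g e x)"
    by (simp add: g_def)
  finally show "F x = F x0 + (\<Sum>e\<in>Basis. ((x - x0) \<bullet> e) *\<^sub>R g e x)"
    by (simp add: algebra_simps)
qed

section \<open>Holomorphic functions of several variables\<close>

lemma norm_vector_scalar_mult: "norm (c *s v) = cmod c * norm (v :: complex^'n)"
proof -
  have "norm (c *s v) = L2_set (\<lambda>i. cmod c * norm (v $ i)) UNIV"
    by (simp add: norm_vec_def norm_mult)
  then show ?thesis by (simp add: norm_vec_def L2_set_right_distrib)
qed

lemma bounded_linear_vector_scalar_mult_left: "bounded_linear (\<lambda>t. t *s (v :: complex^'n))"
  by (rule bounded_linear_intro[where K="norm v"])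
     (auto simp: vec_eq_iff algebra_simps norm_vector_scalar_mult)

lemma holo_on_subset: "holo_on S f \<Longrightarrow> T \<subseteq> S \<Longrightarrow> holo_on T f"
  unfolding holo_on_def by blast

lemma holo_on_local:
  "(\<And>x. x \<in> S \<Longrightarrow> \<exists>T. x \<in> T \<and> holo_on T f) \<Longrightarrow> holo_on S f"
  unfolding holo_on_def by metis

lemma holo_on_differentiable: "holo_on S f \<Longrightarrow> x \<in> S \<Longrightarrow> f differentiable (at x)"
  unfolding holo_on_def differentiable_def by blast

lemma holo_on_continuous_on: "holo_on S f \<Longrightarrow> continuous_on S f"
  by (meson continuous_at_imp_continuous_on differentiable_imp_continuous_within
      holo_on_differentiable)

lemma ddir_scale: "holo_on S f \<Longrightarrow> x \<in> S \<Longrightarrow> ddir f (c *s v) x = c * ddir f v x"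
  unfolding holo_on_def by (metis ddir_eq)

lemma holo_onI:
  assumes "\<And>x. x \<in> S \<Longrightarrow> (f has_derivative f' x) (at x)"
    "\<And>x c v. x \<in> S \<Longrightarrow> f' x (c *s v) = c * f' x v"
  shows "holo_on S f"
  using assms unfolding holo_on_def by blast

lemma vec_sum_smult_axis: "(\<Sum>l\<in>UNIV. (v $ l) *s axis l 1) = (v :: complex^'n)"
  by (simp add: vec_eq_iff axis_def if_distrib[of "\<lambda>y. _ * y"] sum.delta cong: if_cong)

lemma ddir_sum_axis:
  fixes f :: "complex^'n \<Rightarrow> complex"
  assumes f: "holo_on S f" and x: "x \<in> S"
  shows "ddir f v x = (\<Sum>l\<in>UNIV. v $ l * ddir f (axis l 1) x)"
proof -
  have "linear (\<lambda>v. ddir f v x)"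
    using linear_frechet_derivative[OF holo_on_differentiable[OF f x]] by simp
  then have "ddir f (\<Sum>l\<in>UNIV. (v $ l) *s axis l 1) x = (\<Sum>l\<in>UNIV. v $ l * ddir f (axis l 1) x)"
    by (simp add: linear_sum ddir_scale[OF f x])
  then show ?thesis by (simp add: vec_sum_smult_axis)
qed

lemma holo_on_cong:
  assumes "open S" "\<And>x. x \<in> S \<Longrightarrow> f x = g x" "holo_on S f"
  shows "holo_on S g"
  using assms unfolding holo_on_def by (metis has_derivative_transform_within_open)

lemma holo_on_const [simp]: "holo_on S (\<lambda>x. c)"
  by (rule holo_onI[where f'="\<lambda>_ _. 0"]) auto

lemma holo_on_vec_nth [simp]: "holo_on S (\<lambda>x. x $ i)"
  by (rule holo_onI[where f'="\<lambda>_ v. v $ i"])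
     (auto intro: bounded_linear_imp_has_derivative bounded_linear_vec_nth)

lemma holo_on_add: "holo_on S f \<Longrightarrow> holo_on S g \<Longrightarrow> holo_on S (\<lambda>x. f x + g x)"
  by (rule holo_onI[where f'="\<lambda>x v. ddir f v x + ddir g v x"])
     (auto intro!: has_derivative_add has_derivative_frechet holo_on_differentiable
        simp: ddir_scale algebra_simps)

lemma holo_on_mult: "holo_on S f \<Longrightarrow> holo_on S g \<Longrightarrow> holo_on S (\<lambda>x. f x * g x)"
  by (rule holo_onI[where f'="\<lambda>x v. f x * ddir g v x + ddir f v x * g x"],
      intro has_derivative_mult has_derivative_frechet holo_on_differentiable)
     (auto simp: ddir_scale algebra_simps)

lemma holo_on_cmult: "holo_on S f \<Longrightarrow> holo_on S (\<lambda>x. c * f x)"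
  by (rule holo_on_mult) auto

lemma holo_on_diff: "holo_on S f \<Longrightarrow> holo_on S g \<Longrightarrow> holo_on S (\<lambda>x. f x - g x)"
  using holo_on_add[of S f "\<lambda>x. -1 * g x"] holo_on_cmult[of S g "-1"] by simp

lemma holo_on_sum: "(\<And>i. i \<in> I \<Longrightarrow> holo_on S (f i)) \<Longrightarrow> holo_on S (\<lambda>x. \<Sum>i\<in>I. f i x)"
  by (induction I rule: infinite_finite_induct) (auto intro: holo_on_add)

lemma has_derivative_vecI:
  fixes G :: "'a::real_normed_vector \<Rightarrow> 'b::real_normed_vector^'n"
  assumes "\<And>j. ((\<lambda>x. G x $ j) has_derivative (\<lambda>v. G' v $ j)) F"
  shows "(G has_derivative G') F"
proof -
  have "((\<lambda>x. \<Sum>j\<in>UNIV. axis j (G x $ j)) has_derivative (\<lambda>v. \<Sum>j\<in>UNIV. axis j (G' v $ j))) F"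
    by (intro has_derivative_sum bounded_linear.has_derivative[OF bounded_linear_axis] assms)
  then show ?thesis by (simp add: vec_sum_axis)
qed

lemma holo_on_compose:
  fixes G :: "complex^'m \<Rightarrow> complex^'n"
  assumes G: "\<And>j. holo_on S (\<lambda>x. G x $ j)" and f: "holo_on T f" and ST: "G ` S \<subseteq> T"
  shows "holo_on S (\<lambda>x. f (G x))"
proof (rule holo_onI)
  fix x assume x: "x \<in> S"
  define G' where "G' = (\<lambda>x v. \<chi> j. ddir (\<lambda>x. G x $ j) v x)"
  have "(G has_derivative G' x) (at x)"
    by (rule has_derivative_vecI)
       (auto simp: G'_def intro: has_derivative_frechet holo_on_differentiable[OF G x])
  moreover have "(f has_derivative (\<lambda>v. ddir f v (G x))) (at (G x))"
    using x ST by (auto intro!: has_derivative_frechet holo_on_differentiable[OF f])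
  ultimately show "((\<lambda>x. f (G x)) has_derivative (\<lambda>v. ddir f (\<chi> j. ddir (\<lambda>x. G x $ j) v x) (G x))) (at x)"
    using has_derivative_compose unfolding G'_def by fast
  fix c v
  have "(\<chi> j. ddir (\<lambda>x. G x $ j) (c *s v) x) = c *s (\<chi> j. ddir (\<lambda>x. G x $ j) v x)"
    by (simp add: vec_eq_iff ddir_scale[OF G x])
  then show "ddir f (\<chi> j. ddir (\<lambda>x. G x $ j) (c *s v) x) (G x) = c * ddir f (\<chi> j. ddir (\<lambda>x. G x $ j) v x) (G x)"
    using x ST by (simp add: ddir_scale[OF f] image_subset_iff)
qed

lemma holo_on_line:
  fixes f :: "complex^'n \<Rightarrow> complex"
  assumes f: "holo_on S f" and x: "x + t *s v \<in> S"
  shows "((\<lambda>t. f (x + t *s v)) has_field_derivative ddir f v (x + t *s v)) (at t)"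
proof -
  have "((\<lambda>t. x + t *s v) has_derivative (\<lambda>s. s *s v)) (at t)"
    using has_derivative_add[OF has_derivative_const
        bounded_linear_imp_has_derivative[OF bounded_linear_vector_scalar_mult_left]] by simp
  from has_derivative_compose[OF this has_derivative_frechet[OF holo_on_differentiable[OF f x]]]
  have "((\<lambda>t. f (x + t *s v)) has_derivative (\<lambda>s. ddir f (s *s v) (x + t *s v))) (at t)" .
  then show ?thesis
    unfolding has_field_derivative_def
    by (rule has_derivative_eq_rhs) (simp add: ddir_scale[OF f x] mult.commute fun_eq_iff)
qed

lemma line_in_ball:
  assumes "cmod t * norm v \<le> r"
  shows "x + t *s v \<in> cball x r"
  using assms by (simp add: dist_norm norm_vector_scalar_mult)

section \<open>Cauchy estimates, uniform limits and derivatives in several complex variables\<close>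

text \<open>This is the one-variable Cauchy inequality on the complex line through \<open>x\<close>
  in direction \<open>v\<close>, on which the ball of radius \<open>r\<close> cuts out a disc of
  radius \<open>r / norm v\<close>.\<close>

lemma Cauchy_estimate_ddir:
  fixes f :: "complex^'n \<Rightarrow> complex"
  assumes f: "holo_on S f" and S: "cball x r \<subseteq> S" and r: "r > 0"
    and B: "\<And>y. y \<in> cball x r \<Longrightarrow> cmod (f y) \<le> B"
  shows "cmod (ddir f v x) \<le> B / r * norm v"
proof (cases "v = 0")
  case True
  have "x \<in> S" using S r by auto
  then have "ddir f 0 x = 0" using ddir_scale[OF f, of x 0 0] by simp
  then show ?thesis using True by simp
next
  case False
  define \<rho> where "\<rho> = r / norm v"
  have \<rho>: "\<rho> > 0" "\<rho> * norm v = r" using False r by (auto simp: \<rho>_def)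
  have inS: "x + t *s v \<in> cball x r" if "cmod t \<le> \<rho>" for t
    using line_in_ball[of t v r x] mult_right_mono[OF that, of "norm v"] \<rho> by simp
  let ?g = "\<lambda>t. f (x + t *s v)"
  have d: "(?g has_field_derivative ddir f v (x + t *s v)) (at t)" if "cmod t \<le> \<rho>" for t
    using holo_on_line[OF f] inS[OF that] S by blast
  have "norm ((deriv ^^ 1) ?g 0) \<le> fact 1 * B / \<rho> ^ 1"
  proof (rule Cauchy_inequality)
    show "?g holomorphic_on ball 0 \<rho>"
      by (auto simp: holomorphic_on_def field_differentiable_def intro!: exI DERIV_subset[OF d])
    show "continuous_on (cball 0 \<rho>) ?g"
      by (intro continuous_at_imp_continuous_on ballI) (auto intro: DERIV_isCont[OF d])
  qed (use \<rho> B inS in auto)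
  moreover have "deriv ?g 0 = ddir f v x" using DERIV_imp_deriv[OF d[of 0]] \<rho> by simp
  ultimately show ?thesis by (simp add: \<rho>_def)
qed

text \<open>Cauchy estimates for \<open>f m - f n\<close> make the differentials uniformly Cauchy
  near each point, so limit and differential can be exchanged; complex linearity passes to the
  pointwise limit.\<close>

lemma holo_on_uniform_limit:
  fixes f :: "nat \<Rightarrow> complex^'n \<Rightarrow> complex"
  assumes S: "open S" and f: "\<And>n. holo_on S (f n)" and lim: "uniform_limit S f g sequentially"
  shows "holo_on S g"
proof -
  have "\<exists>g'. (g has_derivative g') (at x) \<and> (\<forall>c v. g' (c *s v) = c * g' v)" if "x \<in> S" for x
  proof -
    obtain r0 where r0: "r0 > 0" "cball x r0 \<subseteq> S" using S \<open>x \<in> S\<close> open_contains_cball by blast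
    \<comment> \<open>Half the radius leaves room for a ball of radius \<open>r\<close> around every
      point of \<open>ball x r\<close>.\<close>
    define r where "r = r0 / 2"
    have r: "r > 0" using r0 by (simp add: r_def)
    have sub: "cball y r \<subseteq> S" if y: "y \<in> ball x r" for y
    proof
      fix w assume "w \<in> cball y r"
      then have "dist x w \<le> r0" using y dist_triangle[of x w y] by (simp add: r_def)
      then show "w \<in> S" using r0 by auto
    qed
    have diff: "cmod (ddir (f m) v y - ddir (f n) v y) \<le> e / r * norm v"
      if y: "y \<in> ball x r" and e: "\<And>w. w \<in> S \<Longrightarrow> cmod (f m w - f n w) \<le> e" for m n v y e
    proof -
      have yS: "y \<in> S" using sub[OF y] r by auto
      have h: "holo_on S (\<lambda>w. f m w - f n w)" by (intro holo_on_diff f)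
      have "ddir (\<lambda>w. f m w - f n w) v y = ddir (f m) v y - ddir (f n) v y"
        by (rule ddir_eq) (intro has_derivative_diff has_derivative_frechet holo_on_differentiable[OF f yS])
      then show ?thesis using Cauchy_estimate_ddir[OF h sub[OF y] r, of e v] e sub[OF y]
        by (metis subset_iff)
    qed
    have uC: "\<exists>N. \<forall>m\<ge>N. \<forall>n\<ge>N. \<forall>w\<in>S. cmod (f m w - f n w) \<le> e" if "e > 0" for e
    proof -
      have "\<forall>\<^sub>F n in sequentially. \<forall>w\<in>S. dist (f n w) (g w) < e / 2"
        using uniform_limitD[OF lim, of "e/2"] that by simp
      then obtain N where N: "\<And>n w. n \<ge> N \<Longrightarrow> w \<in> S \<Longrightarrow> dist (f n w) (g w) < e / 2"
        unfolding eventually_sequentially by blast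
      have "cmod (f m w - f n w) \<le> e" if "m \<ge> N" "n \<ge> N" "w \<in> S" for m n w
        using N[OF that(1,3)] N[OF that(2,3)] dist_triangle2[of "f m w" "f n w" "g w"]
        by (simp add: dist_norm)
      then show ?thesis by blast
    qed
    have conv: "convergent (\<lambda>n. ddir (f n) v y)" if y: "y \<in> ball x r" for v y
    proof (rule Cauchy_convergent, rule metric_CauchyI)
      fix e :: real assume e: "e > 0"
      define e' where "e' = e * r / (2 * (norm v + 1))"
      have "norm v + 1 > 0" by (simp add: add_nonneg_pos)
      then have e'0: "e' > 0" and "norm v / (2 * (norm v + 1)) < 1"
        using e r by (auto simp: e'_def divide_less_eq)
      then have "e * (norm v / (2 * (norm v + 1))) < e * 1"
        using e mult_strict_left_mono by blast
      moreover have "e' / r * norm v = e * (norm v / (2 * (norm v + 1)))"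
        using r by (simp add: e'_def)
      ultimately have e': "e' > 0" "e' / r * norm v < e" using e'0 by auto
      obtain N where "\<forall>m\<ge>N. \<forall>n\<ge>N. \<forall>w\<in>S. cmod (f m w - f n w) \<le> e'" using uC[OF e'(1)] by blast
      then have "\<forall>m\<ge>N. \<forall>n\<ge>N. cmod (ddir (f m) v y - ddir (f n) v y) \<le> e' / r * norm v"
        using diff[OF y] by blast
      then show "\<exists>M. \<forall>m\<ge>M. \<forall>n\<ge>M. dist (ddir (f m) v y) (ddir (f n) v y) < e"
        unfolding dist_norm using e'(2) by (meson le_less_trans)
    qed
    define G where "G = (\<lambda>y v. lim (\<lambda>n. ddir (f n) v y))"
    have G: "(\<lambda>n. ddir (f n) v y) \<longlonglongrightarrow> G y v" if "y \<in> ball x r" for v y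
      using conv[OF that] unfolding G_def by (simp add: convergent_LIMSEQ_iff)
    have "\<exists>g2. \<forall>y\<in>ball x r. (\<lambda>n. f n y) \<longlonglongrightarrow> g2 y \<and> (g2 has_derivative G y) (at y within ball x r)"
    proof (rule has_derivative_sequence)
      show "(f n has_derivative (\<lambda>v. ddir (f n) v y)) (at y within ball x r)" if "y \<in> ball x r" for n y
      proof -
        have "y \<in> S" using sub[OF that] r by auto
        then show ?thesis
          by (rule has_derivative_at_withinI[OF has_derivative_frechet[OF holo_on_differentiable[OF f]]])
      qed
      show "\<forall>\<^sub>F n in sequentially. \<forall>y\<in>ball x r. \<forall>h. cmod (ddir (f n) h y - G y h) \<le> e * norm h"
        if e: "e > 0" for e
      proof -
        obtain N where N: "\<forall>m\<ge>N. \<forall>n\<ge>N. \<forall>w\<in>S. cmod (f m w - f n w) \<le> e * r"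
          using uC[of "e * r"] e r by auto
        have "cmod (ddir (f n) h y - G y h) \<le> e * norm h" if n: "n \<ge> N" and y: "y \<in> ball x r" for n h y
        proof (rule LIMSEQ_le_const2)
          show "(\<lambda>m. cmod (ddir (f n) h y - ddir (f m) h y)) \<longlonglongrightarrow> cmod (ddir (f n) h y - G y h)"
            by (intro tendsto_intros G y)
          have "cmod (ddir (f n) h y - ddir (f m) h y) \<le> e * norm h" if "m \<ge> N" for m
            using diff[OF y, of n m "e * r" h] N n that r by auto
          then show "\<exists>N. \<forall>m\<ge>N. cmod (ddir (f n) h y - ddir (f m) h y) \<le> e * norm h" by blast
        qed
        then show ?thesis unfolding eventually_sequentially by blast
      qed
      show "x \<in> ball x r" using r by simp
      show "(\<lambda>n. f n x) \<longlonglongrightarrow> g x" using tendsto_uniform_limitI[OF lim \<open>x \<in> S\<close>] .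
    qed simp
    then obtain g2 where g2: "\<And>y. y \<in> ball x r \<Longrightarrow> (\<lambda>n. f n y) \<longlonglongrightarrow> g2 y"
      "\<And>y. y \<in> ball x r \<Longrightarrow> (g2 has_derivative G y) (at y within ball x r)" by blast
    have eq: "g2 y = g y" if "y \<in> ball x r" for y
    proof -
      have "y \<in> S" using sub[OF that] r by auto
      then show ?thesis using LIMSEQ_unique[OF g2(1)[OF that] tendsto_uniform_limitI[OF lim]] by simp
    qed
    have xb: "x \<in> ball x r" using r by simp
    then have "(g2 has_derivative G x) (at x)"
      using g2(2)[OF xb] at_within_open[OF xb open_ball] by simp
    then have "(g has_derivative G x) (at x)"
      by (rule has_derivative_transform_within_open[OF _ open_ball xb]) (use eq in auto)
    moreover have "G x (c *s v) = c * G x v" for c v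
    proof (rule LIMSEQ_unique[OF G[OF xb]])
      show "(\<lambda>n. ddir (f n) (c *s v) x) \<longlonglongrightarrow> c * G x v"
        by (simp add: ddir_scale[OF f \<open>x \<in> S\<close>]) (intro tendsto_intros G xb)
    qed
    ultimately show ?thesis by blast
  qed
  then show ?thesis unfolding holo_on_def by blast
qed

text \<open>Taylor's formula of second order in the complex parameter of the line. The second
  derivative is bounded by Cauchy's inequality on discs of radius \<open>\<rho>\<close> about the
  points of \<open>cball 0 \<rho>\<close>, which is what the ball of radius \<open>2 * r\<close> is
  for. The bound is the same for all \<open>y\<close>, so the convergence will be uniform.\<close>

lemma difference_quotient_bound:
  fixes f :: "complex^'n \<Rightarrow> complex"
  assumes f: "holo_on S f" and S: "cball y (2 * r) \<subseteq> S" and r: "r > 0"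
    and B: "\<And>w. w \<in> S \<Longrightarrow> cmod (f w) \<le> B" and d: "0 < d" "d * norm v \<le> r" and v: "v \<noteq> 0"
  shows "cmod ((f (y + of_real d *s v) - f y) / of_real d - ddir f v y) \<le> 2 * B * (norm v / r)\<^sup>2 * d"
proof -
  define \<rho> where "\<rho> = r / norm v"
  have \<rho>: "\<rho> > 0" "\<rho> * norm v = r" "d \<le> \<rho>" using v r d by (auto simp: \<rho>_def field_simps)
  let ?g = "\<lambda>t. f (y + t *s v)"
  have inS: "y + t *s v \<in> S" if "cmod t \<le> 2 * \<rho>" for t
    using line_in_ball[of t v "2*r" y] mult_right_mono[OF that, of "norm v"] \<rho> S by auto
  have dg: "(?g has_field_derivative ddir f v (y + t *s v)) (at t)" if "cmod t \<le> 2 * \<rho>" for t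
    by (rule holo_on_line[OF f inS[OF that]])
  have hol: "?g holomorphic_on ball 0 (2 * \<rho>)"
    by (auto simp: holomorphic_on_def field_differentiable_def intro!: exI DERIV_subset[OF dg])
  have d2: "cmod ((deriv ^^ 2) ?g t) \<le> fact 2 * B / \<rho> ^ 2" if t: "t \<in> cball 0 \<rho>" for t
  proof (rule Cauchy_inequality)
    have sub: "cmod s \<le> 2 * \<rho>" if "cmod (t - s) \<le> \<rho>" for s
      using norm_triangle_ineq4[of t "t - s"] t that by simp
    show "?g holomorphic_on ball t \<rho>"
      by (auto simp: holomorphic_on_def field_differentiable_def dist_norm intro!: exI DERIV_subset[OF dg] sub)
    show "continuous_on (cball t \<rho>) ?g"
      by (intro continuous_at_imp_continuous_on ballI) (auto intro!: DERIV_isCont[OF dg] sub simp: dist_norm)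
    show "cmod (?g s) \<le> B" if "cmod (t - s) = \<rho>" for s
      using B inS[OF sub] that by auto
  qed (use \<rho> in auto)
  have "cmod (?g (of_real d) - (\<Sum>i\<le>1. (deriv ^^ i) ?g 0 * (of_real d - 0) ^ i / fact i))
      \<le> (fact 2 * B / \<rho> ^ 2) * cmod (of_real d - 0) ^ Suc 1 / fact 1"
  proof (rule complex_Taylor[where f="\<lambda>i. (deriv ^^ i) ?g" and S="cball 0 \<rho>", simplified funpow_0])
    fix i and t :: complex assume t: "t \<in> cball 0 \<rho>"
    have "(deriv ^^ i) ?g holomorphic_on ball 0 (2 * \<rho>)"
      by (rule holomorphic_higher_deriv[OF hol]) simp
    moreover have "t \<in> ball 0 (2 * \<rho>)" using t \<rho> by auto
    ultimately have "((deriv ^^ i) ?g has_field_derivative deriv ((deriv ^^ i) ?g) t) (at t)"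
      using holomorphic_derivI open_ball by blast
    then show "((deriv ^^ i) ?g has_field_derivative (deriv ^^ Suc i) ?g t) (at t within cball 0 \<rho>)"
      by (auto intro: DERIV_subset)
  next
    show "cmod ((deriv ^^ Suc 1) ?g t) \<le> fact 2 * B / \<rho>\<^sup>2" if "t \<in> cball 0 \<rho>" for t
      using d2[OF that] by (simp add: numeral_2_eq_2)
  qed (use \<rho> d in auto)
  moreover have "deriv ?g 0 = ddir f v y" using DERIV_imp_deriv[OF dg[of 0]] \<rho> by simp
  ultimately have *: "cmod (f (y + of_real d *s v) - f y - ddir f v y * of_real d) \<le> 2 * B / \<rho>\<^sup>2 * d\<^sup>2"
    using d by (simp add: numeral_2_eq_2 algebra_simps)
  have "(f (y + of_real d *s v) - f y) / of_real d - ddir f v y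
      = (f (y + of_real d *s v) - f y - ddir f v y * of_real d) / of_real d"
    using d by (simp add: field_simps)
  also have "cmod \<dots> = cmod (f (y + of_real d *s v) - f y - ddir f v y * of_real d) / d"
    using d by (simp add: norm_divide)
  also have "\<dots> \<le> (2 * B / \<rho>\<^sup>2 * d\<^sup>2) / d" using * d by (intro divide_right_mono) auto
  also have "\<dots> = 2 * B * (norm v / r)\<^sup>2 * d"
    using d by (simp add: \<rho>_def power2_eq_square)
  finally show ?thesis .
qed

text \<open>\<open>holo_on\<close> says nothing about continuity of the differential. The difference
  quotients in direction \<open>v\<close> are holomorphic and, by the preceding bound, converge
  uniformly near each point, so their limit is holomorphic.\<close>

lemma holo_on_ddir:
  fixes f :: "complex^'n \<Rightarrow> complex"
  assumes S: "open S" and f: "holo_on S f"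
  shows "holo_on S (ddir f v)"
proof (cases "v = 0")
  case True
  then have *: "ddir f v x = 0" if "x \<in> S" for x using ddir_scale[OF f that, of 0 0] by simp
  show ?thesis by (rule holo_on_cong[OF S _ holo_on_const[of _ 0]]) (simp add: *)
next
  case False
  show ?thesis
  proof (rule holo_on_local)
    fix x assume "x \<in> S"
    then obtain r0 where r0: "r0 > 0" "cball x r0 \<subseteq> S" using S open_contains_cball by blast
    \<comment> \<open>A quarter, because a ball of radius \<open>2 * r\<close> about a point of
      \<open>ball x r\<close> reaches to distance \<open>3 * r\<close> from
      \<open>x\<close>.\<close>
    define r where "r = r0 / 4"
    have r: "r > 0" using r0 by (simp add: r_def)
    have "compact (f ` cball x r0)"
      by (intro compact_continuous_image continuous_on_subset[OF holo_on_continuous_on[OF f] r0(2)]) simp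
    then obtain B where "\<forall>y\<in>f ` cball x r0. cmod y \<le> B" using compact_imp_bounded bounded_iff by metis
    then have B: "\<And>y. y \<in> cball x r0 \<Longrightarrow> cmod (f y) \<le> B" by blast
    have sub: "cball y (2 * r) \<subseteq> cball x r0" if y: "y \<in> ball x r" for y
    proof
      fix w assume "w \<in> cball y (2 * r)"
      then show "w \<in> cball x r0" using y r dist_triangle[of x w y] by (simp add: r_def)
    qed
    define d where "d = (\<lambda>n. r / norm v / real (Suc n))"
    have d: "0 < d n" "d n * norm v \<le> r" for n
      using r False mult_left_mono[of 1 "1 + real n" r]
      by (auto simp: d_def divide_simps add_pos_nonneg)
    define q where "q = (\<lambda>n y. (f (y + of_real (d n) *s v) - f y) / of_real (d n))"
    have holq: "holo_on (ball x r) (q n)" for n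
    proof -
      have "holo_on (ball x r) (\<lambda>y. f (y + of_real (d n) *s v))"
      proof (rule holo_on_compose[OF _ f])
        show "(\<lambda>y. y + of_real (d n) *s v) ` ball x r \<subseteq> S"
        proof clarify
          fix y assume y: "y \<in> ball x r"
          then have "y + of_real (d n) *s v \<in> cball y (2 * r)"
            using line_in_ball[of "of_real (d n)" v "2 * r" y] d[of n] r by simp
          then show "y + of_real (d n) *s v \<in> S" using sub[OF y] r0 by blast
        qed
      qed (auto intro: holo_on_add)
      moreover have "holo_on (ball x r) f"
        using holo_on_subset[OF f, of "ball x r"] r0(2) subset_ball[of r r0 x] ball_subset_cball[of x r0] r0(1)
        by (fastforce simp: r_def)
      ultimately have "holo_on (ball x r) (\<lambda>y. (1 / of_real (d n)) * (f (y + of_real (d n) *s v) - f y))"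
        by (intro holo_on_cmult holo_on_diff)
      then show ?thesis by (simp add: q_def)
    qed
    have bd: "dist (q n y) (ddir f v y) \<le> 2 * B * (norm v / r)\<^sup>2 * d n" if y: "y \<in> ball x r" for n y
      using difference_quotient_bound[OF holo_on_subset[OF f r0(2)] sub[OF y] r B d False]
      by (simp add: q_def dist_norm)
    have "(\<lambda>n. r / norm v * inverse (real (Suc n))) \<longlonglongrightarrow> r / norm v * 0"
      by (intro tendsto_intros LIMSEQ_inverse_real_of_nat)
    then have "d \<longlonglongrightarrow> 0" unfolding d_def by (simp add: divide_inverse)
    then have "(\<lambda>n. 2 * B * (norm v / r)\<^sup>2 * d n) \<longlonglongrightarrow> 2 * B * (norm v / r)\<^sup>2 * 0"
      by (rule tendsto_mult_left)
    then have lim0: "(\<lambda>n. 2 * B * (norm v / r)\<^sup>2 * d n) \<longlonglongrightarrow> 0" by simp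
    have "uniform_limit (ball x r) q (ddir f v) sequentially"
    proof (rule uniform_limitI)
      fix e :: real assume "e > 0"
      then have "\<forall>\<^sub>F n in sequentially. 2 * B * (norm v / r)\<^sup>2 * d n < e"
        using order_tendstoD(2)[OF lim0] by blast
      then show "\<forall>\<^sub>F n in sequentially. \<forall>y\<in>ball x r. dist (q n y) (ddir f v y) < e"
        by eventually_elim (use bd in \<open>meson le_less_trans\<close>)
    qed
    then have "holo_on (ball x r) (ddir f v)" by (rule holo_on_uniform_limit[OF open_ball holq])
    then show "\<exists>T. x \<in> T \<and> holo_on T (ddir f v)" using r by (meson centre_in_ball)
  qed
qed

lemma holo_on_imp_smooth_on:
  fixes f :: "complex^'n \<Rightarrow> complex"
  assumes S: "open S" and f: "holo_on S f"
  shows "smooth_on S f"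
proof -
  have "diff_times n S f" for n
    using f by (induction n arbitrary: f) (auto intro: holo_on_differentiable holo_on_ddir[OF S])
  then show ?thesis by (simp add: smooth_on_iff)
qed

text \<open>On the complex line from \<open>x\<close> to \<open>y\<close> the derivatives in the
  parameter are the iterated directional derivatives of \<open>f\<close>, so the power series in one
  variable vanishes.\<close>

lemma holo_identity:
  fixes f :: "complex^'n \<Rightarrow> complex"
  assumes f: "holo_on (ball x r) f"
    and D: "\<And>k v. ((\<lambda>h. ddir h v) ^^ k) f x = 0" and y: "y \<in> ball x r"
  shows "f y = 0"
proof -
  define v where "v = y - x"
  have hol: "holo_on (ball x r) (((\<lambda>h. ddir h v) ^^ k) f)" for k
    by (induction k) (auto intro: f holo_on_ddir)
  have yv: "norm v < r" using y by (simp add: v_def dist_norm norm_minus_commute)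
  have r: "r > 0" using yv norm_ge_zero[of v] by linarith
  \<comment> \<open>The parameter disc has to contain \<open>1\<close>, the parameter of
    \<open>y\<close>. For \<open>v = 0\<close> the line is constant and any radius above
    \<open>1\<close> will do.\<close>
  define \<rho> where "\<rho> = (if v = 0 then 2 else r / norm v)"
  have \<rho>: "\<rho> > 1" using yv r by (auto simp: \<rho>_def)
  have inb: "x + t *s v \<in> ball x r" if "t \<in> ball 0 \<rho>" for t
    using that r by (auto simp: \<rho>_def dist_norm norm_vector_scalar_mult field_simps split: if_splits)
  let ?g = "\<lambda>t. f (x + t *s v)"
  have der: "(deriv ^^ k) ?g t = ((\<lambda>h. ddir h v) ^^ k) f (x + t *s v)" if "t \<in> ball 0 \<rho>" for k t
    using that
  proof (induction k arbitrary: t)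
    case (Suc k)
    have "((\<lambda>t. ((\<lambda>h. ddir h v) ^^ k) f (x + t *s v)) has_field_derivative
        ddir (((\<lambda>h. ddir h v) ^^ k) f) v (x + t *s v)) (at t)"
      by (rule holo_on_line[OF hol inb[OF Suc.prems]])
    then have "((deriv ^^ k) ?g has_field_derivative
        ddir (((\<lambda>h. ddir h v) ^^ k) f) v (x + t *s v)) (at t)"
      by (rule has_field_derivative_transform_within_open[OF _ open_ball Suc.prems])
         (simp add: Suc.IH)
    then show ?case by (simp add: DERIV_imp_deriv)
  qed simp
  have "?g holomorphic_on ball 0 \<rho>"
    by (auto simp: holomorphic_on_def field_differentiable_def
        intro!: exI DERIV_subset[OF holo_on_line[OF f inb]])
  moreover have "(1::complex) \<in> ball 0 \<rho>" "(0::complex) \<in> ball 0 \<rho>" using \<rho> by auto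
  ultimately have "?g 1 = 0"
    using holomorphic_fun_eq_0_on_ball[of ?g 0 \<rho> 1] der[of 0] D by simp
  then show ?thesis by (simp add: v_def)
qed

section \<open>Functions whose differential is a combination of independent differentials\<close>

text \<open>\<open>dual_frame\<close> encodes complex linear independence of the component
  differentials at \<open>x\<close>: the \<open>\<mu> i\<close> are the coefficients of complex
  tangent vectors dual to them. They are chosen point by point, with no regularity in
  \<open>x\<close>.\<close>

locale independent_differentials =
  fixes \<Omega> :: "'a::euclidean_space set" and \<phi> :: "'a \<Rightarrow> complex^'n"
  assumes open_dom: "open \<Omega>" and smooth: "smooth_on \<Omega> \<phi>"
    and dual_frame: "x \<in> \<Omega> \<Longrightarrow> \<exists>\<mu> :: 'n \<Rightarrow> 'a \<Rightarrow> complex. \<forall>i j.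
      (\<Sum>b\<in>Basis. \<mu> i b * ddir (\<lambda>x. \<phi> x $ j) b x) = (if i = j then 1 else 0)"
begin

abbreviation d\<phi> where "d\<phi> j b \<equiv> ddir (\<lambda>x. \<phi> x $ j) b"

lemma smooth_component: "smooth_on \<Omega> (\<lambda>x. \<phi> x $ j)"
  by (rule smooth_on_vec_nth[OF open_dom smooth])

lemma contract:
  assumes "\<And>i j. (\<Sum>b\<in>Basis. \<mu> i b * d\<phi> j b x) = (if i = j then 1 else (0::complex))"
  shows "(\<Sum>b\<in>Basis. \<mu> i b * (\<Sum>j\<in>UNIV. w j * d\<phi> j b x)) = w i"
proof -
  have "(\<Sum>b\<in>Basis. \<mu> i b * (\<Sum>j\<in>UNIV. w j * d\<phi> j b x))
      = (\<Sum>j\<in>UNIV. w j * (\<Sum>b\<in>Basis. \<mu> i b * d\<phi> j b x))"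
    by (simp add: sum_distrib_left mult_ac) (rule sum.swap)
  also have "\<dots> = w i" by (simp add: assms if_distrib[of "\<lambda>y. _ * y"] cong: if_cong)
  finally show ?thesis .
qed

lemma coefficients_unique:
  assumes "x \<in> \<Omega>"
    and "\<And>b. b \<in> Basis \<Longrightarrow> (\<Sum>j\<in>UNIV. w j * d\<phi> j b x) = (\<Sum>j\<in>UNIV. w' j * d\<phi> j b x)"
  shows "w i = w' i"
proof -
  obtain \<mu> :: "'n \<Rightarrow> 'a \<Rightarrow> complex" where \<mu>:
    "\<And>i j. (\<Sum>b\<in>Basis. \<mu> i b * d\<phi> j b x) = (if i = j then 1 else 0)"
    using dual_frame[OF assms(1)] by blast
  show ?thesis using contract[OF \<mu>, of i w] contract[OF \<mu>, of i w'] assms(2) by simp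
qed

text \<open>This is \<open>d(df) = 0\<close> for \<open>df = \<Sum>\<^sub>j w\<^sub>j d\<phi>\<^sub>j\<close>, contracted with the dual frame.\<close>

lemma ddir_coefficient:
  assumes f: "smooth_on \<Omega> f" and w: "\<And>j x. x \<in> \<Omega> \<Longrightarrow> w j differentiable (at x)"
    and df: "\<And>x b. x \<in> \<Omega> \<Longrightarrow> b \<in> Basis \<Longrightarrow> ddir f b x = (\<Sum>j\<in>UNIV. w j x * d\<phi> j b x)"
    and x: "x \<in> \<Omega>" and a: "a \<in> Basis"
    and \<mu>: "\<And>i j. (\<Sum>b\<in>Basis. \<mu> i b * d\<phi> j b x) = (if i = j then 1 else (0::complex))"
  shows "ddir (w i) a x = (\<Sum>j\<in>UNIV. (\<Sum>b\<in>Basis. \<mu> i b * ddir (w j) b x) * d\<phi> j a x)"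
proof -
  have second: "ddir (ddir f b) a x = (\<Sum>j\<in>UNIV. w j x * ddir (d\<phi> j b) a x
        + ddir (w j) a x * d\<phi> j b x)" if "b \<in> Basis" for a b
  proof -
    have "ddir (ddir f b) a x = ddir (\<lambda>x. \<Sum>j\<in>UNIV. w j x * d\<phi> j b x) a x"
      by (rule ddir_cong[OF open_dom x df[OF _ that]])
    also have "\<dots> = (\<Sum>j\<in>UNIV. w j x * ddir (d\<phi> j b) a x
        + ddir (w j) a x * d\<phi> j b x)"
      by (rule ddir_eq, intro has_derivative_sum has_derivative_mult has_derivative_frechet w[OF x]
          smooth_on_differentiable[OF smooth_on_ddir[OF smooth_component that] x])
    finally show ?thesis .
  qed
  have sym: "(\<Sum>j\<in>UNIV. ddir (w j) a x * d\<phi> j b x)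
      = (\<Sum>j\<in>UNIV. ddir (w j) b x * d\<phi> j a x)" if b: "b \<in> Basis" for b
  proof -
    have "ddir (d\<phi> j b) a x = ddir (d\<phi> j a) b x" for j
      by (rule smooth_on_ddir_commute[OF open_dom smooth_component x b a])
    moreover have "ddir (ddir f b) a x = ddir (ddir f a) b x"
      by (rule smooth_on_ddir_commute[OF open_dom f x b a])
    ultimately show ?thesis using second[OF b, of a] second[OF a, of b] by (simp add: sum.distrib)
  qed
  have "ddir (w i) a x = (\<Sum>b\<in>Basis. \<mu> i b * (\<Sum>j\<in>UNIV. ddir (w j) a x * d\<phi> j b x))"
    by (simp add: contract[OF \<mu>, where w="\<lambda>j. ddir (w j) a x"])
  also have "\<dots> = (\<Sum>b\<in>Basis. \<mu> i b * (\<Sum>j\<in>UNIV. ddir (w j) b x * d\<phi> j a x))"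
    by (intro sum.cong refl) (simp add: sym)
  also have "\<dots> = (\<Sum>j\<in>UNIV. (\<Sum>b\<in>Basis. \<mu> i b * ddir (w j) b x) * d\<phi> j a x)"
    by (simp add: sum_distrib_left sum_distrib_right mult_ac) (rule sum.swap)
  finally show ?thesis .
qed

text \<open>The differential of a coefficient again lies in the span of the differentials of the
  components of \<open>\<phi>\<close>. Vectors of type \<open>(0,1)\<close> annihilate the latter,
  and this is what makes the coefficients CR functions.\<close>

lemma ddir_coefficient_span:
  assumes "smooth_on \<Omega> f" "\<And>j x. x \<in> \<Omega> \<Longrightarrow> w j differentiable (at x)"
    "\<And>x b. x \<in> \<Omega> \<Longrightarrow> b \<in> Basis \<Longrightarrow> ddir f b x = (\<Sum>j\<in>UNIV. w j x * d\<phi> j b x)"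
    and x: "x \<in> \<Omega>"
  shows "\<exists>c. \<forall>b\<in>Basis. ddir (w i) b x = (\<Sum>j\<in>UNIV. c j * d\<phi> j b x)"
proof -
  obtain \<mu> :: "'n \<Rightarrow> 'a \<Rightarrow> complex" where \<mu>:
    "\<And>i j. (\<Sum>b\<in>Basis. \<mu> i b * d\<phi> j b x) = (if i = j then 1 else 0)"
    using dual_frame[OF x] by blast
  show ?thesis
    using ddir_coefficient[OF assms(1-3) x _ \<mu>] by (intro exI[of _ "\<lambda>j. \<Sum>b\<in>Basis. \<mu> i b * ddir (w j) b x"]) blast
qed

text \<open>The second coefficients form a Hessian with respect to \<open>\<phi>\<close>, symmetric
  for the same reason as an ordinary one. This becomes the commutation of the operators
  \<open>Dop j\<close> along the image of \<open>Z\<close>.\<close>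

lemma coefficients_symmetric:
  assumes "smooth_on \<Omega> f" "\<And>j x. x \<in> \<Omega> \<Longrightarrow> w j differentiable (at x)"
    "\<And>x b. x \<in> \<Omega> \<Longrightarrow> b \<in> Basis \<Longrightarrow> ddir f b x = (\<Sum>j\<in>UNIV. w j x * d\<phi> j b x)"
    and x: "x \<in> \<Omega>"
    and dw: "\<And>i b. b \<in> Basis \<Longrightarrow> ddir (w i) b x = (\<Sum>j\<in>UNIV. c j i * d\<phi> j b x)"
  shows "c i j = c j i"
proof -
  obtain \<mu> :: "'n \<Rightarrow> 'a \<Rightarrow> complex" where \<mu>:
    "\<And>i j. (\<Sum>b\<in>Basis. \<mu> i b * d\<phi> j b x) = (if i = j then 1 else 0)"
    using dual_frame[OF x] by blast
  have "c i j = (\<Sum>b\<in>Basis. \<mu> j b * ddir (w i) b x)"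
    by (rule coefficients_unique[OF x, where w="\<lambda>i. c i j"])
       (simp add: dw[symmetric] ddir_coefficient[OF assms(1-3) x _ \<mu>])
  also have "\<dots> = (\<Sum>b\<in>Basis. \<mu> j b * (\<Sum>l\<in>UNIV. c l i * d\<phi> l b x))"
    by (simp add: dw)
  also have "\<dots> = c j i" by (rule contract[OF \<mu>])
  finally show ?thesis .
qed

lemma ddir_holo_comp:
  assumes T: "holo_on T g" "\<phi> ` \<Omega> \<subseteq> T" and x: "x \<in> \<Omega>"
  shows "ddir (\<lambda>x. g (\<phi> x)) b x = (\<Sum>j\<in>UNIV. ddir g (axis j 1) (\<phi> x) * d\<phi> j b x)"
proof -
  have \<phi>x: "\<phi> x \<in> T" using T x by blast
  have d: "\<phi> differentiable (at x)" by (rule smooth_on_differentiable[OF smooth x])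
  have "ddir (\<lambda>x. g (\<phi> x)) b x = ddir g (ddir \<phi> b x) (\<phi> x)"
    by (rule ddir_compose[OF d holo_on_differentiable[OF T(1) \<phi>x]])
  also have "\<dots> = (\<Sum>j\<in>UNIV. ddir \<phi> b x $ j * ddir g (axis j 1) (\<phi> x))"
    by (rule ddir_sum_axis[OF T(1) \<phi>x])
  also have "\<dots> = (\<Sum>j\<in>UNIV. ddir g (axis j 1) (\<phi> x) * d\<phi> j b x)"
    using ddir_eq[OF bounded_linear.has_derivative[OF bounded_linear_vec_nth has_derivative_frechet[OF d]]]
    by (simp add: mult.commute)
  finally show ?thesis .
qed

lemma vanishing_holo:
  assumes x: "x \<in> \<Omega>" and g: "holo_on (ball (\<phi> x) r) g" and \<phi>: "\<phi> ` \<Omega> \<subseteq> ball (\<phi> x) r"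
    and zero: "\<And>x. x \<in> \<Omega> \<Longrightarrow> g (\<phi> x) = 0" and y: "y \<in> ball (\<phi> x) r"
  shows "g y = 0"
proof -
  have "holo_on (ball (\<phi> x) r) (((\<lambda>h. ddir h v) ^^ k) g) \<and>
      (\<forall>x\<in>\<Omega>. ((\<lambda>h. ddir h v) ^^ k) g (\<phi> x) = 0)" for k v
  proof (induction k)
    case (Suc k)
    define h where "h = ((\<lambda>h. ddir h v) ^^ k) g"
    have h: "holo_on (ball (\<phi> x) r) h" "\<And>x. x \<in> \<Omega> \<Longrightarrow> h (\<phi> x) = 0" using Suc by (auto simp: h_def)
    have "ddir h v (\<phi> x') = 0" if x': "x' \<in> \<Omega>" for x'
    proof -
      have "ddir (\<lambda>x. h (\<phi> x)) b x' = 0" for b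
        using ddir_cong[OF open_dom x', of "\<lambda>x. h (\<phi> x)" "\<lambda>x. 0" b] h(2) by simp
      then have "ddir h (axis j 1) (\<phi> x') = 0" for j
        using coefficients_unique[OF x', where w="\<lambda>j. ddir h (axis j 1) (\<phi> x')" and w'="\<lambda>j. 0"]
          ddir_holo_comp[OF h(1) \<phi> x'] by simp
      then show ?thesis using ddir_sum_axis[OF h(1), of "\<phi> x'" v] \<phi> x' by auto
    qed
    then show ?case using holo_on_ddir[OF open_ball h(1)] by (simp add: h_def)
  qed (use g zero in auto)
  then show ?thesis using holo_identity[OF g _ y] x by blast
qed

end

section \<open>Factoring through the independent coordinates\<close>

text \<open>A single term of the exponential series. At \<open>x = k\<close> it gives
  \<open>k ^ k \<le> fact k * exp k\<close>, which turns nested Cauchy estimates into factorial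
  growth; at \<open>x = 1 / t\<close> it gives the flatness of the bump function.\<close>

lemma power_le_fact_exp:
  fixes x :: real
  assumes "x \<ge> 0"
  shows "x ^ k \<le> fact k * exp x"
proof -
  have "(\<lambda>n. inverse (fact n) * x ^ n) sums exp x" using exp_converges[of x] by simp
  then have sm: "summable (\<lambda>n. inverse (fact n) * x ^ n)"
    and eq: "(\<Sum>n. inverse (fact n) * x ^ n) = exp x" by (auto simp: sums_iff)
  have "(\<Sum>n\<in>{k}. inverse (fact n) * x ^ n) \<le> exp x"
    unfolding eq[symmetric] by (rule sum_le_suminf[OF sm]) (use assms in auto)
  then show ?thesis by (simp add: field_simps)
qed

text \<open>In the application \<open>Z\<close> is the inclusion of \<open>M\<close> in coordinates
  of \<open>X\<close>, and \<open>F j l\<close> extends the coefficient of the differential of the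
  component \<open>j\<close> of \<open>\<phi>\<close> in that of coordinate \<open>l\<close>. The
  relation \<open>dZ\<close> holds on the image of \<open>Z\<close> only, whereas \<open>F\<close>
  is holomorphic on a full ball, where Cauchy estimates apply.\<close>

locale holomorphic_coefficients = independent_differentials \<Omega> \<phi>
  for \<Omega> :: "'a::euclidean_space set" and \<phi> :: "'a \<Rightarrow> complex^'n" +
  fixes Z :: "'a \<Rightarrow> complex^'v" and q :: "complex^'v" and R :: real
    and F :: "'n \<Rightarrow> 'v \<Rightarrow> complex^'v \<Rightarrow> complex"
  assumes smooth_Z: "smooth_on \<Omega> Z" and Z_in: "Z ` \<Omega> \<subseteq> ball q R"
    and holo_F: "holo_on (ball q R) (F j l)"
    and dZ: "x \<in> \<Omega> \<Longrightarrow> b \<in> Basis \<Longrightarrow>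
      ddir (\<lambda>x. Z x $ l) b x = (\<Sum>j\<in>UNIV. F j l (Z x) * d\<phi> j b x)"
begin

definition Dop :: "'n \<Rightarrow> (complex^'v \<Rightarrow> complex) \<Rightarrow> complex^'v \<Rightarrow> complex" where
  "Dop j g = (\<lambda>y. \<Sum>l\<in>UNIV. F j l y * ddir g (axis l 1) y)"

text \<open>The sum over ordered words \<open>J\<close> of length \<open>k\<close>, not over
  multi-indices, which is why the series below divides by \<open>fact k\<close> alone. The operator
  applied first to \<open>g\<close> is the one split off.\<close>

primrec taylor :: "nat \<Rightarrow> (complex^'v \<Rightarrow> complex) \<Rightarrow> complex^'n \<Rightarrow> complex^'v \<Rightarrow> complex" where
  "taylor 0 g \<zeta> y = g y"
| "taylor (Suc k) g \<zeta> y = (\<Sum>j\<in>UNIV. \<zeta> $ j * taylor k (Dop j g) \<zeta> y)"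

abbreviation hol where "hol \<equiv> holo_on (ball q R)"

lemma hol_Dop: "hol g \<Longrightarrow> hol (Dop j g)"
  unfolding Dop_def by (intro holo_on_sum holo_on_mult holo_F holo_on_ddir open_ball)

lemma Z_differentiable: "x \<in> \<Omega> \<Longrightarrow> Z differentiable (at x)"
  by (rule smooth_on_differentiable[OF smooth_Z])

lemma smooth_comp: "hol g \<Longrightarrow> smooth_on \<Omega> (\<lambda>x. g (Z x))"
  by (rule smooth_on_compose[OF open_dom Z_in smooth_Z holo_on_imp_smooth_on[OF open_ball]])

lemma ddir_comp_Z:
  assumes g: "hol g" and x: "x \<in> \<Omega>" and b: "b \<in> Basis"
  shows "ddir (\<lambda>x. g (Z x)) b x = (\<Sum>j\<in>UNIV. Dop j g (Z x) * d\<phi> j b x)"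
proof -
  have Zx: "Z x \<in> ball q R" using Z_in x by blast
  note d = Z_differentiable[OF x]
  have "ddir (\<lambda>x. g (Z x)) b x = ddir g (ddir Z b x) (Z x)"
    by (rule ddir_compose[OF d holo_on_differentiable[OF g Zx]])
  also have "\<dots> = (\<Sum>l\<in>UNIV. ddir Z b x $ l * ddir g (axis l 1) (Z x))"
    by (rule ddir_sum_axis[OF g Zx])
  also have "\<dots> = (\<Sum>l\<in>UNIV. ddir (\<lambda>x. Z x $ l) b x * ddir g (axis l 1) (Z x))"
    using ddir_eq[OF bounded_linear.has_derivative[OF bounded_linear_vec_nth has_derivative_frechet[OF d]]]
    by simp
  also have "\<dots> = (\<Sum>j\<in>UNIV. Dop j g (Z x) * d\<phi> j b x)"
    by (simp add: dZ[OF x b] Dop_def sum_distrib_left sum_distrib_right mult_ac) (rule sum.swap)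
  finally show ?thesis .
qed

text \<open>Along the image of \<open>Z\<close> the value of \<open>Dop j g\<close> is a coefficient
  of the differential of \<open>g\<close> composed with \<open>Z\<close>. It therefore depends on
  that composite only, although \<open>Dop j\<close> differentiates in ambient directions.\<close>

lemma Dop_cong:
  assumes "hol g" "hol h" "\<And>x. x \<in> \<Omega> \<Longrightarrow> g (Z x) = h (Z x)" and x: "x \<in> \<Omega>"
  shows "Dop j g (Z x) = Dop j h (Z x)"
proof (rule coefficients_unique[OF x, where w="\<lambda>j. Dop j g (Z x)" and w'="\<lambda>j. Dop j h (Z x)"])
  fix b :: 'a assume b: "b \<in> Basis"
  have "ddir (\<lambda>x. g (Z x)) b x = ddir (\<lambda>x. h (Z x)) b x"
    by (rule ddir_cong[OF open_dom x assms(3)])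
  then show "(\<Sum>j\<in>UNIV. Dop j g (Z x) * d\<phi> j b x) =
      (\<Sum>j\<in>UNIV. Dop j h (Z x) * d\<phi> j b x)"
    by (simp add: ddir_comp_Z[OF assms(1) x b] ddir_comp_Z[OF assms(2) x b])
qed

lemma Dop_commute:
  assumes g: "hol g" and x: "x \<in> \<Omega>"
  shows "Dop i (Dop j g) (Z x) = Dop j (Dop i g) (Z x)"
  by (rule coefficients_symmetric[OF smooth_comp[OF g] _ ddir_comp_Z[OF g] x,
        where c="\<lambda>i j. Dop i (Dop j g) (Z x)"])
     (auto intro: smooth_on_differentiable[OF smooth_comp[OF hol_Dop[OF g]]] ddir_comp_Z[OF hol_Dop[OF g] x])

lemma taylor_cong:
  assumes "hol g" "hol h" "\<And>x. x \<in> \<Omega> \<Longrightarrow> g (Z x) = h (Z x)" and x: "x \<in> \<Omega>"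
  shows "taylor k g \<zeta> (Z x) = taylor k h \<zeta> (Z x)"
  using assms(1-3)
proof (induction k arbitrary: g h)
  case (Suc k)
  have "taylor k (Dop j g) \<zeta> (Z x) = taylor k (Dop j h) \<zeta> (Z x)" for j
    using Suc.prems by (intro Suc.IH hol_Dop Dop_cong)
  then show ?case by simp
qed (use x in auto)

text \<open>Commutation is known on the image of \<open>Z\<close> only, yet further operators are
  applied afterwards; \<open>taylor_cong\<close> shows that these do not see the difference.\<close>

lemma taylor_commute:
  "hol g \<Longrightarrow> x \<in> \<Omega> \<Longrightarrow> taylor k (Dop i (Dop j g)) \<zeta> (Z x) = taylor k (Dop j (Dop i g)) \<zeta> (Z x)"
  by (intro taylor_cong hol_Dop Dop_commute)

definition recentred :: "complex^'n \<Rightarrow> nat \<Rightarrow> (complex^'v \<Rightarrow> complex) \<Rightarrow> 'a \<Rightarrow> complex" where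
  "recentred c k g x = taylor k g (c - \<phi> x) (Z x)"

text \<open>Product rule: differentiating an iterated derivative of \<open>g\<close> along
  \<open>M\<close> prefixes an operator \<open>Dop i\<close> and keeps the degree, while
  differentiating the monomial in \<open>c - \<phi> x\<close> removes one of its \<open>k\<close>
  factors, each with the same effect. Commutation moves the new operator next to
  \<open>g\<close>.\<close>

lemma has_derivative_recentred:
  assumes "hol g" and x: "x \<in> \<Omega>"
  shows "(recentred c k g has_derivative (\<lambda>v. \<Sum>i\<in>UNIV.
     (recentred c k (Dop i g) x - of_nat k * recentred c (k - 1) (Dop i g) x) * d\<phi> i v x)) (at x)"
  using assms(1)
proof (induction k arbitrary: g)
  case 0
  have d: "(\<lambda>x. g (Z x)) differentiable (at x)"
    by (rule smooth_on_differentiable[OF smooth_comp[OF 0] x])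
  have dl: "(\<lambda>x. \<phi> x $ j) differentiable (at x)" for j
    by (rule smooth_on_differentiable[OF smooth_component x])
  have "ddir (\<lambda>x. g (Z x)) v x = (\<Sum>j\<in>UNIV. Dop j g (Z x) * d\<phi> j v x)" for v
  proof -
    have "ddir (\<lambda>x. g (Z x)) v x = (\<Sum>e\<in>Basis. (v \<bullet> e) *\<^sub>R (\<Sum>j\<in>UNIV. Dop j g (Z x) * d\<phi> j e x))"
      by (simp add: ddir_sum_Basis[OF d, where v=v] ddir_comp_Z[OF 0 x])
    also have "\<dots> = (\<Sum>j\<in>UNIV. Dop j g (Z x) * (\<Sum>e\<in>Basis. (v \<bullet> e) *\<^sub>R d\<phi> j e x))"
      by (simp add: scaleR_sum_right sum_distrib_left) (rule sum.swap)
    finally show ?thesis by (simp add: ddir_sum_Basis[OF dl, where v=v])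
  qed
  then show ?case
    using has_derivative_frechet[OF d] by (simp add: recentred_def[abs_def])
next
  case (Suc k)
  let ?D = "\<lambda>i v. d\<phi> i v x"
  let ?r = "\<lambda>k g. recentred c k g x"
  have rec: "recentred c (Suc k) g y = (\<Sum>j\<in>UNIV. (c $ j - \<phi> y $ j) * recentred c k (Dop j g) y)" for k g y
    by (simp add: recentred_def)
  have "((\<lambda>x. \<Sum>j\<in>UNIV. (c $ j - \<phi> x $ j) * recentred c k (Dop j g) x) has_derivative
     (\<lambda>v. \<Sum>j\<in>UNIV. (c $ j - \<phi> x $ j) *
        (\<Sum>i\<in>UNIV. (?r k (Dop i (Dop j g)) - of_nat k * ?r (k - 1) (Dop i (Dop j g))) * ?D i v)
        + (0 - ?D j v) * ?r k (Dop j g))) (at x)"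
    by (intro has_derivative_sum has_derivative_mult has_derivative_diff has_derivative_const
        has_derivative_frechet smooth_on_differentiable[OF smooth_component x] Suc.IH hol_Dop Suc.prems)
  moreover have "(\<Sum>j\<in>UNIV. (c $ j - \<phi> x $ j) *
        (\<Sum>i\<in>UNIV. (?r k (Dop i (Dop j g)) - of_nat k * ?r (k - 1) (Dop i (Dop j g))) * ?D i v)
        + (0 - ?D j v) * ?r k (Dop j g))
      = (\<Sum>i\<in>UNIV. (?r (Suc k) (Dop i g) - of_nat (Suc k) * ?r (Suc k - 1) (Dop i g)) * ?D i v)" for v
  proof -
    have comm: "?r k' (Dop i (Dop j g)) = ?r k' (Dop j (Dop i g))" for k' i j
      unfolding recentred_def by (rule taylor_commute[OF Suc.prems x])
    \<comment> \<open>At \<open>k = 0\<close> the truncated \<open>k - 1\<close> is harmless because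
      of the factor \<open>of_nat k\<close>.\<close>
    have k1: "of_nat k * (\<Sum>j\<in>UNIV. (c $ j - \<phi> x $ j) * ?r (k - 1) (Dop j (Dop i g))) = of_nat k * ?r k (Dop i g)" for i
      by (cases k) (simp_all add: rec)
    have "(\<Sum>j\<in>UNIV. (c $ j - \<phi> x $ j) *
        (\<Sum>i\<in>UNIV. (?r k (Dop i (Dop j g)) - of_nat k * ?r (k - 1) (Dop i (Dop j g))) * ?D i v))
      = (\<Sum>i\<in>UNIV. (\<Sum>j\<in>UNIV. (c $ j - \<phi> x $ j) *
          (?r k (Dop j (Dop i g)) - of_nat k * ?r (k - 1) (Dop j (Dop i g)))) * ?D i v)"
      unfolding comm[of _ i for i] sum_distrib_left sum_distrib_right
      by (subst sum.swap) (simp add: comm mult_ac)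
    also have "\<dots> = (\<Sum>i\<in>UNIV. (?r (Suc k) (Dop i g) - of_nat k * ?r k (Dop i g)) * ?D i v)"
    proof (rule sum.cong[OF refl])
      fix i
      have "(\<Sum>j\<in>UNIV. (c $ j - \<phi> x $ j) *
          (?r k (Dop j (Dop i g)) - of_nat k * ?r (k - 1) (Dop j (Dop i g))))
        = ?r (Suc k) (Dop i g) - of_nat k * ?r k (Dop i g)"
        unfolding rec k1[symmetric] sum_distrib_left sum_subtractf[symmetric]
        by (rule sum.cong) (simp_all add: algebra_simps)
      then show "(\<Sum>j\<in>UNIV. (c $ j - \<phi> x $ j) *
          (?r k (Dop j (Dop i g)) - of_nat k * ?r (k - 1) (Dop j (Dop i g)))) * ?D i v
        = (?r (Suc k) (Dop i g) - of_nat k * ?r k (Dop i g)) * ?D i v" by simp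
    qed
    finally have 1: "(\<Sum>j\<in>UNIV. (c $ j - \<phi> x $ j) *
        (\<Sum>i\<in>UNIV. (?r k (Dop i (Dop j g)) - of_nat k * ?r (k - 1) (Dop i (Dop j g))) * ?D i v))
       = (\<Sum>i\<in>UNIV. (?r (Suc k) (Dop i g) - of_nat k * ?r k (Dop i g)) * ?D i v)" .
    show ?thesis unfolding sum.distrib 1
      unfolding sum.distrib[symmetric] by (rule sum.cong) (simp_all add: algebra_simps)
  qed
  ultimately show ?case unfolding rec[abs_def] by simp
qed

definition taylor_sum :: "complex^'n \<Rightarrow> nat \<Rightarrow> (complex^'v \<Rightarrow> complex) \<Rightarrow> 'a \<Rightarrow> complex" where
  "taylor_sum c N g x = (\<Sum>k\<le>N. recentred c k g x / fact k)"

text \<open>The differentials of consecutive terms telescope.\<close>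

lemma has_derivative_taylor_sum:
  assumes g: "hol g" and x: "x \<in> \<Omega>"
  shows "(taylor_sum c N g has_derivative
     (\<lambda>v. \<Sum>i\<in>UNIV. recentred c N (Dop i g) x / fact N * d\<phi> i v x)) (at x)"
proof (induction N)
  case 0
  show ?case using has_derivative_recentred[OF g x, of c 0]
    by (simp add: taylor_sum_def[abs_def])
next
  case (Suc N)
  let ?D = "\<lambda>i v. d\<phi> i v x"
  have eq: "taylor_sum c (Suc N) g = (\<lambda>x. taylor_sum c N g x + (1 / fact (Suc N)) * recentred c (Suc N) g x)"
    by (simp add: taylor_sum_def[abs_def])
  have f: "(1 / fact (Suc N)) * (of_nat (Suc N) * a) = a / (fact N :: complex)" for a :: complex
    by (simp add: fact_Suc del: of_nat_Suc)
  have "(taylor_sum c (Suc N) g has_derivative (\<lambda>v.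
      (\<Sum>i\<in>UNIV. recentred c N (Dop i g) x / fact N * ?D i v) + (1 / fact (Suc N)) *
      (\<Sum>i\<in>UNIV. (recentred c (Suc N) (Dop i g) x - of_nat (Suc N) * recentred c (Suc N - 1) (Dop i g) x) * ?D i v))) (at x)"
    unfolding eq by (rule has_derivative_add[OF Suc has_derivative_mult_right[OF has_derivative_recentred[OF g x]]])
  moreover have "(\<Sum>i\<in>UNIV. recentred c N (Dop i g) x / fact N * ?D i v) + (1 / fact (Suc N)) *
      (\<Sum>i\<in>UNIV. (recentred c (Suc N) (Dop i g) x - of_nat (Suc N) * recentred c (Suc N - 1) (Dop i g) x) * ?D i v)
     = (\<Sum>i\<in>UNIV. recentred c (Suc N) (Dop i g) x / fact (Suc N) * ?D i v)" for v
    unfolding sum_distrib_left sum.distrib[symmetric]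
  proof (rule sum.cong[OF refl])
    fix i
    have "recentred c N (Dop i g) x / fact N * ?D i v + 1 / fact (Suc N) * ((recentred c (Suc N) (Dop i g) x - of_nat (Suc N) * recentred c (Suc N - 1) (Dop i g) x) * ?D i v)
      = (recentred c N (Dop i g) x / fact N + (recentred c (Suc N) (Dop i g) x / fact (Suc N) - (1 / fact (Suc N)) * (of_nat (Suc N) * recentred c N (Dop i g) x))) * ?D i v"
      by (simp add: algebra_simps diff_divide_distrib)
    then show "recentred c N (Dop i g) x / fact N * ?D i v + 1 / fact (Suc N) * ((recentred c (Suc N) (Dop i g) x - of_nat (Suc N) * recentred c (Suc N - 1) (Dop i g) x) * ?D i v)
      = recentred c (Suc N) (Dop i g) x / fact (Suc N) * ?D i v"
      unfolding f by simp
  qed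
  ultimately show ?case by simp
qed

lemma norm_axis: "norm (axis i x :: 'b::real_normed_vector^'m) = norm x"
  by (simp add: norm_vec_def L2_set_def axis_def if_distrib[of norm] if_distrib[of "\<lambda>y. y\<^sup>2"] cong: if_cong)

text \<open>Each operator costs one Cauchy estimate, hence a loss \<open>\<delta>\<close> of radius
  and a factor \<open>CARD('v) * K / \<delta>\<close>; the sum over its index adds a factor
  \<open>CARD('n) * norm \<zeta>\<close>.\<close>

lemma taylor_bound_step:
  assumes K: "\<And>j l y. y \<in> ball q s \<Longrightarrow> cmod (F j l y) \<le> K"
    and s: "s \<le> R" and \<delta>: "\<delta> > 0"
    and g: "hol g" and C: "\<And>y. y \<in> ball q s \<Longrightarrow> cmod (g y) \<le> C" and y: "y \<in> ball q (s - real k * \<delta>)"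
  shows "cmod (taylor k g \<zeta> y) \<le> C * (real CARD('n) * norm \<zeta> * (real CARD('v) * K / \<delta>)) ^ k"
  using s g C y K
proof (induction k arbitrary: g s C)
  case (Suc k)
  let ?L = "real CARD('v) * K / \<delta>"
  have Dop: "cmod (Dop j g y) \<le> C * ?L" if y: "y \<in> ball q (s - \<delta>)" for j y
  proof -
    have sub: "cball y \<delta> \<subseteq> ball q s"
    proof
      fix w assume "w \<in> cball y \<delta>"
      then show "w \<in> ball q s" using y dist_triangle[of q w y] by simp
    qed
    have yin: "y \<in> ball q s" using subsetD[OF sub, of y] \<delta> by simp
    have B: "cmod (ddir g (axis l 1) y) \<le> C / \<delta>" for l
    proof -
      have "cmod (ddir g (axis l 1) y) \<le> C / \<delta> * norm (axis l (1::complex))"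
        by (rule Cauchy_estimate_ddir[OF Suc.prems(2) _ \<delta>]) (use sub Suc.prems in auto)
      then show ?thesis by (simp add: norm_axis)
    qed
    have "cmod (Dop j g y) \<le> (\<Sum>l\<in>(UNIV::'v set). K * (C / \<delta>))"
      unfolding Dop_def
    proof (rule sum_norm_le)
      have "0 \<le> K" by (rule order_trans[OF norm_ge_zero Suc.prems(5)[OF yin]])
      then show "cmod (F j l y * ddir g (axis l 1) y) \<le> K * (C / \<delta>)" for l
        unfolding norm_mult by (intro mult_mono Suc.prems(5)[OF yin] B) auto
    qed
    then show ?thesis by (simp add: mult_ac)
  qed
  have IH: "cmod (taylor k (Dop j g) \<zeta> y) \<le> C * ?L * (real CARD('n) * norm \<zeta> * ?L) ^ k" for j
  proof (rule Suc.IH[of "s - \<delta>"])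
    show "y \<in> ball q (s - \<delta> - real k * \<delta>)" using Suc.prems(4) by (simp add: algebra_simps)
  qed (use Suc.prems \<delta> Dop hol_Dop in auto)
  have "cmod (taylor (Suc k) g \<zeta> y) \<le> (\<Sum>j\<in>(UNIV::'n set). norm \<zeta> * (C * ?L * (real CARD('n) * norm \<zeta> * ?L) ^ k))"
    unfolding taylor.simps
  proof (rule sum_norm_le)
    show "cmod (\<zeta> $ j * taylor k (Dop j g) \<zeta> y)
        \<le> norm \<zeta> * (C * ?L * (real CARD('n) * norm \<zeta> * ?L) ^ k)" for j
      unfolding norm_mult by (intro mult_mono IH Finite_Cartesian_Product.norm_nth_le) auto
  qed
  also have "\<dots> = C * (real CARD('n) * norm \<zeta> * ?L) ^ Suc k" by (simp add: mult_ac)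
  finally show ?case .
qed auto

text \<open>In \<open>taylor_bound\<close> half of the radius \<open>s\<close> is spent in
  \<open>k\<close> equal steps of length \<open>s / (2 * k)\<close>. The resulting power contains
  \<open>k ^ k\<close>, at most \<open>fact k * exp 1 ^ k\<close>; after division by
  \<open>fact k\<close> the remaining base is \<open>rate s K * norm \<zeta>\<close>.\<close>

definition rate :: "real \<Rightarrow> real \<Rightarrow> real" where
  "rate s K = 2 * exp 1 * real CARD('n) * real CARD('v) * K / s"

lemma taylor_bound:
  assumes K: "\<And>j l y. y \<in> ball q s \<Longrightarrow> cmod (F j l y) \<le> K" and K0: "K \<ge> 0"
    and s: "0 < s" "s \<le> R"
    and g: "hol g" and C: "\<And>y. y \<in> ball q s \<Longrightarrow> cmod (g y) \<le> C" and y: "y \<in> ball q (s / 2)"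
  shows "cmod (taylor k g \<zeta> y) / fact k \<le> C * (rate s K * norm \<zeta>) ^ k"
proof (cases "k = 0")
  case False
  define \<delta> where "\<delta> = s / (2 * real k)"
  have \<delta>: "\<delta> > 0" "s - real k * \<delta> = s / 2" using False s by (auto simp: \<delta>_def)
  have C0: "C \<ge> 0" using C[of q] s by (meson centre_in_ball norm_ge_zero order_trans)
  define u where "u = 2 * real CARD('n) * norm \<zeta> * real CARD('v) * K / s"
  have u: "u \<ge> 0" using K0 s by (simp add: u_def)
  have "cmod (taylor k g \<zeta> y) \<le> C * (real CARD('n) * norm \<zeta> * (real CARD('v) * K / \<delta>)) ^ k"
    by (rule taylor_bound_step[OF K s(2) \<delta>(1) g C]) (use y in \<open>auto simp only: \<delta>(2)\<close>)
  also have "real CARD('n) * norm \<zeta> * (real CARD('v) * K / \<delta>) = u * real k"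
    using False s by (simp add: \<delta>_def u_def)
  also have "C * (u * real k) ^ k \<le> C * (u ^ k * (fact k * exp 1 ^ k))"
    unfolding power_mult_distrib using C0 u power_le_fact_exp[of "real k" k] exp_of_nat_mult[of k "1::real"] by (intro mult_left_mono) auto
  also have "\<dots> = fact k * (C * (rate s K * norm \<zeta>) ^ k)"
    by (simp add: rate_def u_def power_mult_distrib power_divide mult_ac)
  finally show ?thesis by (simp add: divide_le_eq mult_ac)
qed (use C y s in auto)

text \<open>At \<open>c = \<phi> x\<close> the increment is \<open>0\<close>, so only the term of
  degree \<open>0\<close> survives.\<close>

lemma taylor_sum_self: "taylor_sum (\<phi> x) N g x = g (Z x)"
proof -
  have "taylor_sum (\<phi> x) N g x = (\<Sum>k\<le>N. if k = 0 then g (Z x) else 0)"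
    unfolding taylor_sum_def by (rule sum.cong) (auto simp: recentred_def gr0_conv_Suc)
  then show ?thesis by simp
qed

lemma holo_on_taylor: "holo_on S (\<lambda>\<zeta>. taylor k g (\<zeta> - c) y)"
proof (induction k arbitrary: g)
  case (Suc k)
  then show ?case by (auto intro!: holo_on_sum holo_on_mult holo_on_diff)
qed simp

theorem factors_through_coordinates:
  assumes x0: "x0 \<in> \<Omega>" and q: "Z x0 = q" and g: "hol g"
  shows "\<exists>h r \<rho>. r > 0 \<and> \<rho> > 0 \<and> holo_on (ball (\<phi> x0) r) h \<and> ball x0 \<rho> \<subseteq> \<Omega> \<and>
     (\<forall>x\<in>ball x0 \<rho>. \<phi> x \<in> ball (\<phi> x0) r \<and> g (Z x) = h (\<phi> x))"
proof -
  have R: "R > 0" using Z_in x0 q by (metis centre_in_ball image_subset_iff)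
  define s where "s = R / 2"
  have s: "0 < s" "s \<le> R" "s < R" using R by (auto simp: s_def)
  have bdd: "\<exists>C. \<forall>y\<in>ball q s. cmod (h y) \<le> C" if "hol h" for h
  proof -
    have "cball q s \<subseteq> ball q R" using s by auto
    then have "compact (h ` cball q s)"
      by (intro compact_continuous_image continuous_on_subset[OF holo_on_continuous_on[OF that]]) auto
    then obtain C where "\<forall>y\<in>h ` cball q s. cmod y \<le> C" using compact_imp_bounded bounded_iff by metis
    then show ?thesis by (intro exI[of _ C]) auto
  qed
  obtain KF where KF: "\<And>j l y. y \<in> ball q s \<Longrightarrow> cmod (F j l y) \<le> KF j l" using bdd[OF holo_F] by metis
  define K where "K = (\<Sum>j\<in>UNIV. \<Sum>l\<in>UNIV. \<bar>KF j l\<bar>) + 1"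
  have K0: "K > 0" by (auto simp: K_def intro!: add_nonneg_pos sum_nonneg)
  have K: "cmod (F j l y) \<le> K" if "y \<in> ball q s" for j l y
  proof -
    have "\<bar>KF j l\<bar> \<le> (\<Sum>l\<in>UNIV. \<bar>KF j l\<bar>)" by (rule member_le_sum) auto
    also have "\<dots> \<le> (\<Sum>j\<in>UNIV. \<Sum>l\<in>UNIV. \<bar>KF j l\<bar>)"
      by (rule member_le_sum[where f="\<lambda>j. \<Sum>l\<in>UNIV. \<bar>KF j l\<bar>"]) (auto intro: sum_nonneg)
    finally show ?thesis using KF[OF that, of j l] by (simp add: K_def)
  qed
  obtain C where C: "\<And>y. y \<in> ball q s \<Longrightarrow> cmod (g y) \<le> C" using bdd[OF g] by blast
  obtain C1 where C1: "\<And>i y. y \<in> ball q s \<Longrightarrow> cmod (Dop i g y) \<le> C1 i" using bdd[OF hol_Dop[OF g]] by metis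
  have C10: "C1 i \<ge> 0" for i using C1[of q i] s by (meson centre_in_ball norm_ge_zero order_trans)
  have C0: "C \<ge> 0" using C[of q] s by (meson centre_in_ball norm_ge_zero order_trans)
  define P where "P = rate s K"
  have P: "P > 0" using K0 s by (auto simp: P_def rate_def)
  \<comment> \<open>For increments of this size the geometric ratio \<open>P * norm \<zeta>\<close>
    is at most \<open>1/2\<close>.\<close>
  define \<epsilon> where "\<epsilon> = 1 / (2 * P)"
  have \<epsilon>: "\<epsilon> > 0" using P by (simp add: \<epsilon>_def)
  \<comment> \<open>Stated for a general \<open>h\<close> because it is applied to \<open>g\<close>,
    for the convergence of the series, and to each \<open>Dop i g\<close>, for the remainder left by
    telescoping.\<close>
  have bound: "cmod (taylor k h \<zeta> y) / fact k \<le> B * (1/2) ^ k"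
    if h: "hol h" and B: "\<And>y. y \<in> ball q s \<Longrightarrow> cmod (h y) \<le> B" and y: "y \<in> ball q (s / 2)"
      and \<zeta>: "norm \<zeta> \<le> \<epsilon>" for h B y \<zeta> k
  proof -
    have B0: "B \<ge> 0" using B[of q] s by (meson centre_in_ball norm_ge_zero order_trans)
    have "cmod (taylor k h \<zeta> y) / fact k \<le> B * (P * norm \<zeta>) ^ k"
      unfolding P_def using K0 by (intro taylor_bound[OF K _ s(1,2) h B y]) auto
    also have "P * norm \<zeta> \<le> 1/2"
      using mult_left_mono[OF \<zeta>, of P] P by (simp add: \<epsilon>_def)
    then have "B * (P * norm \<zeta>) ^ k \<le> B * (1/2) ^ k"
      using B0 P by (intro mult_left_mono power_mono) auto
    finally show ?thesis .
  qed
  define h where "h = (\<lambda>w. \<Sum>k. taylor k g (w - \<phi> x0) (Z x0) / fact k)"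
  have Zx0: "Z x0 \<in> ball q (s / 2)" using q s by simp
  have lim: "uniform_limit (ball (\<phi> x0) \<epsilon>) (\<lambda>N w. \<Sum>k<N. taylor k g (w - \<phi> x0) (Z x0) / fact k) h sequentially"
    unfolding h_def
  proof (rule Weierstrass_m_test)
    show "norm (taylor k g (w - \<phi> x0) (Z x0) / fact k) \<le> C * (1/2) ^ k" if "w \<in> ball (\<phi> x0) \<epsilon>" for k w
      using bound[OF g C Zx0, of "w - \<phi> x0" k] that by (simp add: norm_divide dist_norm norm_minus_commute)
    show "summable (\<lambda>k. C * (1/2) ^ k)" by (intro summable_mult summable_geometric) simp
  qed
  have h: "holo_on (ball (\<phi> x0) \<epsilon>) h"
  proof (rule holo_on_uniform_limit[OF open_ball _ lim])
    fix N
    have "holo_on (ball (\<phi> x0) \<epsilon>) (\<lambda>w. \<Sum>k<N. (1 / fact k) * taylor k g (w - \<phi> x0) (Z x0))"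
      by (intro holo_on_sum holo_on_cmult holo_on_taylor)
    then show "holo_on (ball (\<phi> x0) \<epsilon>) (\<lambda>w. \<Sum>k<N. taylor k g (w - \<phi> x0) (Z x0) / fact k)" by simp
  qed
  have c\<phi>: "isCont \<phi> x0" "isCont Z x0"
    using smooth_on_continuous_on[OF smooth] smooth_on_continuous_on[OF smooth_Z] x0 open_dom
    by (auto simp: continuous_on_eq_continuous_at)
  \<comment> \<open>Half of \<open>\<epsilon>\<close>, because the increment
    \<open>\<phi> x - \<phi> y\<close> involves two points near \<open>x0\<close>: the evaluation
    point and the moving centre.\<close>
  obtain \<rho>1 where \<rho>1: "\<rho>1 > 0" "\<And>x. dist x x0 < \<rho>1 \<Longrightarrow> dist (\<phi> x) (\<phi> x0) < \<epsilon> / 2"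
    using c\<phi>(1) \<epsilon> unfolding continuous_at_eps_delta by (metis half_gt_zero)
  obtain \<rho>2 where \<rho>2: "\<rho>2 > 0" "\<And>x. dist x x0 < \<rho>2 \<Longrightarrow> dist (Z x) (Z x0) < s / 2"
    using c\<phi>(2) s(1) unfolding continuous_at_eps_delta by (metis half_gt_zero)
  obtain \<rho>3 where \<rho>3: "\<rho>3 > 0" "cball x0 \<rho>3 \<subseteq> \<Omega>" using open_dom x0 open_contains_cball by blast
  define \<rho> where "\<rho> = min \<rho>1 (min \<rho>2 \<rho>3)"
  have \<rho>: "\<rho> > 0" using \<rho>1 \<rho>2 \<rho>3 by (simp add: \<rho>_def)
  have in\<rho>: "x \<in> \<Omega>" "x \<in> cball x0 \<rho>3" "dist (\<phi> x) (\<phi> x0) < \<epsilon> / 2" "Z x \<in> ball q (s / 2)" if "x \<in> ball x0 \<rho>" for x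
    using that \<rho>1(2)[of x] \<rho>2(2)[of x] \<rho>3(2) q by (auto simp: \<rho>_def dist_commute)
  have "\<exists>L. \<forall>x\<in>cball x0 \<rho>3. cmod (d\<phi> i b x) \<le> L" if b: "b \<in> Basis" for i b
  proof -
    have "compact (d\<phi> i b ` cball x0 \<rho>3)"
      by (intro compact_continuous_image
          continuous_on_subset[OF smooth_on_continuous_on[OF smooth_on_ddir[OF smooth_component b]] \<rho>3(2)]) auto
    then obtain L where "\<forall>y\<in>d\<phi> i b ` cball x0 \<rho>3. cmod y \<le> L"
      using compact_imp_bounded bounded_iff by metis
    then show ?thesis by (intro exI[of _ L]) auto
  qed
  note Lex = this
  define L where "L = (\<lambda>i b. SOME L. \<forall>x\<in>cball x0 \<rho>3. cmod (d\<phi> i b x) \<le> L)"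
  have L: "cmod (d\<phi> i b x) \<le> L i b" if "b \<in> Basis" "x \<in> cball x0 \<rho>3" for i b x
    using someI_ex[OF Lex[OF that(1), of i]] that(2) unfolding L_def by blast
  have Ld: "cmod (d\<phi> i v x) \<le> (\<Sum>b\<in>Basis. L i b) * norm v" if x: "x \<in> ball x0 \<rho>" for i v x
  proof -
    have "cmod (d\<phi> i v x) \<le> (\<Sum>b\<in>Basis. norm v * L i b)"
      unfolding ddir_sum_Basis[OF smooth_on_differentiable[OF smooth_component in\<rho>(1)[OF x]], of i v]
      by (intro sum_norm_le) (auto intro!: mult_mono L in\<rho>(2)[OF x] Basis_le_norm)
    then show ?thesis by (simp add: sum_distrib_left mult.commute)
  qed
  define A where "A = (\<Sum>i\<in>UNIV. C1 i * (\<Sum>b\<in>Basis. L i b))"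
  have eq: "g (Z x) = h (\<phi> x)" if x: "x \<in> ball x0 \<rho>" for x
  proof -
    let ?c = "\<phi> x"
    have \<zeta>: "norm (?c - \<phi> y) \<le> \<epsilon>" if y: "y \<in> ball x0 \<rho>" for y
      using in\<rho>(3)[OF x] in\<rho>(3)[OF y] dist_triangle2[of "\<phi> x" "\<phi> y" "\<phi> x0"] by (simp add: dist_norm)
    \<comment> \<open>Mean value inequality on a convex ball, with the evaluation point
      \<open>?c\<close> fixed and the centre moving from \<open>x0\<close> to \<open>x\<close>.
      After telescoping only the order \<open>N\<close> enters, so the bound decays geometrically.
      At the centre \<open>x\<close> the sum is \<open>g (Z x)\<close>; at \<open>x0\<close> it is a
      partial sum of the series for \<open>h (\<phi> x)\<close>.\<close>
    have close: "cmod (taylor_sum ?c N g x - taylor_sum ?c N g x0) \<le> A * (1/2) ^ N * norm (x - x0)" for N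
    proof (rule differentiable_bound[OF convex_ball])
      fix y assume y: "y \<in> ball x0 \<rho>"
      show "(taylor_sum ?c N g has_derivative
        (\<lambda>v. \<Sum>i\<in>UNIV. recentred ?c N (Dop i g) y / fact N * d\<phi> i v y)) (at y within ball x0 \<rho>)"
        by (rule has_derivative_at_withinI[OF has_derivative_taylor_sum[OF g in\<rho>(1)[OF y]]])
      show "onorm (\<lambda>v. \<Sum>i\<in>UNIV. recentred ?c N (Dop i g) y / fact N * d\<phi> i v y) \<le> A * (1/2) ^ N"
      proof (rule onorm_le)
        fix v
        have "cmod (\<Sum>i\<in>UNIV. recentred ?c N (Dop i g) y / fact N * d\<phi> i v y)
          \<le> (\<Sum>i\<in>UNIV. (C1 i * (1/2) ^ N) * ((\<Sum>b\<in>Basis. L i b) * norm v))"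
        proof (rule sum_norm_le)
          fix i
          have "cmod (recentred ?c N (Dop i g) y / fact N) \<le> C1 i * (1/2) ^ N"
            using bound[OF hol_Dop[OF g] C1 in\<rho>(4)[OF y] \<zeta>[OF y]] by (simp add: norm_divide recentred_def)
          then show "cmod (recentred ?c N (Dop i g) y / fact N * d\<phi> i v y)
             \<le> (C1 i * (1/2) ^ N) * ((\<Sum>b\<in>Basis. L i b) * norm v)"
            unfolding norm_mult using Ld[OF y] C10 by (intro mult_mono) auto
        qed
        also have "\<dots> = A * (1/2) ^ N * norm v"
          by (simp add: A_def sum_distrib_left mult_ac)
        finally show "cmod (\<Sum>i\<in>UNIV. recentred ?c N (Dop i g) y / fact N * d\<phi> i v y) \<le> A * (1/2) ^ N * norm v" .
      qed
    qed (use x \<rho> in auto)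
    have xin: "\<phi> x \<in> ball (\<phi> x0) \<epsilon>" using in\<rho>(3)[OF x] \<epsilon> by (simp add: dist_commute)
    \<comment> \<open>\<open>taylor_sum\<close> includes the term of index \<open>N\<close>, hence
      has \<open>Suc N\<close> terms.\<close>
    have "(\<lambda>N. \<Sum>k<Suc N. taylor k g (\<phi> x - \<phi> x0) (Z x0) / fact k) \<longlonglongrightarrow> h (\<phi> x)"
      using tendsto_uniform_limitI[OF lim xin] by (subst filterlim_sequentially_Suc)
    then have 1: "(\<lambda>N. taylor_sum ?c N g x0) \<longlonglongrightarrow> h (\<phi> x)"
      by (simp add: taylor_sum_def recentred_def lessThan_Suc_atMost)
    have "(\<lambda>N. A * (1/2) ^ N * norm (x - x0)) \<longlonglongrightarrow> A * 0 * norm (x - x0)"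
      by (intro tendsto_intros LIMSEQ_realpow_zero) auto
    then have "(\<lambda>N. taylor_sum ?c N g x - taylor_sum ?c N g x0) \<longlonglongrightarrow> 0"
      by (intro Lim_null_comparison[OF always_eventually[OF allI[OF close]]]) simp
    then have "(\<lambda>N. g (Z x) - taylor_sum ?c N g x0) \<longlonglongrightarrow> 0" by (simp add: taylor_sum_self)
    moreover have "(\<lambda>N. g (Z x) - taylor_sum ?c N g x0) \<longlonglongrightarrow> g (Z x) - h (\<phi> x)"
      by (intro tendsto_intros 1)
    ultimately show ?thesis using LIMSEQ_unique by fastforce
  qed
  have "\<phi> x \<in> ball (\<phi> x0) \<epsilon>" if "x \<in> ball x0 \<rho>" for x
    using in\<rho>(3)[OF that] \<epsilon> by (simp add: dist_commute)
  then show ?thesis using h eq \<epsilon> \<rho> in\<rho>(1) by (intro exI[of _ h] exI[of _ \<epsilon>] exI[of _ \<rho>]) auto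
qed

end

section \<open>Integrals over chart domains\<close>

lemma sum_Basis_cart: "(\<Sum>b\<in>(Basis :: (real^'n) set). f b) = (\<Sum>i\<in>UNIV. f (axis i 1))"
proof -
  have "inj (\<lambda>i. axis i 1 :: real^'n)" by (rule injI) (simp add: axis_eq_axis)
  moreover have "(Basis :: (real^'n) set) = range (\<lambda>i. axis i 1)" by (auto simp: Basis_vec_def)
  ultimately show ?thesis using sum.reindex[of "\<lambda>i. axis i 1 :: real^'n" UNIV f] by (simp add: o_def)
qed

lemma prod_Basis_cart: "(\<Prod>b\<in>(Basis :: (real^'n) set). f b) = (\<Prod>i\<in>UNIV. f (axis i 1))"
proof -
  have "inj (\<lambda>i. axis i 1 :: real^'n)" by (rule injI) (simp add: axis_eq_axis)
  moreover have "(Basis :: (real^'n) set) = range (\<lambda>i. axis i 1)" by (auto simp: Basis_vec_def)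
  ultimately show ?thesis using prod.reindex[of "\<lambda>i. axis i 1 :: real^'n" UNIV f] by (simp add: o_def)
qed

text \<open>The change of variables theorem of the library is restricted to well-ordered index types.
  The following copy of an arbitrary finite type carries such an order.\<close>

typedef 'a ordered_copy = "UNIV :: 'a set" by simp

instance ordered_copy :: (finite) finite
proof
  have "(UNIV :: 'a ordered_copy set) = range Abs_ordered_copy"
    by (metis Rep_ordered_copy_inverse surj_def)
  then show "finite (UNIV :: 'a ordered_copy set)" by (metis finite finite_imageI)
qed

definition enumeration :: "'a::finite \<Rightarrow> nat" where
  "enumeration = (SOME f. inj f)"

lemma inj_enumeration: "inj (enumeration :: 'a::finite \<Rightarrow> nat)"
proof -
  have "\<exists>f :: 'a \<Rightarrow> nat. inj f" using finite_imp_inj_to_nat_seg[of "UNIV :: 'a set"] by auto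
  then show ?thesis unfolding enumeration_def by (rule someI_ex)
qed

instantiation ordered_copy :: (finite) wellorder
begin

definition "x \<le> y \<longleftrightarrow> enumeration (Rep_ordered_copy x) \<le> enumeration (Rep_ordered_copy y)"
definition "x < y \<longleftrightarrow> enumeration (Rep_ordered_copy x) < enumeration (Rep_ordered_copy y)"

instance
proof
  fix x y :: "'a ordered_copy"
  show "x \<le> y \<Longrightarrow> y \<le> x \<Longrightarrow> x = y"
    unfolding less_eq_ordered_copy_def using inj_enumeration
    by (metis Rep_ordered_copy_inject injD order_antisym)
next
  fix P :: "'a ordered_copy \<Rightarrow> bool" and a
  assume step: "\<And>x. (\<And>y. y < x \<Longrightarrow> P y) \<Longrightarrow> P x"
  show "P a"
    by (induction a rule: measure_induct_rule[where f="\<lambda>x. enumeration (Rep_ordered_copy x)"])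
       (rule step, simp add: less_ordered_copy_def)
qed (auto simp: less_eq_ordered_copy_def less_ordered_copy_def)

end

definition to_ordered :: "real^'k::finite \<Rightarrow> real^('k ordered_copy)" where
  "to_ordered x = (\<chi> i. x $ Rep_ordered_copy i)"

definition of_ordered :: "real^('k::finite ordered_copy) \<Rightarrow> real^'k" where
  "of_ordered x = (\<chi> i. x $ Abs_ordered_copy i)"

lemma ordered_inverse [simp]: "of_ordered (to_ordered x) = x" "to_ordered (of_ordered y) = y"
  by (simp_all add: to_ordered_def of_ordered_def Abs_ordered_copy_inverse Rep_ordered_copy_inverse)

lemma bounded_linear_to_ordered: "bounded_linear to_ordered"
  by (simp add: linear_conv_bounded_linear[symmetric] linear_iff to_ordered_def vec_eq_iff)

lemma bounded_linear_of_ordered: "bounded_linear of_ordered"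
  by (simp add: linear_conv_bounded_linear[symmetric] linear_iff of_ordered_def vec_eq_iff)

lemma bij_Rep_ordered_copy: "bij Rep_ordered_copy"
  by (metis Abs_ordered_copy_inverse Rep_ordered_copy_inverse UNIV_I bijI')

text \<open>Conjugation by \<open>f\<close> is a sign-preserving bijection between the permutations
  of the two index types, so the Leibniz sums agree term by term.\<close>

lemma det_reindex:
  fixes A :: "'a::comm_ring_1^'n^'n" and f :: "'m::finite \<Rightarrow> 'n"
  assumes f: "bij f"
  shows "det (\<chi> i j. A $ f i $ f j) = det A"
proof -
  let ?m = "map_permutation UNIV f"
  have inj: "inj f" and surj: "surj f" using f by (auto simp: bij_def)
  have img: "?m ` {p. p permutes (UNIV :: 'm set)} = {p. p permutes (UNIV :: 'n set)}"
  proof (intro equalityI subsetI)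
    fix p assume "p \<in> ?m ` {p. p permutes (UNIV :: 'm set)}"
    then show "p \<in> {p. p permutes (UNIV :: 'n set)}" using map_permutation_permutes[OF f] by auto
  next
    fix p :: "'n \<Rightarrow> 'n" assume "p \<in> {p. p permutes (UNIV :: 'n set)}"
    then have p: "bij p" by (simp add: permutes_bij)
    define r where "r = inv f \<circ> p \<circ> f"
    have "bij r" unfolding r_def by (intro bij_comp f p bij_imp_bij_inv)
    then have r: "r permutes UNIV" using bij_imp_permutes[of r UNIV] by simp
    have "?m r y = p y" for y
    proof -
      obtain x where x: "y = f x" using surj by (metis surjD)
      show ?thesis unfolding x by (simp add: map_permutation_apply[OF inj] r_def surj_f_inv_f[OF surj])
    qed
    then have "p = ?m r" by auto
    then show "p \<in> ?m ` {p. p permutes (UNIV :: 'm set)}" using r by auto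
  qed
  have injm: "inj_on ?m {p. p permutes (UNIV :: 'm set)}"
  proof (rule inj_onI)
    fix p p' assume e: "?m p = ?m p'"
    have "f (p x) = f (p' x)" for x
      using fun_cong[OF e, of "f x"] by (simp add: map_permutation_apply[OF inj])
    then show "p = p'" using inj by (auto simp: inj_eq)
  qed
  have "det A = (\<Sum>p\<in>{p. p permutes (UNIV :: 'm set)}. of_int (sign (?m p)) * (\<Prod>i\<in>UNIV. A $ i $ ?m p i))"
    unfolding det_def img[symmetric] by (simp add: sum.reindex[OF injm])
  also have "\<dots> = (\<Sum>p\<in>{p. p permutes (UNIV :: 'm set)}. of_int (sign p) * (\<Prod>i\<in>UNIV. A $ f i $ f (p i)))"
  proof (rule sum.cong[OF refl])
    fix p assume "p \<in> {p. p permutes (UNIV :: 'm set)}"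
    then have s: "sign (?m p) = sign p" by (simp add: sign_map_permutation[OF inj])
    have "(\<Prod>i\<in>UNIV. A $ i $ ?m p i) = (\<Prod>i\<in>UNIV. A $ f i $ ?m p (f i))"
      using prod.reindex[OF inj, of "\<lambda>i. A $ i $ ?m p i"] surj by simp
    then show "of_int (sign (?m p)) * (\<Prod>i\<in>UNIV. A $ i $ ?m p i) = of_int (sign p) * (\<Prod>i\<in>UNIV. A $ f i $ f (p i))"
      by (simp add: s map_permutation_apply[OF inj])
  qed
  finally show ?thesis by (simp add: det_def)
qed

text \<open>A relabelling of coordinates takes boxes to boxes with the same side lengths, and the
  measure is determined by boxes.\<close>

lemma lborel_ordered: "distr lborel borel to_ordered = lborel"
proof (rule sym, rule lborel_eqI)
  have [measurable]: "to_ordered \<in> borel \<rightarrow>\<^sub>M borel"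
    by (intro borel_measurable_continuous_onI linear_continuous_on bounded_linear_to_ordered)
  fix l u :: "real^('k::finite ordered_copy)" assume "\<And>b. b \<in> Basis \<Longrightarrow> l \<bullet> b \<le> u \<bullet> b"
  then have le: "l $ i \<le> u $ i" for i using axis_in_Basis_iff[of i "1::real"] by (metis cart_eq_inner_axis axis_in_Basis_iff Basis_real_def insertI1)
  have "to_ordered -` box l u = box (of_ordered l) (of_ordered u)"
    by (auto simp: mem_box_cart to_ordered_def of_ordered_def)
       (metis Rep_ordered_copy_inverse Abs_ordered_copy_inverse UNIV_I)+
  then have "emeasure (distr lborel borel to_ordered) (box l u) = emeasure lborel (box (of_ordered l) (of_ordered u))"
    by (subst emeasure_distr) auto
  also have "\<dots> = (\<Prod>b\<in>Basis. (of_ordered u - of_ordered l) \<bullet> b)"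
    by (rule emeasure_lborel_box)
       (auto simp: Basis_vec_def cart_eq_inner_axis[symmetric] inner_axis of_ordered_def le)
  also have "(\<Prod>b\<in>Basis. (of_ordered u - of_ordered l) \<bullet> b) = (\<Prod>i\<in>UNIV. (u - l) $ Abs_ordered_copy i)"
    by (simp add: prod_Basis_cart inner_axis of_ordered_def)
  also have "\<dots> = (\<Prod>i\<in>UNIV. (u - l) $ i)"
  proof -
    have "bij (Abs_ordered_copy :: 'k \<Rightarrow> _)"
      by (metis Abs_ordered_copy_inverse Rep_ordered_copy_inverse UNIV_I bijI')
    then show ?thesis by (intro prod.reindex_bij_betw) simp
  qed
  also have "\<dots> = (\<Prod>b\<in>Basis. (u - l) \<bullet> b)" by (simp add: prod_Basis_cart inner_axis)
  finally show "emeasure (distr lborel borel to_ordered) (box l u) = ennreal (\<Prod>b\<in>Basis. (u - l) \<bullet> b)" .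
qed simp

lemma integral_change_of_variables_ordered:
  fixes \<tau> :: "real^'m::{finite,wellorder} \<Rightarrow> real^'m::_" and g :: "real^'m::_ \<Rightarrow> complex"
  assumes S: "open S" and d: "\<And>x. x \<in> S \<Longrightarrow> (\<tau> has_derivative \<tau>' x) (at x)" and inj: "inj_on \<tau> S"
    and g: "integrable lborel g" "\<And>y. y \<notin> \<tau> ` S \<Longrightarrow> g y = 0"
    and G: "G \<in> borel_measurable borel"
      "\<And>x. G x = (if x \<in> S then of_real \<bar>det (matrix (\<tau>' x))\<bar> * g (\<tau> x) else 0)"
  shows "integral\<^sup>L lborel g = integral\<^sup>L lborel G"
proof -
  \<comment> \<open>\<open>has_absolute_integral_change_of_variables\<close> speaks of functions
    with values in a space \<open>real^'n\<close>; \<open>T\<close> and its inverse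
    \<open>T'\<close> translate complex values into \<open>real^2\<close> and back.\<close>
  define T :: "complex \<Rightarrow> real^2" where "T = (\<lambda>c. \<chi> i. if i = 1 then Re c else Im c)"
  define T' :: "real^2 \<Rightarrow> complex" where "T' = (\<lambda>v. Complex (v $ 1) (v $ 2))"
  have TT: "T' (T c) = c" for c by (simp add: T_def T'_def)
  have T: "bounded_linear T"
    by (simp add: linear_conv_bounded_linear[symmetric] linear_iff T_def vec_eq_iff)
  have T': "bounded_linear T'"
    by (simp add: linear_conv_bounded_linear[symmetric] linear_iff T'_def complex_eq_iff)
  have gU: "g absolutely_integrable_on UNIV"
    unfolding set_integrable_def using g(1) integrable_completion[of g lborel] by simp
  then have "(T \<circ> g) absolutely_integrable_on UNIV" by (rule absolutely_integrable_linear[OF _ T])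
  moreover have "T \<circ> g = (\<lambda>y. if y \<in> \<tau> ` S then (T \<circ> g) y else 0)"
    using g(2) by (auto simp: T_def vec_eq_iff)
  ultimately have aS: "(T \<circ> g) absolutely_integrable_on (\<tau> ` S)"
    using absolutely_integrable_restrict_UNIV[of "\<tau> ` S" "T \<circ> g"] by simp
  have Sl: "S \<in> sets lebesgue" using S by auto
  have dw: "\<And>x. x \<in> S \<Longrightarrow> (\<tau> has_derivative \<tau>' x) (at x within S)"
    using d has_derivative_at_withinI by blast
  have cv: "(\<lambda>x. \<bar>det (matrix (\<tau>' x))\<bar> *\<^sub>R (T \<circ> g) (\<tau> x)) absolutely_integrable_on S"
    "integral S (\<lambda>x. \<bar>det (matrix (\<tau>' x))\<bar> *\<^sub>R (T \<circ> g) (\<tau> x)) = integral (\<tau> ` S) (T \<circ> g)"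
    using has_absolute_integral_change_of_variables[OF Sl dw inj, of "T \<circ> g" "integral (\<tau> ` S) (T \<circ> g)"] aS
    by auto
  have TG: "T \<circ> G = (\<lambda>x. if x \<in> S then \<bar>det (matrix (\<tau>' x))\<bar> *\<^sub>R (T \<circ> g) (\<tau> x) else 0)"
    by (auto simp: T_def vec_eq_iff G(2))
  have aG: "(T \<circ> G) absolutely_integrable_on UNIV"
    unfolding TG absolutely_integrable_restrict_UNIV by (rule cv(1))
  then have "(T' \<circ> (T \<circ> G)) absolutely_integrable_on UNIV" by (rule absolutely_integrable_linear[OF _ T'])
  moreover have "T' \<circ> (T \<circ> G) = G" by (auto simp: TT)
  ultimately have "G absolutely_integrable_on UNIV" by simp
  then have iG: "integrable lborel G"
    unfolding set_integrable_def using G(1) integrable_completion[of G lborel] by simp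
  have "integral UNIV (T \<circ> g) = integral (\<tau> ` S) (T \<circ> g)"
    using integral_restrict_UNIV[of "\<tau> ` S" "T \<circ> g"] \<open>T \<circ> g = _\<close> by simp
  also have "\<dots> = integral UNIV (T \<circ> G)"
    unfolding TG integral_restrict_UNIV cv(2) ..
  finally have "T (integral UNIV g) = T (integral UNIV G)"
    using integral_linear[OF _ T, of g UNIV] integral_linear[OF _ T, of G UNIV] g(1) iG
      has_integral_integral_lborel by (metis has_integral_integrable)
  then have "integral UNIV g = integral UNIV G" by (metis TT)
  then show ?thesis using integral_lborel[OF g(1)] integral_lborel[OF iG] by simp
qed

lemma integral_ordered:
  fixes h :: "real^('k::finite ordered_copy) \<Rightarrow> complex"
  assumes "h \<in> borel_measurable borel"
  shows "integral\<^sup>L lborel h = (LINT x|lborel. h (to_ordered x))"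
    and "integrable lborel h \<longleftrightarrow> integrable lborel (\<lambda>x. h (to_ordered x))"
proof -
  have m: "to_ordered \<in> lborel \<rightarrow>\<^sub>M borel"
    using borel_measurable_continuous_onI[OF linear_continuous_on[OF bounded_linear_to_ordered]]
    by (simp add: measurable_lborel1)
  show "integral\<^sup>L lborel h = (LINT x|lborel. h (to_ordered x))"
    using integral_distr[OF m assms] by (simp add: lborel_ordered)
  show "integrable lborel h \<longleftrightarrow> integrable lborel (\<lambda>x. h (to_ordered x))"
    using integrable_distr_eq[OF m assms] by (simp add: lborel_ordered)
qed

text \<open>Everything is carried to the ordered copy of the index type. The relabelling preserves
  \<open>lborel\<close> and conjugates the Jacobian matrix, which leaves its determinant
  unchanged.\<close>

lemma integral_change_of_variables_lborel:
  fixes \<tau> :: "real^'k \<Rightarrow> real^'k" and g :: "real^'k \<Rightarrow> complex"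
  assumes S: "open S" and d: "\<And>x. x \<in> S \<Longrightarrow> (\<tau> has_derivative \<tau>' x) (at x)" and inj: "inj_on \<tau> S"
    and g: "integrable lborel g" "\<And>y. y \<notin> \<tau> ` S \<Longrightarrow> g y = 0"
    and G: "G \<in> borel_measurable borel"
      "\<And>x. G x = (if x \<in> S then of_real \<bar>det (matrix (\<tau>' x))\<bar> * g (\<tau> x) else 0)"
  shows "integral\<^sup>L lborel g = integral\<^sup>L lborel G"
proof -
  let ?J = "to_ordered :: real^'k \<Rightarrow> _" and ?I = "of_ordered :: _ \<Rightarrow> real^'k"
  note J = bounded_linear_to_ordered and I = bounded_linear_of_ordered
  have mI: "?I \<in> borel \<rightarrow>\<^sub>M borel"
    by (rule borel_measurable_continuous_onI[OF linear_continuous_on[OF I]])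
  have gm: "g \<in> borel_measurable borel" using borel_measurable_integrable[OF g(1)] by simp
  have gI: "(\<lambda>y. g (?I y)) \<in> borel_measurable borel" by (rule measurable_compose[OF mI gm])
  have GI: "(\<lambda>y. G (?I y)) \<in> borel_measurable borel" by (rule measurable_compose[OF mI G(1)])
  have "integral\<^sup>L lborel (\<lambda>y. g (?I y)) = integral\<^sup>L lborel (\<lambda>y. G (?I y))"
  proof (rule integral_change_of_variables_ordered[where S="?I -` S" and \<tau>="\<lambda>y. ?J (\<tau> (?I y))"
        and \<tau>'="\<lambda>y v. ?J (\<tau>' (?I y) (?I v))"])
    show "open (?I -` S)"
      by (rule open_vimage[OF S linear_continuous_on[OF I]])
    show "((\<lambda>y. ?J (\<tau> (?I y))) has_derivative (\<lambda>v. ?J (\<tau>' (?I y) (?I v)))) (at y)" if "y \<in> ?I -` S" for y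
      using that by (intro bounded_linear.has_derivative[OF J]
          has_derivative_compose[OF bounded_linear_imp_has_derivative[OF I] d]) auto
    show "inj_on (\<lambda>y. ?J (\<tau> (?I y))) (?I -` S)"
      by (rule inj_onI) (metis inj inj_onD ordered_inverse vimageE)
    show "integrable lborel (\<lambda>y. g (?I y))" using integral_ordered(2)[OF gI] g(1) by simp
    show "g (?I y) = 0" if "y \<notin> (\<lambda>y. ?J (\<tau> (?I y))) ` (?I -` S)" for y
    proof (rule g(2), rule notI)
      assume "?I y \<in> \<tau> ` S"
      then obtain x where x: "x \<in> S" "?I y = \<tau> x" by blast
      have "y = ?J (?I y)" by simp
      also have "\<dots> = ?J (\<tau> (?I (?J x)))" unfolding x(2) by simp
      finally have "y = ?J (\<tau> (?I (?J x)))" "?J x \<in> ?I -` S" using x(1) by simp_all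
      then show False using that by blast
    qed
    show "G (?I y) = (if y \<in> ?I -` S then of_real \<bar>det (matrix (\<lambda>v. ?J (\<tau>' (?I y) (?I v))))\<bar>
         * g (?I (?J (\<tau> (?I y)))) else 0)" for y
    proof -
      have "matrix (\<lambda>v. ?J (\<tau>' (?I y) (?I v))) = (\<chi> i j. matrix (\<tau>' (?I y)) $ Rep_ordered_copy i $ Rep_ordered_copy j)"
      proof -
        have "?I (axis j 1) = axis (Rep_ordered_copy j) 1" for j
          by (auto simp: of_ordered_def axis_def vec_eq_iff Abs_ordered_copy_inverse Rep_ordered_copy_inverse)
        then show ?thesis by (simp add: matrix_def to_ordered_def)
      qed
      then have "det (matrix (\<lambda>v. ?J (\<tau>' (?I y) (?I v)))) = det (matrix (\<tau>' (?I y)))"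
        by (simp add: det_reindex[OF bij_Rep_ordered_copy])
      then show ?thesis by (simp add: G(2))
    qed
  qed (use GI in auto)
  then show ?thesis by (simp add: integral_ordered(1)[OF gI] integral_ordered(1)[OF GI])
qed

section \<open>Integration against compactly supported functions\<close>

text \<open>\<open>f\<close> is controlled on \<open>\<Omega>\<close> only. The product is
  continuous there and vanishes on \<open>- K\<close>, and these two open sets cover the
  space.\<close>

lemma continuous_compactly_supported:
  fixes f \<psi> :: "'a::euclidean_space \<Rightarrow> complex"
  assumes \<Omega>: "open \<Omega>" and f: "continuous_on \<Omega> f" and \<psi>: "continuous_on UNIV \<psi>"
    and K: "compact K" "K \<subseteq> \<Omega>" "\<And>x. x \<notin> K \<Longrightarrow> \<psi> x = 0"
  shows "continuous_on UNIV (\<lambda>x. f x * \<psi> x)" and "integrable lborel (\<lambda>x. f x * \<psi> x)"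
proof -
  have "continuous_on (\<Omega> \<union> - K) (\<lambda>x. f x * \<psi> x)"
  proof (rule continuous_on_open_Un)
    show "continuous_on \<Omega> (\<lambda>x. f x * \<psi> x)"
      by (intro continuous_intros f continuous_on_subset[OF \<psi>]) auto
    have "continuous_on (- K) (\<lambda>x. 0 :: complex)" by simp
    then show "continuous_on (- K) (\<lambda>x. f x * \<psi> x)"
      by (rule continuous_on_eq) (use K(3) in auto)
  qed (use \<Omega> K(1) compact_imp_closed in auto)
  moreover have "\<Omega> \<union> - K = UNIV" using K by auto
  ultimately show c: "continuous_on UNIV (\<lambda>x. f x * \<psi> x)" by simp
  have "integrable lborel (\<lambda>x. indicator K x *\<^sub>R (f x * \<psi> x))"
    by (rule borel_integrable_compact[OF K(1) continuous_on_subset[OF c]]) simp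
  moreover have "(\<lambda>x. indicator K x *\<^sub>R (f x * \<psi> x)) = (\<lambda>x. f x * \<psi> x)"
    using K(3) by (auto simp: indicator_def)
  ultimately show "integrable lborel (\<lambda>x. f x * \<psi> x)" by simp
qed

text \<open>By translation invariance every difference quotient of \<open>G\<close> in direction
  \<open>b\<close> has integral \<open>0\<close>; dominated convergence passes to the
  derivative.\<close>

lemma integral_ddir_zero:
  fixes G :: "'a::euclidean_space \<Rightarrow> complex"
  assumes d: "\<And>x. G differentiable (at x)" and c: "continuous_on UNIV (ddir G b)"
    and K: "compact K" "\<And>x. x \<notin> K \<Longrightarrow> G x = 0"
  shows "(LINT x|lborel. ddir G b x) = 0"
proof -
  define t where "t = (\<lambda>n. 1 / real (Suc n))"
  have t: "0 < t n" "t n \<le> 1" for n by (auto simp: t_def)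
  have t0: "t \<longlonglongrightarrow> 0" unfolding t_def using LIMSEQ_inverse_real_of_nat by (simp add: divide_inverse)
  define q where "q = (\<lambda>n x. (G (x + t n *\<^sub>R b) - G x) /\<^sub>R t n)"
  have cG: "continuous_on UNIV G"
    by (meson continuous_at_imp_continuous_on d differentiable_imp_continuous_within)
  have iG: "integrable lborel G"
    using continuous_compactly_supported(2)[OF open_UNIV continuous_on_const cG K(1) _ K(2), of 1] by simp
  have shift: "integrable lborel (\<lambda>x. G (x + v))" "(LINT x|lborel. G (x + v)) = integral\<^sup>L lborel G" for v
  proof -
    have m: "(+) v \<in> lborel \<rightarrow>\<^sub>M borel" by simp
    have Gm: "G \<in> borel_measurable borel" using iG borel_measurable_integrable by force
    show "integrable lborel (\<lambda>x. G (x + v))"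
      using integrable_distr_eq[OF m Gm] iG by (simp add: lborel_distr_plus add.commute)
    show "(LINT x|lborel. G (x + v)) = integral\<^sup>L lborel G"
      using integral_distr[OF m Gm] by (simp add: lborel_distr_plus add.commute)
  qed
  have int_q: "integral\<^sup>L lborel (q n) = 0" for n
    unfolding q_def using shift[of "t n *\<^sub>R b"] iG by simp
  have dK: "ddir G b x = 0" if "x \<notin> K" for x
    using ddir_cong[of "- K" x G "\<lambda>x. 0" b] K that open_Compl[OF compact_imp_closed[OF K(1)]] by simp
  have "compact (ddir G b ` K)" by (rule compact_continuous_image[OF continuous_on_subset[OF c] K(1)]) simp
  then obtain L where L: "\<And>y. y \<in> ddir G b ` K \<Longrightarrow> cmod y \<le> L" using compact_imp_bounded bounded_iff by metis
  define L' where "L' = max L 0"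
  have L': "cmod (ddir G b x) \<le> L'" for x
    using L[of "ddir G b x"] dK[of x] by (cases "x \<in> K") (auto simp: L'_def)
  obtain R where R: "\<And>x. x \<in> K \<Longrightarrow> norm x \<le> R" using K(1) compact_imp_bounded bounded_iff by metis
  \<comment> \<open>Since the step lengths \<open>t n\<close> are at most \<open>1\<close>, outside
    this ball neither \<open>x\<close> nor \<open>x + t n *\<^sub>R b\<close> lies in
    \<open>K\<close>.\<close>
  define B where "B = cball (0 :: 'a) (R + norm b)"
  have bound: "cmod (q n x) \<le> indicator B x *\<^sub>R L'" for n x
  proof (cases "x \<in> B")
    case True
    have "norm (G (x + t n *\<^sub>R b) - G (x + 0 *\<^sub>R b)) \<le> L' * norm (t n - 0)"
    proof (rule differentiable_bound[of "{0..t n}"])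
      fix s assume "s \<in> {0..t n}"
      have lin: "linear (\<lambda>v. ddir G v y)" for y using linear_frechet_derivative[OF d] by simp
      have "((\<lambda>s. G (x + s *\<^sub>R b)) has_derivative (\<lambda>v. ddir G (v *\<^sub>R b) (x + s *\<^sub>R b))) (at s within {0..t n})"
        by (rule has_derivative_compose[where g=G and f="\<lambda>s. x + s *\<^sub>R b", OF _ has_derivative_frechet[OF d]])
           (auto intro!: derivative_eq_intros)
      then show "((\<lambda>s. G (x + s *\<^sub>R b)) has_derivative (\<lambda>v. v *\<^sub>R ddir G b (x + s *\<^sub>R b))) (at s within {0..t n})"
        by (simp add: linear_cmul[OF lin])
      show "onorm (\<lambda>v. v *\<^sub>R ddir G b (x + s *\<^sub>R b)) \<le> L'"
        using mult_left_mono[OF L'[of "x + s *\<^sub>R b"], of "\<bar>v\<bar>" for v]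
        by (intro onorm_le) (simp add: mult.commute)
    qed (use t[of n] in auto)
    then show ?thesis using True t[of n] by (simp add: q_def divide_simps mult.commute)
  next
    case False
    have xR: "norm x > R + norm b" using False by (simp add: B_def)
    have "x \<notin> K" using R[of x] xR norm_ge_zero[of b] by linarith
    moreover have "x + t n *\<^sub>R b \<notin> K"
    proof
      assume "x + t n *\<^sub>R b \<in> K"
      then have "norm (x + t n *\<^sub>R b) \<le> R" by (rule R)
      moreover have "norm (t n *\<^sub>R b) \<le> norm b" using t[of n] mult_right_mono[of "t n" 1 "norm b"] by simp
      ultimately show False using xR norm_diff_ineq[of x "t n *\<^sub>R b"] by linarith
    qed
    ultimately show ?thesis using False K(2) by (simp add: q_def)
  qed
  have lim: "(\<lambda>n. q n x) \<longlonglongrightarrow> ddir G b x" for x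
  proof -
    have "((\<lambda>s. G (x + s *\<^sub>R b)) has_derivative (\<lambda>v. ddir G (v *\<^sub>R b) x)) (at 0)"
      by (rule has_derivative_compose[where g=G and f="\<lambda>s. x + s *\<^sub>R b"])
         (auto intro!: derivative_eq_intros has_derivative_frechet[OF d])
    moreover have "linear (\<lambda>v. ddir G v x)" using linear_frechet_derivative[OF d] by simp
    ultimately have "((\<lambda>s. G (x + s *\<^sub>R b)) has_vector_derivative ddir G b x) (at 0)"
      by (simp add: has_vector_derivative_def linear_cmul)
    then have "((\<lambda>s. cmod (G (x + s *\<^sub>R b) - G x - s *\<^sub>R ddir G b x) / norm s) \<longlongrightarrow> 0) (at 0)"
      by (simp add: has_vector_derivative_def has_derivative_at)
    moreover have "\<forall>\<^sub>F s in at 0. cmod (G (x + s *\<^sub>R b) - G x - s *\<^sub>R ddir G b x) / norm s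
        = cmod ((G (x + s *\<^sub>R b) - G x) /\<^sub>R s - ddir G b x)"
      unfolding eventually_at_filter
    proof (rule always_eventually, intro allI impI)
      fix s :: real assume "s \<noteq> 0"
      then have "(G (x + s *\<^sub>R b) - G x) /\<^sub>R s - ddir G b x = (G (x + s *\<^sub>R b) - G x - s *\<^sub>R ddir G b x) /\<^sub>R s"
        by (simp add: scaleR_diff_right)
      then show "cmod (G (x + s *\<^sub>R b) - G x - s *\<^sub>R ddir G b x) / norm s
          = cmod ((G (x + s *\<^sub>R b) - G x) /\<^sub>R s - ddir G b x)"
        by (simp add: divide_inverse mult.commute)
    qed
    ultimately have "((\<lambda>s. cmod ((G (x + s *\<^sub>R b) - G x) /\<^sub>R s - ddir G b x)) \<longlongrightarrow> 0) (at 0)"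
      by (rule Lim_transform_eventually)
    then have "((\<lambda>s. (G (x + s *\<^sub>R b) - G x) /\<^sub>R s) \<longlongrightarrow> ddir G b x) (at 0)"
      by (rule LIM_zero_cancel[OF tendsto_norm_zero_cancel])
    moreover have "filterlim t (at 0) sequentially"
    proof -
      have "t n \<noteq> 0" for n using t(1)[of n] by simp
      then show ?thesis by (simp add: filterlim_at t0)
    qed
    ultimately show ?thesis unfolding q_def by (rule filterlim_compose)
  qed
  have iB: "integrable lborel (\<lambda>x. indicator B x *\<^sub>R L')"
    by (rule borel_integrable_compact) (auto simp: B_def)
  have "(\<lambda>n. integral\<^sup>L lborel (q n)) \<longlonglongrightarrow> integral\<^sup>L lborel (ddir G b)"
  proof (rule integral_dominated_convergence[OF _ _ iB])
    show "ddir G b \<in> borel_measurable lborel" using borel_measurable_continuous_onI[OF c] by simp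
    show "q n \<in> borel_measurable lborel" for n
      unfolding q_def using shift(1) iG borel_measurable_integrable
      by (intro borel_measurable_scaleR borel_measurable_diff) auto
  qed (use lim bound in auto)
  then show ?thesis by (simp add: int_q LIMSEQ_const_iff)
qed

section \<open>Test functions separate continuous functions\<close>

text \<open>The classical flat function \<open>exp (- 1 / t)\<close> times \<open>1 / t ^ k\<close>,
  extended by \<open>0\<close>. The powers are included so that the span of the family is closed
  under differentiation.\<close>

definition flat_exp :: "nat \<Rightarrow> real \<Rightarrow> real" where
  "flat_exp k t = (if t > 0 then inverse t ^ k * exp (- inverse t) else 0)"

text \<open>The term of order \<open>k + 2\<close> in the exponential series of \<open>1 / t\<close>
  leaves a factor \<open>t\<^sup>2\<close> to spare. A quadratic bound forces the derivative at
  \<open>0\<close> to vanish.\<close>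

lemma flat_exp_bound: "\<bar>flat_exp k t\<bar> \<le> fact (k + 2) * t\<^sup>2"
proof (cases "t > 0")
  case True
  have "inverse t ^ (k + 2) \<le> fact (k + 2) * exp (inverse t)"
    by (rule power_le_fact_exp) (use True in simp)
  then have "inverse t ^ (k + 2) * exp (- inverse t) * t\<^sup>2 \<le> fact (k + 2) * exp (inverse t) * exp (- inverse t) * t\<^sup>2"
    by (intro mult_right_mono) auto
  moreover have "exp (inverse t) * exp (- inverse t) = 1" by (simp add: exp_minus)
  ultimately show ?thesis using True
    by (simp add: flat_exp_def power_add power2_eq_square field_simps exp_minus)
qed (simp add: flat_exp_def)

lemma has_derivative_flat_exp:
  "(flat_exp k has_derivative (\<lambda>v. v * (flat_exp (k + 2) t - of_nat k * flat_exp (k + 1) t))) (at t)"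
proof (cases t "0 :: real" rule: linorder_cases)
  case less
  have "((\<lambda>t. 0) has_derivative (\<lambda>v. v * (flat_exp (k + 2) t - of_nat k * flat_exp (k + 1) t))) (at t)"
    using less by (simp add: flat_exp_def)
  then show ?thesis
    by (rule has_derivative_transform_within_open[where s="{..<0}"]) (use less in \<open>auto simp: flat_exp_def\<close>)
next
  case equal
  have "(flat_exp k has_derivative (\<lambda>v. 0)) (at 0)"
    unfolding has_derivative_at_alt
  proof (intro conjI allI impI)
    fix e :: real assume e: "e > 0"
    have "\<bar>flat_exp k y\<bar> \<le> e * \<bar>y\<bar>" if y: "\<bar>y\<bar> < e / fact (k + 2)" for y
    proof -
      have "fact (k + 2) > (0 :: real)" by (rule fact_gt_zero)
      then have "fact (k + 2) * \<bar>y\<bar> \<le> e"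
        using y by (simp only: pos_less_divide_eq mult.commute less_imp_le)
      then have "fact (k + 2) * \<bar>y\<bar> * \<bar>y\<bar> \<le> e * \<bar>y\<bar>" by (rule mult_right_mono) simp
      then show ?thesis using flat_exp_bound[of k y] by (simp add: power2_eq_square mult.assoc)
    qed
    then show "\<exists>d>0. \<forall>y. norm (y - 0) < d \<longrightarrow> norm (flat_exp k y - flat_exp k 0 - 0) \<le> e * norm (y - 0)"
      using e by (intro exI[of _ "e / fact (k + 2)"]) (auto simp: flat_exp_def[of k 0])
  qed simp
  then show ?thesis using equal by (simp add: flat_exp_def)
next
  case greater
  have "((\<lambda>t. inverse t ^ k * exp (- inverse t)) has_real_derivative
      (flat_exp (k + 2) t - of_nat k * flat_exp (k + 1) t)) (at t)"
  proof -
    have p: "((\<lambda>t. inverse t ^ k) has_real_derivative of_nat k * (inverse t ^ (k - 1) * - (inverse t)\<^sup>2)) (at t)"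
      using greater by (auto intro!: derivative_eq_intros simp: power2_eq_square)
    have k: "of_nat k * (inverse t ^ (k - 1) * - (inverse t)\<^sup>2) = - of_nat k * inverse t ^ (k + 1)"
      by (cases k) (auto simp: power2_eq_square algebra_simps)
    have e: "((\<lambda>t. exp (- inverse t)) has_real_derivative exp (- inverse t) * (inverse t)\<^sup>2) (at t)"
      using greater by (auto intro!: derivative_eq_intros simp: power2_eq_square)
    show ?thesis
      by (rule DERIV_cong[OF DERIV_mult[OF p[unfolded k] e]])
         (use greater in \<open>simp add: flat_exp_def power_add power2_eq_square algebra_simps\<close>)
  qed
  then have "((\<lambda>t. inverse t ^ k * exp (- inverse t)) has_derivative
      (\<lambda>v. v * (flat_exp (k + 2) t - of_nat k * flat_exp (k + 1) t))) (at t)"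
    unfolding has_field_derivative_def by (rule has_derivative_eq_rhs) (simp add: mult.commute fun_eq_iff)
  then show ?thesis
    by (rule has_derivative_transform_within_open[where s="{0<..}"]) (use greater in \<open>auto simp: flat_exp_def\<close>)
qed

lemma smooth_on_flat_exp: "smooth_on UNIV (flat_exp k)"
proof -
  have "diff_times n UNIV (flat_exp k)" for n
  proof (induction n arbitrary: k)
    case 0
    then show ?case using has_derivative_flat_exp differentiable_def by (metis diff_times.simps(1))
  next
    case (Suc n)
    show ?case
    proof (rule diff_times_SucI[OF open_UNIV has_derivative_flat_exp])
      fix b :: real
      have "diff_times n UNIV (\<lambda>t. flat_exp (k + 2) t + (- of_nat k) * flat_exp (k + 1) t)"
        by (intro diff_times_add open_UNIV Suc.IH diff_times_bounded_linear[OF _ bounded_linear_mult_right])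
      from diff_times_bounded_linear[OF open_UNIV bounded_linear_mult_right this, of b]
      show "diff_times n UNIV (\<lambda>t. b * (flat_exp (k + 2) t - of_nat k * flat_exp (k + 1) t))" by simp
    qed
  qed
  then show ?thesis by (simp add: smooth_on_iff)
qed

text \<open>\<open>flat_exp 0\<close> is smooth across \<open>0\<close>, so its composite with the
  polynomial \<open>\<epsilon>\<^sup>2 - (dist x x1)\<^sup>2\<close> is smooth across the sphere of
  radius \<open>\<epsilon>\<close>.\<close>

lemma bump_test_fun:
  fixes x1 :: "real^'k"
  assumes "\<epsilon> > 0" "cball x1 \<epsilon> \<subseteq> \<Omega>"
  obtains \<beta> :: "real^'k \<Rightarrow> real" where "(\<lambda>x. complex_of_real (\<beta> x)) \<in> test_fun \<Omega>"
    "\<And>x. \<beta> x \<ge> 0" "\<And>x. \<beta> x > 0 \<longleftrightarrow> x \<in> ball x1 \<epsilon>" "continuous_on UNIV \<beta>"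
proof
  define \<beta> where "\<beta> = (\<lambda>x. flat_exp 0 (\<epsilon>\<^sup>2 - (x - x1) \<bullet> (x - x1)))"
  have s: "smooth_on UNIV \<beta>"
    unfolding \<beta>_def
    by (rule smooth_on_compose[OF open_UNIV subset_UNIV _ smooth_on_flat_exp])
       (intro smooth_on_diff smooth_on_bilinear[OF _ bounded_bilinear_inner] smooth_on_const smooth_on_ident open_UNIV)
  show pos: "\<beta> x > 0 \<longleftrightarrow> x \<in> ball x1 \<epsilon>" for x
  proof -
    have "(x - x1) \<bullet> (x - x1) = (dist x1 x)\<^sup>2"
      by (simp add: dist_norm power2_norm_eq_inner inner_diff_left inner_diff_right inner_commute)
    moreover have "(dist x1 x)\<^sup>2 < \<epsilon>\<^sup>2 \<longleftrightarrow> dist x1 x < \<epsilon>"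
      using assms(1) by (meson power_strict_mono power_less_imp_less_base zero_le_dist less_imp_le zero_less_numeral)
    ultimately have "(x - x1) \<bullet> (x - x1) < \<epsilon>\<^sup>2 \<longleftrightarrow> dist x1 x < \<epsilon>" by simp
    then show ?thesis by (simp add: \<beta>_def flat_exp_def)
  qed
  show nn: "\<beta> x \<ge> 0" for x by (simp add: \<beta>_def flat_exp_def)
  have "{x. complex_of_real (\<beta> x) \<noteq> 0} \<subseteq> cball x1 \<epsilon>"
    using pos nn by (metis (mono_tags, lifting) ball_subset_cball less_eq_real_def mem_Collect_eq of_real_0 subset_iff)
  then have sub: "closure {x. complex_of_real (\<beta> x) \<noteq> 0} \<subseteq> cball x1 \<epsilon>"
    by (rule closure_minimal) simp
  then have "compact (closure {x. complex_of_real (\<beta> x) \<noteq> 0})"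
    by (metis closed_closure compact_Int_closed compact_cball inf.absorb_iff2)
  moreover have "smooth_on UNIV (\<lambda>x. complex_of_real (\<beta> x))"
    by (rule smooth_on_bounded_linear_comp[OF open_UNIV bounded_linear_of_real s])
  ultimately show "(\<lambda>x. complex_of_real (\<beta> x)) \<in> test_fun \<Omega>"
    using sub assms(2) by (auto simp: test_fun_def)
  show "continuous_on UNIV \<beta>" by (rule smooth_on_continuous_on[OF s])
qed

lemma test_fun_continuous: "\<psi> \<in> test_fun \<Omega> \<Longrightarrow> continuous_on UNIV \<psi>"
  by (simp add: test_fun_def smooth_on_continuous_on)

lemma test_fun_outside: "\<psi> \<in> test_fun \<Omega> \<Longrightarrow> x \<notin> closure {x. \<psi> x \<noteq> 0} \<Longrightarrow> \<psi> x = 0"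
  using closure_subset[of "{x. \<psi> x \<noteq> 0}"] by auto

lemma test_fun_mono: "\<psi> \<in> test_fun \<Omega> \<Longrightarrow> \<Omega> \<subseteq> \<Omega>' \<Longrightarrow> \<psi> \<in> test_fun \<Omega>'"
  by (auto simp: test_fun_def)

lemma integrable_times_test_fun:
  assumes "open \<Omega>" "continuous_on \<Omega> f" "\<psi> \<in> test_fun \<Omega>"
  shows "integrable lborel (\<lambda>x. f x * \<psi> x)"
proof (rule continuous_compactly_supported(2)[OF assms(1,2) test_fun_continuous[OF assms(3)]])
  show "compact (closure {x. \<psi> x \<noteq> 0})" "closure {x. \<psi> x \<noteq> 0} \<subseteq> \<Omega>"
    using assms(3) by (auto simp: test_fun_def)
qed (rule test_fun_outside[OF assms(3)])

lemma test_functions_separate: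
  fixes f :: "real^'k \<Rightarrow> complex"
  assumes \<Omega>: "open \<Omega>" and f: "continuous_on \<Omega> f"
    and zero: "\<And>\<psi>. \<psi> \<in> test_fun \<Omega> \<Longrightarrow> (LINT x|lborel. f x * \<psi> x) = 0" and x1: "x1 \<in> \<Omega>"
  shows "f x1 = 0"
proof (rule ccontr)
  assume ne: "f x1 \<noteq> 0"
  \<comment> \<open>Near \<open>x1\<close> the values of \<open>f\<close> differ from
    \<open>f x1\<close> by at most \<open>\<eta>\<close>, so a bump of mass \<open>I > 0\<close>
    supported there yields \<open>cmod (f x1) * I \<le> \<eta> * I\<close>. Half of
    \<open>cmod (f x1)\<close> makes this a contradiction.\<close>
  define \<eta> where "\<eta> = cmod (f x1) / 2"
  have \<eta>: "\<eta> > 0" using ne by (simp add: \<eta>_def)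
  have "isCont f x1" using f \<Omega> x1 continuous_on_eq_continuous_at by blast
  then obtain d where d: "d > 0" "\<And>x. dist x x1 < d \<Longrightarrow> dist (f x) (f x1) < \<eta>"
    using \<eta> unfolding continuous_at_eps_delta by blast
  obtain e where e: "e > 0" "cball x1 e \<subseteq> \<Omega>" using \<Omega> x1 open_contains_cball by blast
  define \<epsilon> where "\<epsilon> = min e (d / 2)"
  have \<epsilon>: "\<epsilon> > 0" "cball x1 \<epsilon> \<subseteq> \<Omega>" using e d by (auto simp: \<epsilon>_def)
  obtain \<beta> where \<beta>: "(\<lambda>x. complex_of_real (\<beta> x)) \<in> test_fun \<Omega>"
    "\<And>x. \<beta> x \<ge> 0" "\<And>x. \<beta> x > 0 \<longleftrightarrow> x \<in> ball x1 \<epsilon>" "continuous_on UNIV \<beta>"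
    using bump_test_fun[OF \<epsilon>] by blast
  have i1: "integrable lborel (\<lambda>x. f x * complex_of_real (\<beta> x))" by (rule integrable_times_test_fun[OF \<Omega> f \<beta>(1)])
  have i2: "integrable lborel (\<lambda>x. f x1 * complex_of_real (\<beta> x))"
    by (rule integrable_times_test_fun[OF \<Omega> continuous_on_const \<beta>(1)])
  have "integrable lborel (\<lambda>x. 1 * complex_of_real (\<beta> x))"
    by (rule integrable_times_test_fun[OF \<Omega> continuous_on_const \<beta>(1)])
  then have i3: "integrable lborel \<beta>" by (simp add: complex_of_real_integrable_eq)
  define I where "I = integral\<^sup>L lborel \<beta>"
  have "cmod (f x1) * I = cmod (LINT x|lborel. f x1 * complex_of_real (\<beta> x))"
    using \<beta>(2) by (simp add: I_def norm_mult)
  also have "\<dots> = cmod (LINT x|lborel. f x1 * complex_of_real (\<beta> x) - f x * complex_of_real (\<beta> x))"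
    using zero[OF \<beta>(1)] by (simp add: Bochner_Integration.integral_diff[OF i2 i1])
  also have "\<dots> \<le> (LINT x|lborel. \<eta> * \<beta> x)"
  proof (rule Bochner_Integration.integral_norm_bound_integral)
    show "cmod (f x1 * complex_of_real (\<beta> x) - f x * complex_of_real (\<beta> x)) \<le> \<eta> * \<beta> x" for x
    proof (cases "x \<in> ball x1 \<epsilon>")
      case True
      then have "dist x x1 < d" using d(1) by (simp add: \<epsilon>_def dist_commute)
      then have "dist (f x) (f x1) < \<eta>" by (rule d(2))
      then have "cmod (f x1 - f x) \<le> \<eta>" unfolding dist_norm by (metis less_imp_le norm_minus_commute)
      then have "cmod ((f x1 - f x) * complex_of_real (\<beta> x)) \<le> \<eta> * \<beta> x"
        unfolding norm_mult using \<beta>(2)[of x] \<eta> by (auto intro!: mult_mono)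
      then show ?thesis by (simp add: algebra_simps)
    next
      case False
      then have "\<beta> x = 0" using \<beta>(2,3)[of x] by (meson order_antisym not_le)
      then show ?thesis by simp
    qed
  qed (use i1 i2 i3 in auto)
  also have "\<dots> = \<eta> * I" by (simp add: I_def)
  finally have "2 * \<eta> * I \<le> \<eta> * I" by (simp add: \<eta>_def)
  moreover have "I > 0"
  proof -
    have "I \<ge> 0" unfolding I_def using \<beta>(2) by simp
    moreover have "I \<noteq> 0"
    proof
      assume "I = 0"
      then have "AE x in lborel. \<beta> x = 0"
        unfolding I_def using integral_nonneg_eq_0_iff_AE[OF i3] \<beta>(2) by auto
      then have "AE x in lborel. x \<notin> ball x1 \<epsilon>" by eventually_elim (use \<beta>(3) in force)
      then have "ball x1 \<epsilon> \<in> null_sets lborel" using AE_iff_null_sets[of "ball x1 \<epsilon>" lborel] by simp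
      then show False
        using \<epsilon>(1) open_not_negligible[of "ball x1 \<epsilon>"] null_sets_completionI negligible_iff_null_sets
        by (metis ball_eq_empty not_le open_ball)
    qed
    ultimately show ?thesis by simp
  qed
  ultimately show False using \<eta> by simp
qed

section \<open>Charts and smooth functions on manifolds\<close>

lemma chart_onD:
  assumes "chart_on M (U, \<kappa>)"
  shows "openin (top_of_set M) U" "open (\<kappa> ` U)" "inj_on \<kappa> U" "continuous_on U \<kappa>"
    "continuous_on (\<kappa> ` U) (inv_into U \<kappa>)" "U \<subseteq> M"
proof -
  have h: "openin (top_of_set M) U" "open (\<kappa> ` U)" "homeomorphism U (\<kappa> ` U) \<kappa> (inv_into U \<kappa>)"
    using assms by (auto simp: chart_on_def)
  then show "openin (top_of_set M) U" "open (\<kappa> ` U)" "continuous_on U \<kappa>"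
    "continuous_on (\<kappa> ` U) (inv_into U \<kappa>)" by (auto simp: homeomorphism_def)
  show "inj_on \<kappa> U" using h(3) by (metis homeomorphism_def inj_on_inverseI)
  show "U \<subseteq> M" using h(1) openin_imp_subset by blast
qed

lemma chart_image_open:
  assumes c: "chart_on M (U, \<kappa>)" and V: "openin (top_of_set M) V"
  shows "open (\<kappa> ` (V \<inter> U))"
proof -
  have "homeomorphism U (\<kappa> ` U) \<kappa> (inv_into U \<kappa>)" using c by (simp add: chart_on_def)
  moreover have "openin (top_of_set U) (V \<inter> U)"
  proof -
    obtain T where "open T" "V = M \<inter> T" using V by (auto simp: openin_open)
    then show ?thesis using chart_onD(6)[OF c] by (auto simp: openin_open intro!: exI[of _ T])
  qed
  ultimately have "openin (top_of_set (\<kappa> ` U)) (\<kappa> ` (V \<inter> U))" by (rule homeomorphism_imp_open_map)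
  then show ?thesis using chart_onD(2)[OF c] openin_open_eq by blast
qed

lemma chart_preimage_open:
  assumes c: "chart_on M (U, \<kappa>)" and O: "open T"
  shows "openin (top_of_set M) (U \<inter> \<kappa> -` T)"
  using continuous_openin_preimage_gen[OF chart_onD(4)[OF c] O] chart_onD(1)[OF c] openin_trans by blast

lemma nbhd_Int: "nbhd M p U \<Longrightarrow> nbhd M p V \<Longrightarrow> nbhd M p (U \<inter> V)"
  by (auto simp: nbhd_def)

lemma nbhd_mem: "nbhd M p U \<Longrightarrow> p \<in> U"
  by (simp add: nbhd_def)

lemma nbhd_restrict: "nbhd X p V \<Longrightarrow> M \<subseteq> X \<Longrightarrow> p \<in> M \<Longrightarrow> nbhd M p (M \<inter> V)"
  by (auto simp: nbhd_def openin_open)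

lemma openin_restrict: "openin (top_of_set X) V \<Longrightarrow> M \<subseteq> X \<Longrightarrow> openin (top_of_set M) (M \<inter> V)"
  by (auto simp: openin_open)

lemma smooth_fun_chartD:
  "smooth_fun B U f \<Longrightarrow> (V, \<kappa>) \<in> B \<Longrightarrow> smooth_on (\<kappa> ` (U \<inter> V)) (\<lambda>x. f (inv_into V \<kappa> x))"
  by (auto simp: smooth_fun_def o_def)

lemma smooth_fun_subset: "smooth_fun B U f \<Longrightarrow> V \<subseteq> U \<Longrightarrow> smooth_fun B V f"
  unfolding smooth_fun_def by (fast intro: smooth_on_subset)

lemma smooth_near_if: "openin (top_of_set M) U \<Longrightarrow> smooth_fun B U f \<Longrightarrow> p \<in> U \<Longrightarrow> smooth_near M B p f"
  unfolding smooth_near_def nbhd_def by blast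

locale smooth_manifold =
  fixes M :: "'x::topological_space set" and B :: "('x, real^'k) chart set"
  assumes atlas: "smooth_atlas M B"
begin

lemma chart: "(U, \<kappa>) \<in> B \<Longrightarrow> chart_on M (U, \<kappa>)"
  using atlas unfolding smooth_atlas_def by blast

lemma chart_at: "p \<in> M \<Longrightarrow> \<exists>V \<kappa>. (V, \<kappa>) \<in> B \<and> p \<in> V"
  using atlas unfolding smooth_atlas_def by force

lemma transition: "(U, \<kappa>) \<in> B \<Longrightarrow> (V, \<eta>) \<in> B \<Longrightarrow> smooth_on (\<kappa> ` (U \<inter> V)) (\<lambda>x. \<eta> (inv_into U \<kappa> x))"
  using atlas unfolding smooth_atlas_def o_def by fast

text \<open>One chart suffices, because all others differ from it by smooth transition maps.\<close>

lemma smooth_fun_chartI: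
  assumes V: "(V, \<kappa>) \<in> B" and U: "openin (top_of_set M) U" "U \<subseteq> V"
    and f: "smooth_on (\<kappa> ` U) (\<lambda>x. f (inv_into V \<kappa> x))"
  shows "smooth_fun B U f"
  unfolding smooth_fun_def
proof safe
  fix V' \<eta> assume V': "(V', \<eta>) \<in> B"
  note inj = chart_onD(3)[OF chart[OF V]] and inj' = chart_onD(3)[OF chart[OF V']]
  have op: "open (\<eta> ` (U \<inter> V'))" by (rule chart_image_open[OF chart[OF V'] U(1)])
  have "smooth_on (\<eta> ` (U \<inter> V')) (\<lambda>x. f (inv_into V \<kappa> (\<kappa> (inv_into V' \<eta> x))))"
  proof (rule smooth_on_compose[OF op _ _ f])
    show "(\<lambda>x. \<kappa> (inv_into V' \<eta> x)) ` \<eta> ` (U \<inter> V') \<subseteq> \<kappa> ` U"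
      using inj' by (auto simp: inv_into_f_f)
    show "smooth_on (\<eta> ` (U \<inter> V')) (\<lambda>x. \<kappa> (inv_into V' \<eta> x))"
      by (rule smooth_on_subset[OF transition[OF V' V]]) (use U(2) in auto)
  qed
  then show "smooth_on (\<eta> ` (U \<inter> V')) (f \<circ> inv_into V' \<eta>)"
    by (rule smooth_on_cong[OF op, rotated]) (use inj inj' U(2) in \<open>auto simp: inv_into_f_f subset_iff\<close>)
qed

lemma smooth_fun_continuous_on:
  assumes U: "openin (top_of_set M) U" and f: "smooth_fun B U f"
  shows "continuous_on U f"
  unfolding continuous_on_topological
proof (intro ballI allI impI)
  fix p O' assume p: "p \<in> U" and O': "open O'" "f p \<in> O'"
  have "p \<in> M" using U p openin_imp_subset by blast
  then obtain V \<kappa> where V: "(V, \<kappa>) \<in> B" "p \<in> V" using chart_at by blast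
  note inj = chart_onD(3)[OF chart[OF V(1)]]
  have "continuous_on (U \<inter> V) (\<lambda>q. f (inv_into V \<kappa> (\<kappa> q)))"
    by (rule continuous_on_compose2[OF smooth_on_continuous_on[OF smooth_fun_chartD[OF f V(1)]]
          continuous_on_subset[OF chart_onD(4)[OF chart[OF V(1)]]]]) auto
  then have "continuous_on (U \<inter> V) f"
    by (rule continuous_on_eq) (use inj in \<open>auto simp: inv_into_f_f\<close>)
  then obtain T where T: "open T" "p \<in> T" "\<And>y. y \<in> U \<inter> V \<Longrightarrow> y \<in> T \<Longrightarrow> f y \<in> O'"
    unfolding continuous_on_topological using p V(2) O' by (metis IntI)
  obtain S where S: "open S" "V = M \<inter> S" using chart_onD(1)[OF chart[OF V(1)]] openin_open by metis
  have "U \<subseteq> M" using U openin_imp_subset by blast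
  then show "\<exists>A. open A \<and> p \<in> A \<and> (\<forall>y\<in>U. y \<in> A \<longrightarrow> f y \<in> O')"
    using T S V(2) by (intro exI[of _ "T \<inter> S"]) auto
qed

lemma smooth_fun_const: "smooth_fun B U (\<lambda>q. c)"
  by (auto simp: smooth_fun_def o_def)

lemma smooth_fun_add:
  assumes "openin (top_of_set M) U" "smooth_fun B U f" "smooth_fun B U g"
  shows "smooth_fun B U (\<lambda>q. f q + g q)"
  unfolding smooth_fun_def o_def
proof safe
  fix V \<kappa> assume V: "(V, \<kappa>) \<in> B"
  show "smooth_on (\<kappa> ` (U \<inter> V)) (\<lambda>x. f (inv_into V \<kappa> x) + g (inv_into V \<kappa> x))"
    by (rule smooth_on_add[OF chart_image_open[OF chart[OF V] assms(1)]
          smooth_fun_chartD[OF assms(2) V] smooth_fun_chartD[OF assms(3) V]])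
qed

lemma smooth_fun_mult:
  assumes "openin (top_of_set M) U" "smooth_fun B U f" "smooth_fun B U g"
  shows "smooth_fun B U (\<lambda>q. f q * g q)"
  unfolding smooth_fun_def o_def
proof safe
  fix V \<kappa> assume V: "(V, \<kappa>) \<in> B"
  show "smooth_on (\<kappa> ` (U \<inter> V)) (\<lambda>x. f (inv_into V \<kappa> x) * g (inv_into V \<kappa> x))"
    by (rule smooth_on_mult[OF chart_image_open[OF chart[OF V] assms(1)]
          smooth_fun_chartD[OF assms(2) V] smooth_fun_chartD[OF assms(3) V]])
qed

lemma smooth_near_const: "p \<in> M \<Longrightarrow> smooth_near M B p (\<lambda>q. c)"
  by (rule smooth_near_if[OF openin_subtopology_self smooth_fun_const])

lemma smooth_near_add: "smooth_near M B p f \<Longrightarrow> smooth_near M B p g \<Longrightarrow> smooth_near M B p (\<lambda>q. f q + g q)"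
proof -
  assume "smooth_near M B p f" "smooth_near M B p g"
  then obtain U V where "nbhd M p U" "smooth_fun B U f" "nbhd M p V" "smooth_fun B V g"
    unfolding smooth_near_def by blast
  then have "nbhd M p (U \<inter> V)" "smooth_fun B (U \<inter> V) (\<lambda>q. f q + g q)"
    by (auto intro!: nbhd_Int smooth_fun_add intro: smooth_fun_subset simp: nbhd_def)
  then show ?thesis unfolding smooth_near_def by blast
qed

lemma smooth_near_mult: "smooth_near M B p f \<Longrightarrow> smooth_near M B p g \<Longrightarrow> smooth_near M B p (\<lambda>q. f q * g q)"
proof -
  assume "smooth_near M B p f" "smooth_near M B p g"
  then obtain U V where "nbhd M p U" "smooth_fun B U f" "nbhd M p V" "smooth_fun B V g"
    unfolding smooth_near_def by blast
  then have "nbhd M p (U \<inter> V)" "smooth_fun B (U \<inter> V) (\<lambda>q. f q * g q)"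
    by (auto intro!: nbhd_Int smooth_fun_mult intro: smooth_fun_subset simp: nbhd_def)
  then show ?thesis unfolding smooth_near_def by blast
qed

lemma smooth_near_sum:
  "p \<in> M \<Longrightarrow> (\<And>i. i \<in> I \<Longrightarrow> smooth_near M B p (f i)) \<Longrightarrow> smooth_near M B p (\<lambda>q. \<Sum>i\<in>I. f i q)"
  by (induction I rule: infinite_finite_induct) (auto intro: smooth_near_add smooth_near_const)

definition coord :: "('x \<Rightarrow> real^'k) \<Rightarrow> 'k \<Rightarrow> 'x \<Rightarrow> complex" where
  "coord \<kappa> b = (\<lambda>q. of_real (\<kappa> q $ b))"

lemma smooth_fun_coord:
  assumes V: "(V, \<kappa>) \<in> B"
  shows "smooth_fun B V (coord \<kappa> b)"
proof (rule smooth_fun_chartI[OF V])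
  note c = chart[OF V]
  have "smooth_on (\<kappa> ` V) (\<lambda>x. complex_of_real (x $ b))"
    by (intro smooth_on_bounded_linear_comp[OF chart_onD(2)[OF c] bounded_linear_of_real]
        smooth_on_vec_nth chart_onD(2)[OF c] smooth_on_ident)
  then show "smooth_on (\<kappa> ` V) (\<lambda>x. coord \<kappa> b (inv_into V \<kappa> x))"
    by (rule smooth_on_cong[OF chart_onD(2)[OF c], rotated])
       (auto simp: coord_def inv_into_f_f[OF chart_onD(3)[OF c]])
qed (use chart_onD(1)[OF chart[OF V]] in auto)

lemma smooth_near_coord: "(V, \<kappa>) \<in> B \<Longrightarrow> q \<in> V \<Longrightarrow> smooth_near M B q (coord \<kappa> b)"
  using smooth_near_if[OF chart_onD(1)[OF chart] smooth_fun_coord] by blast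

subsection \<open>Tangent vectors as derivations\<close>

lemma ctangentD:
  assumes "v \<in> ctangent M B p"
  shows "smooth_near M B p f \<Longrightarrow> smooth_near M B p g \<Longrightarrow> v (\<lambda>x. f x + g x) = v f + v g"
    "smooth_near M B p f \<Longrightarrow> smooth_near M B p g \<Longrightarrow> v (\<lambda>x. f x * g x) = f p * v g + g p * v f"
    "smooth_near M B p f \<Longrightarrow> smooth_near M B p g \<Longrightarrow> nbhd M p U \<Longrightarrow> (\<And>x. x \<in> U \<Longrightarrow> f x = g x) \<Longrightarrow> v f = v g"
    "smooth_near M B p f \<Longrightarrow> v (\<lambda>x. c * f x) = c * v f"
    "\<not> smooth_near M B p f \<Longrightarrow> v f = 0"
  using assms unfolding ctangent_def by blast+

lemma ctangent_const:
  assumes v: "v \<in> ctangent M B p" and p: "p \<in> M"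
  shows "v (\<lambda>x. c) = 0"
proof -
  note s = smooth_near_const[OF p]
  have "v (\<lambda>x. 1 * 1) = 1 * v (\<lambda>x. 1) + 1 * v (\<lambda>x. 1)" by (rule ctangentD(2)[OF v s s])
  then have "v (\<lambda>x. 1) = 0" by simp
  then show ?thesis using ctangentD(4)[OF v s, of c 1] by simp
qed

lemma ctangent_sum:
  assumes v: "v \<in> ctangent M B p" and p: "p \<in> M" and f: "\<And>i. i \<in> I \<Longrightarrow> smooth_near M B p (f i)"
  shows "v (\<lambda>x. \<Sum>i\<in>I. f i x) = (\<Sum>i\<in>I. v (f i))"
  using f
proof (induction I rule: infinite_finite_induct)
  case (insert i I)
  have "v (\<lambda>x. f i x + (\<Sum>i\<in>I. f i x)) = v (f i) + v (\<lambda>x. \<Sum>i\<in>I. f i x)"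
    using insert.prems by (intro ctangentD(1)[OF v] smooth_near_sum p) auto
  then show ?case using insert by simp
qed (use ctangent_const[OF v p] in auto)

text \<open>Near \<open>p\<close>, Hadamard's lemma writes \<open>f\<close> as \<open>f p\<close>
  plus products of \<open>coord \<kappa> b - coord \<kappa> b p\<close> with smooth functions. The
  first factors vanish at \<open>p\<close>, so the Leibniz rule leaves only the values of the second
  factors at \<open>p\<close>, which are the partial derivatives.\<close>

lemma ctangent_expansion:
  assumes v: "v \<in> ctangent M B p" and V: "(V, \<kappa>) \<in> B" "p \<in> V" and f: "smooth_near M B p f"
  shows "v f = (\<Sum>b\<in>UNIV. v (coord \<kappa> b) * ddir (\<lambda>x. f (inv_into V \<kappa> x)) (axis b 1) (\<kappa> p))"
proof -
  note c = chart[OF V(1)]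
  note inj = chart_onD(3)[OF c]
  have p: "p \<in> M" using chart_onD(6)[OF c] V(2) by blast
  obtain U where U: "nbhd M p U" "smooth_fun B U f" using f unfolding smooth_near_def by blast
  have op: "open (\<kappa> ` (U \<inter> V))" using chart_image_open[OF c] U(1) by (simp add: nbhd_def)
  have "\<kappa> p \<in> \<kappa> ` (U \<inter> V)" using U(1) V(2) by (auto simp: nbhd_def)
  then obtain r where r: "r > 0" "ball (\<kappa> p) r \<subseteq> \<kappa> ` (U \<inter> V)" using op openE by blast
  define F where "F = (\<lambda>x. f (inv_into V \<kappa> x))"
  have F: "smooth_on (ball (\<kappa> p) r) F"
    unfolding F_def by (rule smooth_on_subset[OF smooth_fun_chartD[OF U(2) V(1)] r(2)])
  have pb: "\<kappa> p \<in> ball (\<kappa> p) r" using r(1) by simp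
  obtain g where g: "\<And>e. e \<in> Basis \<Longrightarrow> smooth_on (ball (\<kappa> p) r) (g e)"
    "\<And>x. x \<in> ball (\<kappa> p) r \<Longrightarrow> F x = F (\<kappa> p) + (\<Sum>e\<in>Basis. ((x - \<kappa> p) \<bullet> e) *\<^sub>R g e x)"
    "\<And>e. e \<in> Basis \<Longrightarrow> g e (\<kappa> p) = ddir F e (\<kappa> p)"
    by (rule Hadamard_lemma[OF open_ball convex_ball pb F]) (rule that)
  define N where "N = V \<inter> \<kappa> -` ball (\<kappa> p) r"
  have N: "openin (top_of_set M) N" "N \<subseteq> V" "p \<in> N"
    using chart_preimage_open[OF c open_ball] V(2) r(1) by (auto simp: N_def)
  have \<kappa>N: "\<kappa> ` N \<subseteq> ball (\<kappa> p) r" by (auto simp: N_def)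
  define h where "h = (\<lambda>b q. g (axis b 1) (\<kappa> q))"
  have sh: "smooth_near M B p (h b)" for b
  proof (rule smooth_near_if[OF N(1) smooth_fun_chartI[OF V(1) N(1,2)] N(3)])
    have opN: "open (\<kappa> ` N)" using chart_image_open[OF c N(1)] N(2) by (simp add: Int_absorb2)
    have "smooth_on (\<kappa> ` N) (g (axis b 1))" by (rule smooth_on_subset[OF g(1) \<kappa>N]) simp
    then show "smooth_on (\<kappa> ` N) (\<lambda>x. h b (inv_into V \<kappa> x))"
      by (rule smooth_on_cong[OF opN, rotated]) (use N(2) in \<open>auto simp: h_def inv_into_f_f[OF inj] subset_iff\<close>)
  qed
  note sk = smooth_near_coord[OF V] and sc = smooth_near_const[OF p]
  have skc: "smooth_near M B p (\<lambda>q. coord \<kappa> b q + - coord \<kappa> b p)" for b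
    by (rule smooth_near_add[OF sk sc])
  have v1: "v (\<lambda>q. coord \<kappa> b q + - coord \<kappa> b p) = v (coord \<kappa> b)" for b
    by (simp only: ctangentD(1)[OF v sk sc] ctangent_const[OF v p] add_0_right)
  have v2: "v (\<lambda>q. (coord \<kappa> b q + - coord \<kappa> b p) * h b q) = v (coord \<kappa> b) * h b p" for b
    using ctangentD(2)[OF v skc sh, of b b] unfolding v1 by simp
  have sm: "smooth_near M B p (\<lambda>q. \<Sum>b\<in>UNIV. (coord \<kappa> b q + - coord \<kappa> b p) * h b q)"
    by (intro smooth_near_sum p smooth_near_mult skc sh)
  have "v f = v (\<lambda>q. f p + (\<Sum>b\<in>UNIV. (coord \<kappa> b q + - coord \<kappa> b p) * h b q))"
  proof (rule ctangentD(3)[OF v f smooth_near_add[OF sc sm]])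
    show "nbhd M p N" using N by (simp add: nbhd_def)
    fix q assume q: "q \<in> N"
    have Fq: "F (\<kappa> q) = f q" if "q \<in> V" for q using that by (simp add: F_def inv_into_f_f[OF inj])
    have "f q = F (\<kappa> p) + (\<Sum>e\<in>Basis. ((\<kappa> q - \<kappa> p) \<bullet> e) *\<^sub>R g e (\<kappa> q))"
    proof -
      have qb: "\<kappa> q \<in> ball (\<kappa> p) r" and qV: "q \<in> V" using q by (auto simp: N_def)
      show ?thesis unfolding Fq[OF qV, symmetric] by (rule g(2)[OF qb])
    qed
    also have "\<dots> = f p + (\<Sum>b\<in>UNIV. (coord \<kappa> b q + - coord \<kappa> b p) * h b q)"
      by (simp add: Fq[OF V(2)] sum_Basis_cart inner_axis coord_def h_def scaleR_conv_of_real)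
    finally show "f q = f p + (\<Sum>b\<in>UNIV. (coord \<kappa> b q + - coord \<kappa> b p) * h b q)" .
  qed
  also have "\<dots> = v (\<lambda>q. \<Sum>b\<in>UNIV. (coord \<kappa> b q + - coord \<kappa> b p) * h b q)"
    unfolding ctangentD(1)[OF v sc sm] ctangent_const[OF v p] by (rule add_0_left)
  also have "\<dots> = (\<Sum>b\<in>UNIV. v (\<lambda>q. (coord \<kappa> b q + - coord \<kappa> b p) * h b q))"
    by (rule ctangent_sum[OF v p smooth_near_mult[OF skc sh]])
  also have "\<dots> = (\<Sum>b\<in>UNIV. v (coord \<kappa> b) * h b p)" unfolding v2 ..
  also have "\<dots> = (\<Sum>b\<in>UNIV. v (coord \<kappa> b) * ddir F (axis b 1) (\<kappa> p))"
    by (simp add: h_def g(3))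
  finally show ?thesis by (simp add: F_def)
qed

subsection \<open>Functions as distributions\<close>

lemma chart_smooth:
  assumes U: "openin (top_of_set M) U" and f: "smooth_fun B U f" and V: "(V, \<kappa>) \<in> B"
  shows "open (\<kappa> ` (U \<inter> V))" "smooth_on (\<kappa> ` (U \<inter> V)) (\<lambda>x. f (inv_into V \<kappa> x))"
    "continuous_on (\<kappa> ` (U \<inter> V)) (\<lambda>x. f (inv_into V \<kappa> x))"
  using chart_image_open[OF chart[OF V] U] smooth_fun_chartD[OF f V] smooth_on_continuous_on by blast+

lemma distribution_on_integral:
  fixes F :: "real^'k \<Rightarrow> complex"
  assumes \<Omega>: "open \<Omega>" and F: "continuous_on \<Omega> F"
  shows "distribution_on \<Omega> (\<lambda>\<psi>. LINT x|lborel. F x * \<psi> x)"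
  unfolding distribution_on_def
proof (intro conjI ballI allI impI)
  note i = integrable_times_test_fun[OF \<Omega> F]
  show "(LINT x|lborel. F x * (\<psi> x + \<eta> x)) = (LINT x|lborel. F x * \<psi> x) + (LINT x|lborel. F x * \<eta> x)"
    if "\<psi> \<in> test_fun \<Omega>" "\<eta> \<in> test_fun \<Omega>" for \<psi> \<eta>
    using i[OF that(1)] i[OF that(2)] by (simp add: distrib_left)
  show "(LINT x|lborel. F x * (c * \<psi> x)) = c * (LINT x|lborel. F x * \<psi> x)" for c \<psi>
    by (simp add: mult.left_commute)
  fix K assume K: "compact K \<and> K \<subseteq> \<Omega>"
  have iK: "integrable lborel (\<lambda>x. indicator K x *\<^sub>R F x)"
    by (rule borel_integrable_compact) (use K continuous_on_subset[OF F] in auto)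
  show "\<exists>C N. \<forall>\<psi>\<in>test_fun K. \<forall>b. (\<forall>bs\<in>lists Basis. length bs \<le> N \<longrightarrow> (\<forall>x. cmod (iter_deriv bs \<psi> x) \<le> b)) \<longrightarrow>
        cmod (LINT x|lborel. F x * \<psi> x) \<le> C * b"
  \<comment> \<open>The distribution has order \<open>0\<close>: the witnesses will be
    \<open>N = 0\<close> and, for \<open>C\<close>, the integral of \<open>cmod (F x)\<close> over
    \<open>K\<close>.\<close>
  proof (intro exI ballI allI impI)
    fix \<psi> b assume \<psi>: "\<psi> \<in> test_fun K"
      and b: "\<forall>bs\<in>lists Basis. length bs \<le> 0 \<longrightarrow> (\<forall>x. cmod (iter_deriv bs \<psi> x) \<le> b)"
    have b': "cmod (\<psi> x) \<le> b" for x using b[rule_format, of "[]" x] by simp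
    have \<psi>0: "\<psi> x = 0" if "x \<notin> K" for x
      using \<psi> that test_fun_outside[OF \<psi>] unfolding test_fun_def by blast
    have "cmod (LINT x|lborel. F x * \<psi> x) \<le> (LINT x|lborel. cmod (indicator K x *\<^sub>R F x) * b)"
    proof (rule Bochner_Integration.integral_norm_bound_integral)
      show "integrable lborel (\<lambda>x. F x * \<psi> x)" using i test_fun_mono[OF \<psi>] K by blast
      show "integrable lborel (\<lambda>x. cmod (indicator K x *\<^sub>R F x) * b)"
        by (rule integrable_mult_left) (rule integrable_norm[OF iK])
      show "cmod (F x * \<psi> x) \<le> cmod (indicator K x *\<^sub>R F x) * b" for x
        using b'[of x] \<psi>0[of x] by (cases "x \<in> K") (auto simp: norm_mult mult_left_mono)
    qed
    then show "cmod (LINT x|lborel. F x * \<psi> x) \<le> (LINT x|lborel. cmod (indicator K x *\<^sub>R F x)) * b"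
      by simp
  qed
qed

text \<open>Compatibility between charts is the change of variables formula;
  \<open>transport_test\<close> carries the Jacobian factor.\<close>

lemma mdistribution_of_fun:
  assumes U: "openin (top_of_set M) U" and f: "smooth_fun B U f"
  shows "mdistribution B U (mdistr_of_fun f)"
  unfolding mdistribution_def
proof (intro conjI)
  show "\<forall>(V, \<kappa>)\<in>B. distribution_on (\<kappa> ` (U \<inter> V)) (mdistr_of_fun f (V, \<kappa>))"
    using chart_smooth[OF U f] by (auto simp: mdistr_of_fun_def intro!: distribution_on_integral)
  show "\<forall>(V, \<kappa>)\<in>B. \<forall>(V', \<kappa>')\<in>B. \<forall>\<psi>\<in>test_fun (\<kappa>' ` (U \<inter> V \<inter> V')).
      mdistr_of_fun f (V', \<kappa>') \<psi> = mdistr_of_fun f (V, \<kappa>) (transport_test U (V, \<kappa>) (V', \<kappa>') \<psi>)"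
  proof safe
    fix V \<kappa> V' \<kappa>' \<psi> assume V: "(V, \<kappa>) \<in> B" and V': "(V', \<kappa>') \<in> B"
      and \<psi>: "\<psi> \<in> test_fun (\<kappa>' ` (U \<inter> V \<inter> V'))"
    note inj = chart_onD(3)[OF chart[OF V]] and inj' = chart_onD(3)[OF chart[OF V']]
    define S where "S = \<kappa> ` (U \<inter> V \<inter> V')"
    define \<tau> where "\<tau> = \<kappa>' \<circ> inv_into V \<kappa>"
    have UV: "openin (top_of_set M) (U \<inter> V')" "openin (top_of_set M) (U \<inter> V)"
      using U chart_onD(1)[OF chart[OF V]] chart_onD(1)[OF chart[OF V']] by auto
    have S: "open S"
      using chart_image_open[OF chart[OF V] UV(1)] by (simp add: S_def Int_ac)
    have S': "open (\<kappa>' ` (U \<inter> V \<inter> V'))" by (rule chart_image_open[OF chart[OF V'] UV(2)])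
    have \<tau>: "smooth_on S \<tau>"
      using smooth_on_subset[OF transition[OF V V'], of S] by (auto simp: S_def \<tau>_def o_def)
    have \<tau>v: "\<tau> (\<kappa> q) = \<kappa>' q" if "q \<in> V" for q using that by (simp add: \<tau>_def inv_into_f_f[OF inj])
    have \<tau>S: "\<tau> ` S = \<kappa>' ` (U \<inter> V \<inter> V')"
      by (force simp: S_def \<tau>v image_iff)
    have inv': "inv_into V' \<kappa>' (\<tau> x) = inv_into V \<kappa> x" if "x \<in> S" for x
      using that by (auto simp: S_def \<tau>v inv_into_f_f[OF inj] inv_into_f_f[OF inj'])
    have fS: "continuous_on S (\<lambda>x. f (inv_into V \<kappa> x))"
      by (rule continuous_on_subset[OF chart_smooth(3)[OF U f V]]) (auto simp: S_def)
    have fS': "continuous_on (\<kappa>' ` (U \<inter> V \<inter> V')) (\<lambda>x. f (inv_into V' \<kappa>' x))"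
      by (rule continuous_on_subset[OF chart_smooth(3)[OF U f V']]) auto
    let ?G = "\<lambda>x. f (inv_into V \<kappa> x) * transport_test U (V, \<kappa>) (V', \<kappa>') \<psi> x"
    have G: "?G x = (if x \<in> S then of_real \<bar>det (matrix (\<lambda>v. ddir \<tau> v x))\<bar> *
        (f (inv_into V' \<kappa>' (\<tau> x)) * \<psi> (\<tau> x)) else 0)" for x
      by (simp add: transport_test_def S_def[symmetric] \<tau>_def[symmetric] Let_def inv')
    have det: "continuous_on S (\<lambda>x. det (matrix (\<lambda>v. ddir \<tau> v x)))"
    proof -
      have "smooth_on S (\<lambda>x. det (\<chi> i j. ddir \<tau> (axis j 1) x $ i))"
        by (rule smooth_on_det[OF S]) (simp add: smooth_on_vec_nth[OF S] smooth_on_ddir[OF \<tau>])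
      then show ?thesis by (simp add: matrix_def smooth_on_continuous_on)
    qed
    have "continuous_on S (\<lambda>x. of_real \<bar>det (matrix (\<lambda>v. ddir \<tau> v x))\<bar> * (f (inv_into V \<kappa> x) * \<psi> (\<tau> x)))"
      by (intro continuous_intros det fS continuous_on_compose2[OF test_fun_continuous[OF \<psi>] smooth_on_continuous_on[OF \<tau>]]) auto
    from borel_measurable_continuous_on_indicator[OF _ this]
    have "(\<lambda>x. indicator S x *\<^sub>R (of_real \<bar>det (matrix (\<lambda>v. ddir \<tau> v x))\<bar> *
        (f (inv_into V \<kappa> x) * \<psi> (\<tau> x)))) \<in> borel_measurable borel" using S by simp
    moreover have "?G = (\<lambda>x. indicator S x *\<^sub>R (of_real \<bar>det (matrix (\<lambda>v. ddir \<tau> v x))\<bar> *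
        (f (inv_into V \<kappa> x) * \<psi> (\<tau> x))))"
    proof
      fix x show "?G x = indicator S x *\<^sub>R (of_real \<bar>det (matrix (\<lambda>v. ddir \<tau> v x))\<bar> *
        (f (inv_into V \<kappa> x) * \<psi> (\<tau> x)))"
        unfolding G by (cases "x \<in> S") (simp_all add: inv')
    qed
    ultimately have Gm: "?G \<in> borel_measurable borel" by simp
    have "(LINT x|lborel. f (inv_into V' \<kappa>' x) * \<psi> x) = integral\<^sup>L lborel ?G"
    proof (rule integral_change_of_variables_lborel[OF S, of \<tau> "\<lambda>x v. ddir \<tau> v x", OF _ _ _ _ Gm])
      show "(\<tau> has_derivative (\<lambda>v. ddir \<tau> v x)) (at x)" if "x \<in> S" for x
        by (rule has_derivative_frechet[OF smooth_on_differentiable[OF \<tau> that]])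
      show "inj_on \<tau> S"
        using inj inj' by (auto simp: inj_on_def S_def \<tau>v)
      show "integrable lborel (\<lambda>x. f (inv_into V' \<kappa>' x) * \<psi> x)"
        by (rule integrable_times_test_fun[OF S' fS' \<psi>])
      show "f (inv_into V' \<kappa>' y) * \<psi> y = 0" if "y \<notin> \<tau> ` S" for y
        using that test_fun_outside[OF \<psi>, of y] \<psi> unfolding \<tau>S test_fun_def by auto
    qed (rule G)
    then show "mdistr_of_fun f (V', \<kappa>') \<psi> = mdistr_of_fun f (V, \<kappa>) (transport_test U (V, \<kappa>) (V', \<kappa>') \<psi>)"
      by (simp add: mdistr_of_fun_def)
  qed
qed

text \<open>Integration by parts in a chart. Because \<open>Z q f = 0\<close>, the product of
  \<open>F\<close> with the adjoint expression equals the sum of the partial derivatives of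
  \<open>F * (a j * \<psi>)\<close>, a divergence with compact support, whose integral is
  \<open>0\<close>.\<close>

lemma weakly_annihilates_of_fun:
  assumes U: "openin (top_of_set M) U" and f: "smooth_fun B U f" and Z: "vector_field M B U Z"
    and Zf: "\<And>q. q \<in> U \<Longrightarrow> Z q f = 0"
  shows "weakly_annihilates B U Z (mdistr_of_fun f)"
  unfolding weakly_annihilates_def
proof safe
  fix V \<kappa> \<psi> assume V: "(V, \<kappa>) \<in> B" and \<psi>: "\<psi> \<in> test_fun (\<kappa> ` (U \<inter> V))"
  note inj = chart_onD(3)[OF chart[OF V]]
  define \<Omega> where "\<Omega> = \<kappa> ` (U \<inter> V)"
  define F where "F = (\<lambda>x. f (inv_into V \<kappa> x))"
  define a where "a = (\<lambda>j y. Z (inv_into V \<kappa> y) (\<lambda>q. of_real (\<kappa> q $ j)))"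
  define K where "K = closure {x. \<psi> x \<noteq> 0}"
  have \<Omega>: "open \<Omega>" and F: "smooth_on \<Omega> F"
    using chart_smooth[OF U f V] by (auto simp: \<Omega>_def F_def)
  have UV: "openin (top_of_set M) (U \<inter> V)" using U chart_onD(1)[OF chart[OF V]] by auto
  have a: "smooth_on \<Omega> (a j)" for j
  proof -
    have "smooth_fun B (U \<inter> V) (coord \<kappa> j)" by (rule smooth_fun_subset[OF smooth_fun_coord[OF V]]) simp
    then have "smooth_fun B (U \<inter> V) (\<lambda>q. Z q (coord \<kappa> j))"
      using Z UV unfolding vector_field_def by blast
    from smooth_fun_chartD[OF this V] show ?thesis
      by (simp add: a_def \<Omega>_def coord_def Int_assoc)
  qed
  have \<psi>s: "smooth_on UNIV \<psi>" and K12: "compact K" "K \<subseteq> \<Omega>"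
    using \<psi> by (auto simp: test_fun_def K_def \<Omega>_def)
  have K3: "\<psi> x = 0" if "x \<notin> K" for x
    using test_fun_outside[OF \<psi>] that unfolding K_def .
  note K = K12 K3
  have oK: "open (- K)" by (rule open_Compl[OF compact_imp_closed[OF K(1)]])
  have a\<psi>: "smooth_on \<Omega> (\<lambda>y. a j y * \<psi> y)" for j
    by (rule smooth_on_mult[OF \<Omega> a smooth_on_subset[OF \<psi>s]]) simp
  define G where "G = (\<lambda>j y. F y * (a j y * \<psi> y))"
  \<comment> \<open>Smoothness of \<open>F\<close> and \<open>a j\<close> is known on
    \<open>\<Omega>\<close> only, but off the support of \<open>\<psi>\<close> the product is
    identically \<open>0\<close>.\<close>
  have Gs: "smooth_on UNIV (G j)" for j
  proof (rule smooth_on_local)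
    fix x
    have "smooth_on \<Omega> (G j)" unfolding G_def by (rule smooth_on_mult[OF \<Omega> F a\<psi>])
    moreover have "smooth_on (- K) (G j)"
      by (rule smooth_on_cong[OF oK _ smooth_on_const[of _ 0]]) (auto simp: G_def K(3))
    ultimately show "\<exists>T. x \<in> T \<and> smooth_on T (G j)" using K(2) by blast
  qed
  have zero_off: "ddir g b x = 0" if "x \<notin> K" "\<And>y. y \<notin> K \<Longrightarrow> g y = 0" for g :: "real^'k \<Rightarrow> complex" and b x
    using ddir_cong[OF oK, of x g "\<lambda>y. 0" b] that by simp
  have eq: "F x * (\<Sum>j\<in>UNIV. ddir (\<lambda>y. a j y * \<psi> y) (axis j 1) x) = (\<Sum>j\<in>UNIV. ddir (G j) (axis j 1) x)" for x
  proof (cases "x \<in> K")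
    case True
    then have x: "x \<in> \<Omega>" using K(2) by blast
    then obtain q where q: "q \<in> U" "q \<in> V" "x = \<kappa> q" by (auto simp: \<Omega>_def)
    have "Z q \<in> ctangent M B q" using Z q(1) by (auto simp: vector_field_def)
    from ctangent_expansion[OF this V q(2) smooth_near_if[OF U f q(1)]]
    have Z0: "(\<Sum>j\<in>UNIV. a j x * ddir F (axis j 1) x) = 0"
      by (simp add: Zf[OF q(1)] a_def q inv_into_f_f[OF inj] F_def coord_def)
    have "ddir (G j) v x = F x * ddir (\<lambda>y. a j y * \<psi> y) v x + ddir F v x * (a j x * \<psi> x)" for j v
      unfolding G_def
      by (rule ddir_eq, intro has_derivative_mult has_derivative_frechet
          smooth_on_differentiable[OF F x] smooth_on_differentiable[OF a\<psi> x])
    then have "(\<Sum>j\<in>UNIV. ddir (G j) (axis j 1) x) = F x * (\<Sum>j\<in>UNIV. ddir (\<lambda>y. a j y * \<psi> y) (axis j 1) x)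
        + (\<Sum>j\<in>UNIV. a j x * ddir F (axis j 1) x) * \<psi> x"
      by (simp add: sum.distrib sum_distrib_left sum_distrib_right mult_ac)
    then show ?thesis using Z0 by simp
  next
    case False
    then show ?thesis using zero_off[OF False] by (simp add: G_def K(3))
  qed
  have int: "integrable lborel (ddir (G j) (axis j 1))" for j
    using continuous_compactly_supported(2)[OF open_UNIV continuous_on_const
        smooth_on_continuous_on[OF smooth_on_ddir[OF Gs]] K(1), of "axis j 1" j 1]
      zero_off by (simp add: G_def K(3))
  have "(LINT x|lborel. ddir (G j) (axis j 1) x) = 0" for j
    by (rule integral_ddir_zero[OF smooth_on_differentiable[OF Gs UNIV_I]
          smooth_on_continuous_on[OF smooth_on_ddir[OF Gs]] K(1)])
       (auto simp: G_def K(3))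
  then have "(LINT x|lborel. F x * (\<Sum>j\<in>UNIV. ddir (\<lambda>y. a j y * \<psi> y) (axis j 1) x)) = 0"
    by (simp add: eq Bochner_Integration.integral_sum[OF int])
  then show "mdistr_of_fun f (V, \<kappa>) (\<lambda>x. \<Sum>j\<in>UNIV. frechet_derivative
           (\<lambda>y. Z (inv_into V \<kappa> y) (\<lambda>q. of_real (\<kappa> q $ j)) * \<psi> y) (at x) (axis j 1)) = 0"
    by (simp add: mdistr_of_fun_def F_def a_def)
qed

text \<open>In the distributional case the test functions are supported over \<open>W\<close>, so
  the integrals see no values outside it.\<close>

lemma sec_agree_of_fun:
  assumes "\<And>q. q \<in> W \<Longrightarrow> f q = g q"
  shows "sec_agree B W (sec_of_fun a f) (sec_of_fun a g)"
proof (cases a)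
  case Distributional
  have "mdistr_of_fun f (V, \<kappa>) \<psi> = mdistr_of_fun g (V, \<kappa>) \<psi>"
    if V: "(V, \<kappa>) \<in> B" and \<psi>: "\<psi> \<in> test_fun (\<kappa> ` (W \<inter> V))" for V \<kappa> \<psi>
  proof -
    have eq: "f (inv_into V \<kappa> x) * \<psi> x = g (inv_into V \<kappa> x) * \<psi> x" for x
    proof (cases "x \<in> \<kappa> ` (W \<inter> V)")
      case True
      then show ?thesis using assms inv_into_f_f[OF chart_onD(3)[OF chart[OF V]]] by auto
    next
      case False
      then have "\<psi> x = 0" using \<psi> test_fun_outside[OF \<psi>] unfolding test_fun_def by blast
      then show ?thesis by simp
    qed
    show ?thesis unfolding mdistr_of_fun_def prod.case eq ..
  qed
  then show ?thesis using Distributional by auto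
qed (use assms in \<open>auto simp: fun_agree_def\<close>)

text \<open>Only the distributional case has content: the functions have the same integrals against
  all test functions, and these separate continuous functions. Hence germs coming from smooth
  functions can be compared pointwise for every \<open>a\<close>.\<close>

lemma sec_agree_of_funD:
  assumes W: "openin (top_of_set M) W" and f: "smooth_fun B W f" and g: "smooth_fun B W g"
    and ag: "sec_agree B W (sec_of_fun a f) (sec_of_fun a g)" and q: "q \<in> W"
  shows "f q = g q"
proof (cases a)
  case Distributional
  have "q \<in> M" using W q openin_imp_subset by blast
  then obtain V \<kappa> where V: "(V, \<kappa>) \<in> B" "q \<in> V" using chart_at by blast
  note cf = chart_smooth[OF W f V(1)] and cg = chart_smooth[OF W g V(1)]
  have "f (inv_into V \<kappa> (\<kappa> q)) - g (inv_into V \<kappa> (\<kappa> q)) = 0"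
  proof (rule test_functions_separate[OF cf(1), where f="\<lambda>x. f (inv_into V \<kappa> x) - g (inv_into V \<kappa> x)"])
    show "continuous_on (\<kappa> ` (W \<inter> V)) (\<lambda>x. f (inv_into V \<kappa> x) - g (inv_into V \<kappa> x))"
      by (intro continuous_intros cf cg)
    show "\<kappa> q \<in> \<kappa> ` (W \<inter> V)" using q V(2) by blast
    fix \<psi> assume \<psi>: "\<psi> \<in> test_fun (\<kappa> ` (W \<inter> V))"
    have "(LINT x|lborel. f (inv_into V \<kappa> x) * \<psi> x) = (LINT x|lborel. g (inv_into V \<kappa> x) * \<psi> x)"
      using ag Distributional V(1) \<psi> by (auto simp: mdistr_of_fun_def)
    then show "(LINT x|lborel. (f (inv_into V \<kappa> x) - g (inv_into V \<kappa> x)) * \<psi> x) = 0"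
      using integrable_times_test_fun[OF cf(1,3) \<psi>] integrable_times_test_fun[OF cg(1,3) \<psi>]
      by (simp add: left_diff_distrib)
  qed
  then show ?thesis using inv_into_f_f[OF chart_onD(3)[OF chart[OF V(1)]] V(2)] by simp
qed (use ag q in \<open>auto simp: fun_agree_def\<close>)

end

section \<open>Local coordinates on a CR submanifold\<close>

text \<open>By dimension the whole space is the sum of the span of the \<open>t i\<close>, which
  lies in the kernel of \<open>P\<close>, and the range of the right inverse \<open>R\<close>. With
  the coefficients \<open>c\<close> taken from the product of \<open>l\<close> and \<open>R\<close>,
  the form \<open>l\<close> minus the combination of rows vanishes on both summands.\<close>

lemma covector_in_row_span:
  fixes P :: "complex^'k^'n" and R :: "complex^'n^'k" and t :: "nat \<Rightarrow> complex^'k" and l :: "complex^'k"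
  assumes PR: "P ** R = mat 1" and card: "CARD('k) = CARD('n) + m"
    and indep: "\<And>c. (\<Sum>i<m. c i *s t i) = 0 \<Longrightarrow> \<forall>i<m. c i = 0"
    and Pt: "\<And>i. i < m \<Longrightarrow> P *v t i = 0"
    and lt: "\<And>i. i < m \<Longrightarrow> (\<Sum>b\<in>UNIV. l $ b * t i $ b) = 0"
  shows "\<exists>c. \<forall>b. l $ b = (\<Sum>j\<in>UNIV. c j * P $ j $ b)"
proof -
  define c where "c = (\<lambda>j. \<Sum>b\<in>UNIV. l $ b * R $ b $ j)"
  define \<eta> where "\<eta> = (\<lambda>v :: complex^'k. \<Sum>b\<in>UNIV. (l $ b - (\<Sum>j\<in>UNIV. c j * P $ j $ b)) * v $ b)"
  have \<eta>_alt: "\<eta> v = (\<Sum>b\<in>UNIV. l $ b * v $ b) - (\<Sum>j\<in>UNIV. c j * (P *v v) $ j)" for v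
  proof -
    have "(\<Sum>b\<in>UNIV. (\<Sum>j\<in>UNIV. c j * P $ j $ b) * v $ b) = (\<Sum>j\<in>UNIV. c j * (P *v v) $ j)"
      unfolding matrix_vector_mult_def by (simp add: sum_distrib_left sum_distrib_right mult_ac) (rule sum.swap)
    then show ?thesis by (simp add: \<eta>_def left_diff_distrib sum_subtractf)
  qed
  have \<eta>_add: "\<eta> (x + y) = \<eta> x + \<eta> y" for x y by (simp add: \<eta>_def distrib_left sum.distrib)
  have \<eta>_scale: "\<eta> (a *s x) = a * \<eta> x" for a x by (simp add: \<eta>_def sum_distrib_left mult_ac)
  let ?S = "vec.span (t ` {..<m})" and ?T = "range ((*v) R)"
  have PRw: "P *v (R *v w) = w" for w by (simp add: matrix_vector_mul_assoc PR)
  have inj_t: "inj_on t {..<m}"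
  proof (rule inj_onI, rule ccontr)
    fix i j assume ij: "i \<in> {..<m}" "j \<in> {..<m}" "t i = t j" "i \<noteq> j"
    have "(\<Sum>k<m. (if k = i then 1 else if k = j then -1 else 0) *s t k)
        = (\<Sum>k\<in>{i, j}. (if k = i then 1 else if k = j then -1 else 0) *s t k)"
      by (rule sum.mono_neutral_right) (use ij in auto)
    also have "\<dots> = 0" using ij by (simp add: vec_eq_iff)
    finally show False using indep[of "\<lambda>k. if k = i then 1 else if k = j then -1 else 0"] ij by auto
  qed
  have ind_t: "vec.independent (t ` {..<m})"
  proof
    assume "vec.dependent (t ` {..<m})"
    then obtain u v where u: "v \<in> t ` {..<m}" "u v \<noteq> 0" "(\<Sum>v\<in>t ` {..<m}. u v *s v) = 0"
      by (auto simp: vec.dependent_finite)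
    then have "(\<Sum>i<m. u (t i) *s t i) = 0" by (simp add: sum.reindex[OF inj_t])
    then show False using indep[of "\<lambda>i. u (t i)"] u by auto
  qed
  then have dimS: "vec.dim ?S = m"
    using vec.dim_span_eq_card_independent[OF ind_t] card_image[OF inj_t] by simp
  have lR: "Vector_Spaces.linear (*s) (*s) ((*v) R)" by (rule matrix_vector_mul_linear_gen)
  have injR: "inj ((*v) R)" by (metis PRw injI)
  have dimT: "vec.dim ?T = CARD('n)"
    using vec.dim_image_eq[OF lR, of UNIV] injR vec_dim_card[where 'a=complex and 'n='n] by simp
  have subT: "vec.subspace ?T" by (rule vec.linear_subspace_image[OF lR vec.subspace_UNIV])
  have PS: "P *v x = 0" if "x \<in> ?S" for x
    using that by (induction rule: vec.span_induct_alt) (auto simp: Pt matrix_vector_right_distrib vector_scalar_commute)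
  have "?S \<inter> ?T = {0}"
  proof (intro equalityI subsetI)
    fix x assume "x \<in> ?S \<inter> ?T"
    then obtain w where "x = R *v w" "P *v x = 0" using PS by auto
    then show "x \<in> {0}" using PRw by auto
  qed (auto simp: vec.span_zero vec.subspace_0[OF subT])
  then have "vec.dim {x + y |x y. x \<in> ?S \<and> y \<in> ?T} = CARD('k)"
    using vec.dim_sums_Int[OF vec.subspace_span[of "t ` {..<m}"] subT] dimS dimT card by simp
  then have "vec.span {x + y |x y. x \<in> ?S \<and> y \<in> ?T} = UNIV"
    using vec.dim_eq_span[OF subset_UNIV, of "{x + y |x y. x \<in> ?S \<and> y \<in> ?T}"]
      vec_dim_card[where 'a=complex and 'n='k] vec.span_UNIV by simp
  moreover have "vec.subspace {x + y |x y. x \<in> ?S \<and> y \<in> ?T}"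
    by (rule vec.subspace_sums[OF vec.subspace_span subT])
  ultimately have full: "{x + y |x y. x \<in> ?S \<and> y \<in> ?T} = UNIV"
    using vec.span_eq_iff[of "{x + y |x y. x \<in> ?S \<and> y \<in> ?T}"] by simp
  have "\<eta> x = 0" if "x \<in> ?S" for x
    using that
  proof (induction rule: vec.span_induct_alt)
    case base
    show ?case by (simp add: \<eta>_def)
  next
    case (step a x y)
    then obtain i where "i < m" "x = t i" by auto
    then have "\<eta> x = 0" by (simp add: \<eta>_alt Pt lt)
    then show ?case using step by (simp add: \<eta>_add \<eta>_scale)
  qed
  moreover have "\<eta> (R *v w) = 0" for w
  proof -
    have "(\<Sum>b\<in>UNIV. l $ b * (R *v w) $ b) = (\<Sum>j\<in>UNIV. c j * w $ j)"
      unfolding matrix_vector_mult_def c_def by (simp add: sum_distrib_left sum_distrib_right mult_ac) (rule sum.swap)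
    then show ?thesis by (simp add: \<eta>_alt PRw)
  qed
  ultimately have "\<eta> v = 0" for v
  proof -
    have "v \<in> {x + y |x y. x \<in> ?S \<and> y \<in> ?T}" unfolding full by simp
    then show ?thesis using \<open>\<And>x. x \<in> ?S \<Longrightarrow> \<eta> x = 0\<close> \<open>\<And>w. \<eta> (R *v w) = 0\<close> by (auto simp: \<eta>_add)
  qed
  then have "\<eta> (axis b 1) = 0" for b by blast
  then have "l $ b - (\<Sum>j\<in>UNIV. c j * P $ j $ b) = 0" for b
    by (simp add: \<eta>_def axis_def if_distrib[of "\<lambda>y. _ * y"] cong: if_cong)
  then show ?thesis by (intro exI[of _ c]) simp
qed

lemma independent_differentials_subset:
  assumes "independent_differentials \<Omega> \<phi>" "open \<Omega>'" "\<Omega>' \<subseteq> \<Omega>"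
  shows "independent_differentials \<Omega>' \<phi>"
  using assms smooth_on_subset unfolding independent_differentials_def by blast

section \<open>Restriction of holomorphic functions to a CR submanifold\<close>

locale cr_submanifold_of =
  fixes X M :: "'x::topological_space set" and A :: "('x, complex^'v) chart set"
    and B :: "('x, real^'k) chart set" and m d :: nat
  assumes cr: "cr_submanifold X A M B m d"
begin

sublocale smooth_manifold M B
  by standard (use cr in \<open>auto simp: cr_submanifold_def smooth_submanifold_def\<close>)

lemma M_subset: "M \<subseteq> X"
  using cr by (simp add: cr_submanifold_def smooth_submanifold_def)

lemma X_chart: "(V, \<zeta>) \<in> A \<Longrightarrow> chart_on X (V, \<zeta>)"
  using cr by (auto simp: cr_submanifold_def complex_manifold_def)

lemma X_chart_at: "p \<in> X \<Longrightarrow> \<exists>V \<zeta>. (V, \<zeta>) \<in> A \<and> p \<in> V"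
  using cr unfolding cr_submanifold_def complex_manifold_def by force

lemma immersion_smooth: "(U, \<kappa>) \<in> B \<Longrightarrow> (V, \<zeta>) \<in> A \<Longrightarrow> smooth_on (\<kappa> ` (U \<inter> V)) (\<lambda>x. \<zeta> (inv_into U \<kappa> x))"
  using cr unfolding cr_submanifold_def smooth_submanifold_def o_def by fast

lemma holo_funD: "holo_fun A Y f \<Longrightarrow> (V, \<zeta>) \<in> A \<Longrightarrow> holo_on (\<zeta> ` (Y \<inter> V)) (\<lambda>x. f (inv_into V \<zeta> x))"
  unfolding holo_fun_def o_def by blast

lemma holo_fun_smooth:
  assumes Y: "openin (top_of_set X) Y" and f: "holo_fun A Y f"
  shows "smooth_fun A Y f"
  unfolding smooth_fun_def o_def
proof safe
  fix V \<zeta> assume V: "(V, \<zeta>) \<in> A"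
  show "smooth_on (\<zeta> ` (Y \<inter> V)) (\<lambda>x. f (inv_into V \<zeta> x))"
    by (rule holo_on_imp_smooth_on[OF chart_image_open[OF X_chart[OF V] Y] holo_funD[OF f V]])
qed

lemma holo_fun_restrict_smooth:
  assumes Y: "openin (top_of_set X) Y" and f: "holo_fun A Y f" and U: "openin (top_of_set M) U" "U \<subseteq> Y"
  shows "smooth_fun B U f"
  unfolding smooth_fun_def o_def
proof safe
  fix V \<kappa> assume V: "(V, \<kappa>) \<in> B"
  note inj = chart_onD(3)[OF chart[OF V]]
  show "smooth_on (\<kappa> ` (U \<inter> V)) (\<lambda>x. f (inv_into V \<kappa> x))"
  proof (rule smooth_on_local)
    fix x assume "x \<in> \<kappa> ` (U \<inter> V)"
    then obtain q where q: "q \<in> U" "q \<in> V" "x = \<kappa> q" by blast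
    then have "q \<in> X" using U(1) M_subset openin_imp_subset by blast
    then obtain V' \<zeta> where V': "(V', \<zeta>) \<in> A" "q \<in> V'" using X_chart_at by blast
    note inj' = chart_onD(3)[OF X_chart[OF V'(1)]]
    let ?T = "\<kappa> ` (U \<inter> V' \<inter> V)"
    have "openin (top_of_set M) (M \<inter> V')"
      by (rule openin_restrict[OF chart_onD(1)[OF X_chart[OF V'(1)]] M_subset])
    then have "openin (top_of_set M) (U \<inter> (M \<inter> V'))" using U(1) by blast
    moreover have "U \<inter> (M \<inter> V') = U \<inter> V'" using U(1) openin_imp_subset by blast
    ultimately have op: "open ?T" using chart_image_open[OF chart[OF V]] by metis
    have "smooth_on ?T (\<lambda>x. f (inv_into V' \<zeta> (\<zeta> (inv_into V \<kappa> x))))"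
    proof (rule smooth_on_compose[OF op _ _ smooth_fun_chartD[OF holo_fun_smooth[OF Y f] V'(1)]])
      show "(\<lambda>x. \<zeta> (inv_into V \<kappa> x)) ` ?T \<subseteq> \<zeta> ` (Y \<inter> V')"
        using U(2) by (auto simp: inv_into_f_f[OF inj])
      show "smooth_on ?T (\<lambda>x. \<zeta> (inv_into V \<kappa> x))"
        by (rule smooth_on_subset[OF immersion_smooth[OF V V'(1)]]) auto
    qed
    then have "smooth_on ?T (\<lambda>x. f (inv_into V \<kappa> x))"
      by (rule smooth_on_cong[OF op, rotated]) (auto simp: inv_into_f_f[OF inj] inv_into_f_f[OF inj'])
    then show "\<exists>T. x \<in> T \<and> smooth_on T (\<lambda>x. f (inv_into V \<kappa> x))"
      by (intro exI[of _ ?T] conjI) (use q V'(2) in auto)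
  qed
qed

text \<open>Complex linearity of the differential gives
  \<open>D (axis j \<i>) = \<i> * D (axis j 1)\<close>, so each \<open>dzbar\<close> vanishes on
  \<open>f\<close>. As \<open>f\<close> is smooth near \<open>q\<close> in \<open>X\<close>,
  \<open>push_incl\<close> does not alter the value \<open>v f\<close>.\<close>

lemma cr_bundle_kills_holo:
  assumes Y: "openin (top_of_set X) Y" and f: "holo_fun A Y f" and q: "q \<in> Y"
    and v: "v \<in> cr_bundle X A M B q"
  shows "v f = 0"
proof -
  have sm: "smooth_near X A q f"
    by (rule smooth_near_if[OF Y holo_fun_smooth[OF Y f] q])
  from v obtain \<zeta> c where \<zeta>: "\<zeta> \<in> A" "q \<in> fst \<zeta>"
    "push_incl X A q v = (\<lambda>f. if smooth_near X A q f then \<Sum>j\<in>UNIV. c j * dzbar \<zeta> q j f else 0)"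
    unfolding cr_bundle_def antiholo_tangent_def by blast
  obtain V z where V: "\<zeta> = (V, z)" by fastforce
  have hol: "holo_on (z ` (Y \<inter> V)) (\<lambda>x. f (inv_into V z x))" using holo_funD[OF f] \<zeta>(1) V by blast
  have zq: "z q \<in> z ` (Y \<inter> V)" using q \<zeta>(2) V by auto
  have "dzbar \<zeta> q j f = 0" for j
  proof -
    have "axis j \<i> = \<i> *s (axis j 1 :: complex^'v)" by (simp add: vec_eq_iff axis_def)
    then have "ddir (\<lambda>x. f (inv_into V z x)) (axis j \<i>) (z q) = \<i> * ddir (\<lambda>x. f (inv_into V z x)) (axis j 1) (z q)"
      using ddir_scale[OF hol zq] by simp
    then show ?thesis by (simp add: dzbar_def V Let_def o_def)
  qed
  then have "push_incl X A q v f = 0" using \<zeta>(3) by simp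
  then show ?thesis using sm by (simp add: push_incl_def)
qed

text \<open>Smooth CR functions, tested on single vectors rather than on sections over
  \<open>U\<close>. This form passes to smaller sets without any extension of sections, and implies
  the condition in \<open>cr_sections\<close> for each regularity.\<close>

definition cr_function :: "'x set \<Rightarrow> ('x \<Rightarrow> complex) \<Rightarrow> bool" where
  "cr_function U f \<longleftrightarrow> smooth_fun B U f \<and> (\<forall>q\<in>U. \<forall>v\<in>cr_bundle X A M B q. v f = 0)"

lemma cr_function_holo:
  assumes "openin (top_of_set X) Y" "holo_fun A Y f" "openin (top_of_set M) U" "U \<subseteq> Y"
  shows "cr_function U f"
  unfolding cr_function_def using holo_fun_restrict_smooth[OF assms] cr_bundle_kills_holo[OF assms(1,2)] assms(4) by blast

text \<open>One smooth function gives a section for every value of \<open>a\<close>; so surjectivity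
  for any \<open>a\<close> can be applied to smooth CR functions.\<close>

lemma cr_function_section:
  assumes U: "openin (top_of_set M) U" and f: "cr_function U f"
  shows "sec_of_fun a f \<in> cr_sections X A M B a U"
proof -
  have s: "smooth_fun B U f" using f by (simp add: cr_function_def)
  have Z0: "Z q f = 0" if "Z \<in> bundle_sections M B (cr_bundle X A M B) U" "q \<in> U" for Z q
    using that f by (auto simp: bundle_sections_def cr_function_def)
  have w: "weakly_annihilates B U Z (mdistr_of_fun f)"
    if "Z \<in> bundle_sections M B (cr_bundle X A M B) U" for Z
    using that Z0[OF that] by (intro weakly_annihilates_of_fun[OF U s]) (auto simp: bundle_sections_def)
  show ?thesis
    by (cases a) (use s Z0 w smooth_fun_continuous_on[OF U s] mdistribution_of_fun[OF U s] in auto)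
qed

lemma cr_bundle_ctangent: "v \<in> cr_bundle X A M B q \<Longrightarrow> v \<in> ctangent M B q"
  by (simp add: cr_bundle_def)

lemma cr_bundle_frame:
  assumes "q \<in> M"
  obtains v where "\<And>i. i < m \<Longrightarrow> v i \<in> cr_bundle X A M B q"
    "\<And>c. (\<forall>f. (\<Sum>i<m. c i * v i f) = 0) \<Longrightarrow> \<forall>i<m. c i = 0"
proof -
  have "smooth_subbundle M B m (cr_bundle X A M B)"
    using cr by (simp add: cr_submanifold_def cr_manifold_def)
  then have "\<exists>U Z. nbhd M q U \<and> (\<forall>i<m. vector_field M B U (Z i)) \<and>
      (\<forall>q\<in>U. cr_bundle X A M B q = {v. \<exists>c. v = (\<lambda>f. \<Sum>i<m. c i * Z i q f)} \<and>
        (\<forall>c. (\<forall>f. (\<Sum>i<m. c i * Z i q f) = 0) \<longrightarrow> (\<forall>i<m. c i = 0)))"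
    unfolding smooth_subbundle_def by (rule bspec) (rule assms)
  then obtain U Z where UZ: "nbhd M q U" "\<forall>q\<in>U. cr_bundle X A M B q = {v. \<exists>c. v = (\<lambda>f. \<Sum>i<m. c i * Z i q f)} \<and>
        (\<forall>c. (\<forall>f. (\<Sum>i<m. c i * Z i q f) = 0) \<longrightarrow> (\<forall>i<m. c i = 0))"
    by (elim exE conjE) (rule that)
  then have q: "cr_bundle X A M B q = {v. \<exists>c. v = (\<lambda>f. \<Sum>i<m. c i * Z i q f)}"
    "\<And>c. (\<forall>f. (\<Sum>i<m. c i * Z i q f) = 0) \<Longrightarrow> \<forall>i<m. c i = 0"
    using nbhd_mem[OF UZ(1)] by blast+
  have "Z i q \<in> cr_bundle X A M B q" if "i < m" for i
  proof -
    have "(\<Sum>j<m. (if j = i then 1 else 0) * Z j q f) = Z i q f" for f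
      using that by (simp add: if_distrib[of "\<lambda>y. y * _"] cong: if_cong)
    then show ?thesis unfolding q(1) mem_Collect_eq by (intro exI[of _ "\<lambda>j. if j = i then 1 else 0"]) simp
  qed
  then show ?thesis by (rule that[of "\<lambda>i. Z i q"]) (assumption, rule q(2))
qed

end

section \<open>The generic embedding given by the selected coordinates\<close>

locale cr_embedding = cr_submanifold_of X M A B m d
  for X M :: "'x::topological_space set" and A :: "('x, complex^'v) chart set"
    and B :: "('x, real^'k) chart set" and m d :: nat +
  fixes U W :: "'x set" and z :: "'x \<Rightarrow> complex^'v" and \<sigma> :: "'n::finite \<Rightarrow> 'v" and p\<^sub>0 :: 'x
  assumes card_n: "CARD('n) = m + d" and p0M: "p\<^sub>0 \<in> M" and W: "holo_chart X A (W, z)"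
    and p0W: "p\<^sub>0 \<in> W" and zp0: "z p\<^sub>0 = 0"
    and indep: "differentials_independent M B p\<^sub>0 (\<lambda>i q. z q $ \<sigma> i)"
    and U: "nbhd M p\<^sub>0 U" "U \<subseteq> M \<inter> W"
begin

abbreviation \<phi> where "\<phi> \<equiv> coord_proj z \<sigma>"

lemma phi_nth: "\<phi> q $ j = z q $ \<sigma> j"
  by (simp add: coord_proj_def)

lemma phi_p0: "\<phi> p\<^sub>0 = 0"
  by (simp add: vec_eq_iff phi_nth zp0)

lemma W_chart: "chart_on X (W, z)"
  using W by (simp add: holo_chart_def)

lemma W_open: "openin (top_of_set X) W"
  by (rule chart_onD(1)[OF W_chart])

lemma inj_z: "inj_on z W"
  by (rule chart_onD(3)[OF W_chart])

lemma U_open: "openin (top_of_set M) U"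
  using U(1) by (simp add: nbhd_def)

lemma compatible: "(V, \<zeta>) \<in> A \<Longrightarrow> holo_on (z ` (W \<inter> V)) (\<lambda>x. \<zeta> (inv_into W z x) $ j)"
  "(V, \<zeta>) \<in> A \<Longrightarrow> holo_on (\<zeta> ` (W \<inter> V)) (\<lambda>x. z (inv_into V \<zeta> x) $ l)"
  using W unfolding holo_chart_def holo_compatible_def by fast+

lemma coordinate_holo: "holo_fun A W (\<lambda>q. z q $ l)"
  unfolding holo_fun_def o_def using compatible(2) by blast

text \<open>\<open>holo_fun\<close> refers to the charts in \<open>A\<close>, while
  \<open>(W, z)\<close> is only assumed compatible with these, so every point is treated through a
  chart of \<open>A\<close>.\<close>

lemma holo_in_chart:
  assumes Y: "openin (top_of_set X) Y" and f: "holo_fun A Y f"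
  shows "holo_on (z ` (Y \<inter> W)) (\<lambda>x. f (inv_into W z x))"
proof (rule holo_on_local)
  fix x assume "x \<in> z ` (Y \<inter> W)"
  then obtain q where q: "q \<in> Y" "q \<in> W" "x = z q" by blast
  then have "q \<in> X" using Y openin_imp_subset by blast
  then obtain V \<zeta> where V: "(V, \<zeta>) \<in> A" "q \<in> V" using X_chart_at by blast
  note inj = chart_onD(3)[OF X_chart[OF V(1)]]
  let ?T = "z ` (Y \<inter> V \<inter> W)"
  have op: "open ?T"
    by (rule chart_image_open[OF W_chart]) (use Y chart_onD(1)[OF X_chart[OF V(1)]] in auto)
  have "holo_on ?T (\<lambda>x. f (inv_into V \<zeta> (\<zeta> (inv_into W z x))))"
  proof (rule holo_on_compose[OF _ holo_funD[OF f V(1)]])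
    show "holo_on ?T (\<lambda>x. \<zeta> (inv_into W z x) $ j)" for j
      by (rule holo_on_subset[OF compatible(1)[OF V(1)]]) auto
    show "(\<lambda>x. \<zeta> (inv_into W z x)) ` ?T \<subseteq> \<zeta> ` (Y \<inter> V)"
      by (auto simp: inv_into_f_f[OF inj_z])
  qed
  then have "holo_on ?T (\<lambda>x. f (inv_into W z x))"
    by (rule holo_on_cong[OF op, rotated]) (auto simp: inv_into_f_f[OF inj] inv_into_f_f[OF inj_z])
  then show "\<exists>T. x \<in> T \<and> holo_on T (\<lambda>x. f (inv_into W z x))"
    by (intro exI[of _ ?T] conjI) (use q V(2) in auto)
qed

lemma phi_preimage_open:
  assumes "open D"
  shows "openin (top_of_set X) (W \<inter> \<phi> -` D)"
proof -
  have "continuous_on W \<phi>"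
    unfolding coord_proj_def[abs_def]
    by (intro continuous_on_vec_lambda continuous_intros chart_onD(4)[OF W_chart])
  then show ?thesis using continuous_openin_preimage_gen[OF _ assms] W_open openin_trans by blast
qed

lemma pullback_holo:
  assumes D: "open D" and g: "holo_on D g"
  shows "holo_fun A (W \<inter> \<phi> -` D) (\<lambda>q. g (\<phi> q))"
  unfolding holo_fun_def o_def
proof safe
  fix V \<zeta> assume V: "(V, \<zeta>) \<in> A"
  note inj = chart_onD(3)[OF X_chart[OF V]]
  show "holo_on (\<zeta> ` (W \<inter> \<phi> -` D \<inter> V)) (\<lambda>x. g (\<phi> (inv_into V \<zeta> x)))"
  proof (rule holo_on_compose[OF _ g])
    show "holo_on (\<zeta> ` (W \<inter> \<phi> -` D \<inter> V)) (\<lambda>x. \<phi> (inv_into V \<zeta> x) $ j)" for j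
      unfolding phi_nth by (rule holo_on_subset[OF compatible(2)[OF V]]) auto
    show "(\<lambda>x. \<phi> (inv_into V \<zeta> x)) ` \<zeta> ` (W \<inter> \<phi> -` D \<inter> V) \<subseteq> D"
      by (auto simp: inv_into_f_f[OF inj])
  qed
qed

text \<open>The \<open>(0,1)\<close> tangent space has dimension \<open>m = dim M - n\<close> and is contained in the kernel of
  \<open>d\<phi>\<close>, so it is the kernel, and every differential \<open>dz\<^sub>l\<close> is a combination of the components of
  \<open>d\<phi>\<close>.\<close>

lemma coordinate_differentials_in_span:
  assumes V: "(V, \<kappa>) \<in> B" and q: "q \<in> U" "q \<in> V"
    and R: "(\<chi> j b. ddir (\<lambda>x. \<phi> (inv_into V \<kappa> x) $ j) (axis b 1) (\<kappa> q)) ** R = mat 1"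
  shows "\<exists>c. \<forall>b. ddir (\<lambda>x. z (inv_into V \<kappa> x) $ l) (axis b 1) (\<kappa> q)
    = (\<Sum>j\<in>UNIV. c j * ddir (\<lambda>x. \<phi> (inv_into V \<kappa> x) $ j) (axis b 1) (\<kappa> q))"
proof -
  have qM: "q \<in> M" and qW: "q \<in> W" using q(1) U(2) by auto
  obtain v where v: "\<And>i. i < m \<Longrightarrow> v i \<in> cr_bundle X A M B q"
    "\<And>c. (\<forall>f. (\<Sum>i<m. c i * v i f) = 0) \<Longrightarrow> \<forall>i<m. c i = 0"
    using cr_bundle_frame[OF qM] by blast
  have ct: "v i \<in> ctangent M B q" if "i < m" for i by (rule cr_bundle_ctangent[OF v(1)[OF that]])
  define t where "t = (\<lambda>i. \<chi> b. v i (coord \<kappa> b))"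
  define P where "P = (\<chi> j b. ddir (\<lambda>x. \<phi> (inv_into V \<kappa> x) $ j) (axis b 1) (\<kappa> q))"
  define l' where "l' = (\<chi> b. ddir (\<lambda>x. z (inv_into V \<kappa> x) $ l) (axis b 1) (\<kappa> q))"
  have smz: "smooth_near M B q (\<lambda>q. z q $ l)" for l
    by (rule smooth_near_if[OF U_open holo_fun_restrict_smooth[OF W_open coordinate_holo U_open] q(1)]) (use U(2) in auto)
  have vz: "(\<Sum>b\<in>UNIV. v i (coord \<kappa> b) * ddir (\<lambda>x. z (inv_into V \<kappa> x) $ l) (axis b 1) (\<kappa> q)) = 0"
    if "i < m" for i l
    using ctangent_expansion[OF ct[OF that] V q(2) smz] cr_bundle_kills_holo[OF W_open coordinate_holo qW v(1)[OF that]]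
    by simp
  have "\<exists>c. \<forall>b. l' $ b = (\<Sum>j\<in>UNIV. c j * P $ j $ b)"
  proof (rule covector_in_row_span[where R=R and m=m and t=t])
    show "P ** R = mat 1" unfolding P_def by (rule R)
    show "CARD('k) = CARD('n) + m"
      using cr card_n by (simp add: cr_submanifold_def cr_manifold_def)
    show "P *v t i = 0" if "i < m" for i
      using vz[OF that] by (simp add: vec_eq_iff matrix_vector_mult_def P_def t_def phi_nth mult.commute)
    show "(\<Sum>b\<in>UNIV. l' $ b * t i $ b) = 0" if "i < m" for i
      using vz[OF that, of l] by (simp add: l'_def t_def mult.commute)
    fix c assume c: "(\<Sum>i<m. c i *s t i) = 0"
    have c0: "(\<Sum>i<m. c i * v i (coord \<kappa> b)) = 0" for b
      using arg_cong[OF c, of "\<lambda>w. w $ b"] by (simp add: t_def)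
    \<comment> \<open>A derivation is determined by its values on coordinates, so a relation among
      the vectors \<open>t i\<close> is one among the derivations \<open>v i\<close>. On functions
      that are not smooth near \<open>q\<close> all of them are \<open>0\<close> by
      convention.\<close>
    have "(\<Sum>i<m. c i * v i f) = 0" for f
    proof (cases "smooth_near M B q f")
      case True
      have "(\<Sum>i<m. c i * v i f) = (\<Sum>i<m. \<Sum>b\<in>UNIV. c i * v i (coord \<kappa> b) * ddir (\<lambda>x. f (inv_into V \<kappa> x)) (axis b 1) (\<kappa> q))"
        by (rule sum.cong[OF refl]) (simp add: ctangent_expansion[OF ct V q(2) True] sum_distrib_left mult_ac)
      also have "\<dots> = (\<Sum>b\<in>UNIV. (\<Sum>i<m. c i * v i (coord \<kappa> b)) * ddir (\<lambda>x. f (inv_into V \<kappa> x)) (axis b 1) (\<kappa> q))"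
        by (subst sum.swap) (simp add: sum_distrib_right)
      finally show ?thesis by (simp add: c0)
    next
      case False
      then show ?thesis using ctangentD(5)[OF ct False] by simp
    qed
    then show "\<forall>i<m. c i = 0" using v(2) by blast
  qed
  then show ?thesis by (simp add: l'_def P_def)
qed

text \<open>At each point coefficients exist by \<open>coordinate_differentials_in_span\<close>, but
  smoothness needs a formula. A fixed right inverse \<open>Q\<close> of the Jacobian of
  \<open>\<phi>\<close> at \<open>p\<^sub>0\<close> turns the Jacobian into a square matrix
  \<open>N x\<close>, invertible near that point, and Cramer's rule gives the coefficients as
  quotients of smooth determinants.\<close>

lemma local_frame:
  obtains V \<kappa> \<Omega> C where "(V, \<kappa>) \<in> B" "p\<^sub>0 \<in> V" "\<kappa> p\<^sub>0 \<in> \<Omega>" "\<Omega> \<subseteq> \<kappa> ` (U \<inter> V)"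
    "independent_differentials \<Omega> (\<lambda>x. \<phi> (inv_into V \<kappa> x))"
    "smooth_on \<Omega> (\<lambda>x. z (inv_into V \<kappa> x))" "\<And>l j. smooth_on \<Omega> (C l j)"
    "\<And>x l b. x \<in> \<Omega> \<Longrightarrow> b \<in> Basis \<Longrightarrow> ddir (\<lambda>x. z (inv_into V \<kappa> x) $ l) b x
      = (\<Sum>j\<in>UNIV. C l j x * ddir (\<lambda>x. \<phi> (inv_into V \<kappa> x) $ j) b x)"
proof -
  obtain V \<kappa> where V: "(V, \<kappa>) \<in> B" "p\<^sub>0 \<in> V" using chart_at[OF p0M] by blast
  note inj = chart_onD(3)[OF chart[OF V(1)]]
  define D where "D = \<kappa> ` (U \<inter> V)"
  have D: "open D" unfolding D_def by (rule chart_image_open[OF chart[OF V(1)] U_open])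
  define x0 where "x0 = \<kappa> p\<^sub>0"
  have x0: "x0 \<in> D" using V(2) nbhd_mem[OF U(1)] by (auto simp: D_def x0_def)
  define Z where "Z = (\<lambda>x. z (inv_into V \<kappa> x))"
  define \<Phi> where "\<Phi> = (\<lambda>x. \<phi> (inv_into V \<kappa> x))"
  have Z: "smooth_on D (\<lambda>x. Z x $ l)" for l
    unfolding Z_def D_def
    by (rule smooth_fun_chartD[OF holo_fun_restrict_smooth[OF W_open coordinate_holo U_open] V(1)]) (use U(2) in auto)
  have \<Phi>Z: "\<Phi> x $ j = Z x $ \<sigma> j" for x j by (simp add: \<Phi>_def Z_def phi_nth)
  have \<Phi>: "smooth_on D (\<lambda>x. \<Phi> x $ j)" for j unfolding \<Phi>Z by (rule Z)
  define P where "P = (\<lambda>x. \<chi> j b. ddir (\<lambda>x. \<Phi> x $ j) (axis b 1) x)"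
  have "\<exists>Q. P x0 ** Q = mat 1"
    unfolding matrix_right_invertible_independent_rows
  proof (intro allI impI)
    fix c i assume c: "(\<Sum>i\<in>UNIV. c i *s row i (P x0)) = 0"
    have c0: "(\<Sum>j\<in>UNIV. c j * ddir (\<lambda>x. \<Phi> x $ j) (axis b 1) x0) = 0" for b
      using arg_cong[OF c, of "\<lambda>w. w $ b"] by (simp add: row_def P_def)
    \<comment> \<open>By \<open>ctangent_expansion\<close> a relation between the rows of the
      Jacobian is a relation between the differentials, tested on all derivations.\<close>
    have "(\<Sum>j\<in>UNIV. c j * v (\<lambda>q. z q $ \<sigma> j)) = 0" if v: "v \<in> ctangent M B p\<^sub>0" for v
    proof -
      have smz: "smooth_near M B p\<^sub>0 (\<lambda>q. z q $ l)" for l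
        by (rule smooth_near_if[OF U_open holo_fun_restrict_smooth[OF W_open coordinate_holo U_open] nbhd_mem[OF U(1)]])
           (use U(2) in auto)
      have "(\<Sum>j\<in>UNIV. c j * v (\<lambda>q. z q $ \<sigma> j)) = (\<Sum>j\<in>UNIV. \<Sum>b\<in>UNIV. v (coord \<kappa> b) * (c j * ddir (\<lambda>x. \<Phi> x $ j) (axis b 1) x0))"
        by (rule sum.cong[OF refl])
           (simp add: ctangent_expansion[OF v V smz] sum_distrib_left mult_ac \<Phi>_def phi_nth x0_def)
      also have "\<dots> = (\<Sum>b\<in>UNIV. v (coord \<kappa> b) * (\<Sum>j\<in>UNIV. c j * ddir (\<lambda>x. \<Phi> x $ j) (axis b 1) x0))"
        by (subst sum.swap) (simp add: sum_distrib_left)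
      finally show ?thesis by (simp add: c0)
    qed
    then show "c i = 0" using indep unfolding differentials_independent_def by blast
  qed
  then obtain Q where Q: "P x0 ** Q = mat 1" by blast
  define N where "N = (\<lambda>x. P x ** Q)"
  have bB: "axis b 1 \<in> (Basis :: (real^'k) set)" for b by simp
  have N: "smooth_on D (\<lambda>x. N x $ i $ j)" for i j
    unfolding N_def matrix_matrix_mult_def P_def
    by (simp, intro smooth_on_sum smooth_on_mult smooth_on_ddir D \<Phi> smooth_on_const bB)
  have detN: "smooth_on D (\<lambda>x. det (N x))" by (rule smooth_on_det[OF D N])
  define \<Omega> where "\<Omega> = {x \<in> D. det (N x) \<noteq> 0}"
  have "\<Omega> = D \<inter> (\<lambda>x. det (N x)) -` (- {0})" by (auto simp: \<Omega>_def)
  then have \<Omega>: "open \<Omega>"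
    using continuous_open_preimage[OF smooth_on_continuous_on[OF detN] D, of "- {0}"] by (simp add: open_Compl)
  have \<Omega>D: "\<Omega> \<subseteq> D" by (auto simp: \<Omega>_def)
  have x0\<Omega>: "x0 \<in> \<Omega>" using x0 Q by (simp add: \<Omega>_def N_def)
  have right_inv: "\<exists>S. P x ** S = mat 1" if "x \<in> \<Omega>" for x
  proof -
    have "invertible (N x)" using that by (simp add: \<Omega>_def invertible_det_nz)
    then obtain I where "N x ** I = mat 1" unfolding invertible_def by blast
    then have "P x ** (Q ** I) = mat 1" by (simp add: matrix_mul_assoc N_def)
    then show ?thesis by blast
  qed
  have ind: "independent_differentials \<Omega> \<Phi>"
  proof
    show "smooth_on \<Omega> \<Phi>" by (rule smooth_on_vecI[OF \<Omega> smooth_on_subset[OF \<Phi> \<Omega>D]])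
    fix x assume x: "x \<in> \<Omega>"
    obtain S where S: "P x ** S = mat 1" using right_inv[OF x] by blast
    have "(\<Sum>b\<in>Basis. S $ axis_index b $ i * ddir (\<lambda>x. \<Phi> x $ j) b x) = (if i = j then 1 else 0)" for i j
    proof -
      have "(P x ** S) $ j $ i = (if i = j then 1 else 0)" by (simp add: S mat_def)
      then show ?thesis by (simp add: sum_Basis_cart matrix_matrix_mult_def P_def mult.commute)
    qed
    then show "\<exists>\<mu> :: 'n \<Rightarrow> real^'k \<Rightarrow> complex. \<forall>i j. (\<Sum>b\<in>Basis. \<mu> i b * ddir (\<lambda>x. \<Phi> x $ j) b x) = (if i = j then 1 else 0)"
      by (intro exI[of _ "\<lambda>i b. S $ axis_index b $ i"]) blast
  qed (rule \<Omega>)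
  \<comment> \<open>The row of partial derivatives of coordinate \<open>l\<close> multiplied by
    \<open>Q\<close>: the right-hand side of the square system with matrix
    \<open>transpose (N x)\<close> that the coefficients solve.\<close>
  define w where "w = (\<lambda>l x r. \<Sum>b\<in>UNIV. Q $ b $ r * ddir (\<lambda>x. Z x $ l) (axis b 1) x)"
  define C where "C = (\<lambda>l j x. det (\<chi> r s. if s = j then w l x r else N x $ s $ r) / det (N x))"
  have w: "smooth_on D (\<lambda>x. w l x r)" for l r
    unfolding w_def by (intro smooth_on_sum smooth_on_mult smooth_on_ddir D Z smooth_on_const bB)
  have C: "smooth_on \<Omega> (C l j)" for l j
    unfolding C_def
  proof (rule smooth_on_divide[OF \<Omega> _ smooth_on_subset[OF detN \<Omega>D]])
    have "smooth_on \<Omega> (\<lambda>x. (\<chi> r s. if s = j then w l x r else N x $ s $ r) $ r $ s)" for r s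
      using smooth_on_subset[OF w \<Omega>D] smooth_on_subset[OF N \<Omega>D] by (cases "s = j") auto
    then show "smooth_on \<Omega> (\<lambda>x. det (\<chi> r s. if s = j then w l x r else N x $ s $ r))"
      by (rule smooth_on_det[OF \<Omega>])
  qed (simp add: \<Omega>_def)
  have dZ: "ddir (\<lambda>x. Z x $ l) b x = (\<Sum>j\<in>UNIV. C l j x * ddir (\<lambda>x. \<Phi> x $ j) b x)"
    if x: "x \<in> \<Omega>" and b: "b \<in> Basis" for x l b
  proof -
    obtain q where q: "q \<in> U" "q \<in> V" "x = \<kappa> q" using x \<Omega>D by (auto simp: D_def)
    obtain c where c: "\<And>b. ddir (\<lambda>x. Z x $ l) (axis b 1) x = (\<Sum>j\<in>UNIV. c j * ddir (\<lambda>x. \<Phi> x $ j) (axis b 1) x)"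
    proof -
      obtain S where "P x ** S = mat 1" using right_inv[OF x] by blast
      then show ?thesis
        using coordinate_differentials_in_span[OF V(1) q(1,2), of S l] that
        unfolding P_def \<Phi>_def Z_def q(3) by blast
    qed
    have "transpose (N x) *v (\<chi> j. c j) = (\<chi> r. w l x r)"
    proof -
      have "(\<Sum>j\<in>UNIV. N x $ j $ r * c j) = w l x r" for r
        unfolding w_def c N_def matrix_matrix_mult_def
        by (simp add: P_def sum_distrib_left sum_distrib_right mult_ac) (rule sum.swap)
      then show ?thesis by (simp add: vec_eq_iff matrix_vector_mult_def transpose_def)
    qed
    moreover have "det (transpose (N x)) \<noteq> 0" using x by (simp add: \<Omega>_def)
    ultimately have "(\<chi> j. c j) = (\<chi> j. det (\<chi> r s. if s = j then (\<chi> r. w l x r) $ r else transpose (N x) $ r $ s) / det (transpose (N x)))"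
      using cramer by blast
    then have "c j = C l j x" for j
      by (simp add: vec_eq_iff C_def transpose_def det_transpose[unfolded transpose_def] cong: if_cong)
    then have "c = (\<lambda>j. C l j x)" by blast
    moreover obtain i where "b = axis i 1" using b by (auto simp: Basis_vec_def)
    ultimately show ?thesis using c by simp
  qed
  have "smooth_on \<Omega> Z" by (rule smooth_on_vecI[OF \<Omega> smooth_on_subset[OF Z \<Omega>D]])
  then show ?thesis
    using that[OF V, of \<Omega> C] x0\<Omega> \<Omega>D ind C dZ unfolding x0_def D_def \<Phi>_def Z_def by blast
qed

text \<open>The vanishing is known only near \<open>p\<^sub>0\<close> in \<open>M\<close>. The chart
  domain is shrunk until \<open>\<phi>\<close> maps it into a ball inside \<open>D\<close>, where
  \<open>vanishing_holo\<close> applies.\<close>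

lemma pullback_injective:
  assumes D: "open D" "0 \<in> D" and g: "holo_on D g" and N: "nbhd M p\<^sub>0 N"
    and zero: "\<And>q. q \<in> N \<Longrightarrow> q \<in> U \<Longrightarrow> \<phi> q \<in> D \<Longrightarrow> g (\<phi> q) = 0"
  obtains r where "r > 0" "ball 0 r \<subseteq> D" "\<And>y. y \<in> ball 0 r \<Longrightarrow> g y = 0"
proof -
  obtain V \<kappa> \<Omega> C where fr: "(V, \<kappa>) \<in> B" "p\<^sub>0 \<in> V" "\<kappa> p\<^sub>0 \<in> \<Omega>" "\<Omega> \<subseteq> \<kappa> ` (U \<inter> V)"
    "independent_differentials \<Omega> (\<lambda>x. \<phi> (inv_into V \<kappa> x))"
    by (rule local_frame) (rule that; assumption)
  note inj = chart_onD(3)[OF chart[OF fr(1)]]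
  obtain r where r: "r > 0" "ball 0 r \<subseteq> D" using D openE by blast
  define N' where "N' = N \<inter> (M \<inter> (W \<inter> \<phi> -` ball 0 r))"
  have N': "openin (top_of_set M) N'" "p\<^sub>0 \<in> N'"
    using N openin_restrict[OF phi_preimage_open[OF open_ball] M_subset, of 0 r] p0M p0W phi_p0 r(1)
    by (auto simp: N'_def nbhd_def)
  define \<Omega>' where "\<Omega>' = \<Omega> \<inter> \<kappa> ` (N' \<inter> V)"
  have \<Omega>: "open \<Omega>" using fr(5) by (simp add: independent_differentials_def)
  have "independent_differentials \<Omega>' (\<lambda>x. \<phi> (inv_into V \<kappa> x))"
    by (rule independent_differentials_subset[OF fr(5)])
       (use \<Omega> chart_image_open[OF chart[OF fr(1)] N'(1)] in \<open>auto simp: \<Omega>'_def\<close>)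
  then interpret independent_differentials \<Omega>' "\<lambda>x. \<phi> (inv_into V \<kappa> x)" .
  have base: "\<phi> (inv_into V \<kappa> (\<kappa> p\<^sub>0)) = 0" using inv_into_f_f[OF inj fr(2)] phi_p0 by simp
  have x: "\<exists>q. x = \<kappa> q \<and> q \<in> U \<and> q \<in> V \<and> q \<in> N' \<and> inv_into V \<kappa> x = q" if "x \<in> \<Omega>'" for x
  proof -
    obtain q where q: "x = \<kappa> q" "q \<in> N'" "q \<in> V" using \<open>x \<in> \<Omega>'\<close> by (auto simp: \<Omega>'_def)
    moreover have "q \<in> U" using that q(1,3) fr(4) inj by (auto simp: \<Omega>'_def inj_on_def)
    ultimately show ?thesis using inv_into_f_f[OF inj q(3)] by blast
  qed
  have "g y = 0" if y: "y \<in> ball 0 r" for y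
  proof (rule vanishing_holo[of "\<kappa> p\<^sub>0" r g, unfolded base])
    show "\<kappa> p\<^sub>0 \<in> \<Omega>'" using fr N'(2) by (auto simp: \<Omega>'_def)
    show "holo_on (ball 0 r) g" by (rule holo_on_subset[OF g r(2)])
    show "(\<lambda>x. \<phi> (inv_into V \<kappa> x)) ` \<Omega>' \<subseteq> ball 0 r"
    proof clarify
      fix y assume "y \<in> \<Omega>'"
      then show "\<phi> (inv_into V \<kappa> y) \<in> ball 0 r" using x[of y] by (auto simp: N'_def)
    qed
    show "g (\<phi> (inv_into V \<kappa> y)) = 0" if "y \<in> \<Omega>'" for y
      using x[OF that] zero r(2) by (auto simp: N'_def)
  qed (rule y)
  then show ?thesis using that r by blast
qed

text \<open>\<open>extend\<close> is what surjectivity of restriction provides for smooth CR germs,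
  whatever the regularity. It is applied only to the coefficients \<open>C l j\<close> of
  \<open>local_frame\<close>.\<close>

theorem holo_restriction_factors:
  assumes extend: "\<And>N c. nbhd M p\<^sub>0 N \<Longrightarrow> cr_function N c \<Longrightarrow>
      \<exists>Y F N'. nbhd X p\<^sub>0 Y \<and> holo_fun A Y F \<and> nbhd M p\<^sub>0 N' \<and> N' \<subseteq> N \<inter> Y \<and> (\<forall>q\<in>N'. c q = F q)"
    and Y: "nbhd X p\<^sub>0 Y" and f: "holo_fun A Y f"
  obtains h r N where "r > 0" "holo_on (ball 0 r) h" "nbhd M p\<^sub>0 N" "N \<subseteq> U \<inter> Y"
    "\<And>q. q \<in> N \<Longrightarrow> \<phi> q \<in> ball 0 r \<and> f q = h (\<phi> q)"
proof -
  obtain V \<kappa> \<Omega> C where fr: "(V, \<kappa>) \<in> B" "p\<^sub>0 \<in> V" "\<kappa> p\<^sub>0 \<in> \<Omega>" "\<Omega> \<subseteq> \<kappa> ` (U \<inter> V)"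
    "independent_differentials \<Omega> (\<lambda>x. \<phi> (inv_into V \<kappa> x))"
    "smooth_on \<Omega> (\<lambda>x. z (inv_into V \<kappa> x))" "\<And>l j. smooth_on \<Omega> (C l j)"
    "\<And>x l b. x \<in> \<Omega> \<Longrightarrow> b \<in> Basis \<Longrightarrow> ddir (\<lambda>x. z (inv_into V \<kappa> x) $ l) b x
      = (\<Sum>j\<in>UNIV. C l j x * ddir (\<lambda>x. \<phi> (inv_into V \<kappa> x) $ j) b x)"
    by (rule local_frame) (rule that)
  note c = chart[OF fr(1)]
  note inj = chart_onD(3)[OF c]
  interpret fr: independent_differentials \<Omega> "\<lambda>x. \<phi> (inv_into V \<kappa> x)" by (rule fr(5))
  define N0 where "N0 = V \<inter> \<kappa> -` \<Omega>"
  have N0: "openin (top_of_set M) N0" "N0 \<subseteq> V" "p\<^sub>0 \<in> N0" "N0 \<subseteq> U" "nbhd M p\<^sub>0 N0"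
  proof -
    show o: "openin (top_of_set M) N0" unfolding N0_def by (rule chart_preimage_open[OF c fr.open_dom])
    show "N0 \<subseteq> V" "p\<^sub>0 \<in> N0" using fr by (auto simp: N0_def)
    then show "nbhd M p\<^sub>0 N0" using o by (simp add: nbhd_def)
    show "N0 \<subseteq> U"
    proof
      fix q assume "q \<in> N0"
      then have "q \<in> V" "\<kappa> q \<in> \<kappa> ` (U \<inter> V)" using fr(4) by (auto simp: N0_def)
      then show "q \<in> U" using inj by (auto simp: inj_on_def)
    qed
  qed
  have \<kappa>N0: "\<kappa> ` N0 \<subseteq> \<Omega>" by (auto simp: N0_def)
  have crC: "cr_function N0 (\<lambda>q. C l j (\<kappa> q))" for l j
    unfolding cr_function_def
  proof (intro conjI ballI)
    have op: "open (\<kappa> ` N0)" using chart_image_open[OF c N0(1)] N0(2) by (simp add: Int_absorb2)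
    have "smooth_on (\<kappa> ` N0) (C l j)" by (rule smooth_on_subset[OF fr(7) \<kappa>N0])
    then have "smooth_on (\<kappa> ` N0) (\<lambda>x. C l j (\<kappa> (inv_into V \<kappa> x)))"
      by (rule smooth_on_cong[OF op, rotated]) (use N0(2) in \<open>auto simp: inv_into_f_f[OF inj] subset_iff\<close>)
    then show sm: "smooth_fun B N0 (\<lambda>q. C l j (\<kappa> q))" by (rule smooth_fun_chartI[OF fr(1) N0(1,2)])
    fix q v assume q: "q \<in> N0" and v: "v \<in> cr_bundle X A M B q"
    have qV: "q \<in> V" "\<kappa> q \<in> \<Omega>" and qU: "q \<in> U" using q N0(4) by (auto simp: N0_def)
    note ct = cr_bundle_ctangent[OF v]
    \<comment> \<open>The differential of \<open>C l j\<close> is a combination of the differentials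
      of the components of \<open>\<phi>\<close>. These are holomorphic coordinates, which
      \<open>v\<close> annihilates.\<close>
    obtain e where e: "\<And>b. b \<in> Basis \<Longrightarrow> ddir (C l j) b (\<kappa> q) = (\<Sum>i\<in>UNIV. e i * ddir (\<lambda>x. \<phi> (inv_into V \<kappa> x) $ i) b (\<kappa> q))"
      using fr.ddir_coefficient_span[OF smooth_on_vec_nth[OF fr.open_dom fr(6), of l] _ fr(8) qV(2), of j]
        smooth_on_differentiable[OF fr(7)] by blast
    have "ddir (\<lambda>x. C l j (\<kappa> (inv_into V \<kappa> x))) b (\<kappa> q) = ddir (C l j) b (\<kappa> q)" for b
    proof (rule ddir_cong[OF fr.open_dom qV(2)])
      fix y assume "y \<in> \<Omega>"
      then have "y \<in> \<kappa> ` V" using fr(4) by blast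
      then show "C l j (\<kappa> (inv_into V \<kappa> y)) = C l j y" by (simp add: f_inv_into_f)
    qed
    then have "v (\<lambda>q. C l j (\<kappa> q)) = (\<Sum>b\<in>UNIV. v (coord \<kappa> b) * (\<Sum>i\<in>UNIV. e i * ddir (\<lambda>x. \<phi> (inv_into V \<kappa> x) $ i) (axis b 1) (\<kappa> q)))"
      by (simp add: ctangent_expansion[OF ct fr(1) qV(1) smooth_near_if[OF N0(1) sm q]] e)
    also have "\<dots> = (\<Sum>i\<in>UNIV. e i * (\<Sum>b\<in>UNIV. v (coord \<kappa> b) * ddir (\<lambda>x. z (inv_into V \<kappa> x) $ \<sigma> i) (axis b 1) (\<kappa> q)))"
      by (simp add: sum_distrib_left phi_nth mult_ac) (rule sum.swap)
    also have "\<dots> = (\<Sum>i\<in>UNIV. e i * v (\<lambda>q. z q $ \<sigma> i))"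
    proof -
      have smz: "smooth_near M B q (\<lambda>q. z q $ l)" for l
        by (rule smooth_near_if[OF U_open holo_fun_restrict_smooth[OF W_open coordinate_holo U_open] qU]) (use U(2) in auto)
      show ?thesis by (simp add: ctangent_expansion[OF ct fr(1) qV(1) smz])
    qed
    also have "\<dots> = 0"
      using cr_bundle_kills_holo[OF W_open coordinate_holo _ v] qU U(2) by (simp add: subset_iff)
    finally show "v (\<lambda>q. C l j (\<kappa> q)) = 0" .
  qed
  have "\<forall>l j. \<exists>Y F N'. nbhd X p\<^sub>0 Y \<and> holo_fun A Y F \<and> nbhd M p\<^sub>0 N' \<and> N' \<subseteq> N0 \<inter> Y \<and> (\<forall>q\<in>N'. C l j (\<kappa> q) = F q)"
    using extend[OF N0(5) crC] by blast
  then obtain Yf F N' where YF: "\<And>l j. nbhd X p\<^sub>0 (Yf l j)" "\<And>l j. holo_fun A (Yf l j) (F l j)"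
    "\<And>l j. nbhd M p\<^sub>0 (N' l j)" "\<And>l j. N' l j \<subseteq> N0 \<inter> Yf l j" "\<And>l j q. q \<in> N' l j \<Longrightarrow> C l j (\<kappa> q) = F l j q"
    by metis
  \<comment> \<open>There are finitely many coefficients, so the domains of their extensions have an
    open intersection.\<close>
  define YA where "YA = Y \<inter> (\<Inter>(l, j)\<in>UNIV. Yf l j)"
  have YA: "openin (top_of_set X) YA" "p\<^sub>0 \<in> YA" "YA \<subseteq> Y" "\<And>l j. YA \<subseteq> Yf l j"
  proof -
    have "openin (top_of_set X) (\<Inter>(l, j)\<in>UNIV. Yf l j)"
      by (rule openin_INT2) (use YF(1) in \<open>auto simp: nbhd_def\<close>)
    then show "openin (top_of_set X) YA" using Y by (auto simp: YA_def nbhd_def)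
    show "p\<^sub>0 \<in> YA" using Y YF(1) by (auto simp: YA_def nbhd_def)
  qed (auto simp: YA_def)
  have "open (z ` (YA \<inter> W))" by (rule chart_image_open[OF W_chart YA(1)])
  moreover have "0 \<in> z ` (YA \<inter> W)" using YA(2) p0W zp0 by (metis IntI imageI)
  ultimately obtain R where R: "R > 0" "ball 0 R \<subseteq> z ` (YA \<inter> W)" using openE by blast
  have holR: "holo_on (ball 0 R) (\<lambda>y. G (inv_into W z y))"
    if "openin (top_of_set X) Y'" "holo_fun A Y' G" "YA \<subseteq> Y'" for Y' G
    by (rule holo_on_subset[OF holo_in_chart[OF that(1,2)]]) (use R(2) that(3) in blast)
  define N1 where "N1 = N0 \<inter> (\<Inter>(l, j)\<in>UNIV. N' l j) \<inter> (M \<inter> (W \<inter> z -` ball 0 R))"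
  have N1: "openin (top_of_set M) N1" "p\<^sub>0 \<in> N1"
  proof -
    have "openin (top_of_set M) (\<Inter>(l, j)\<in>UNIV. N' l j)"
      by (rule openin_INT2) (use YF(3) in \<open>auto simp: nbhd_def\<close>)
    moreover have "openin (top_of_set M) (M \<inter> (W \<inter> z -` ball 0 R))"
      by (rule openin_restrict[OF chart_preimage_open[OF W_chart open_ball] M_subset])
    ultimately show "openin (top_of_set M) N1" using N0(1) unfolding N1_def by blast
    show "p\<^sub>0 \<in> N1" using N0(3) YF(3) p0M p0W zp0 R(1) by (auto simp: N1_def nbhd_def)
  qed
  define \<Omega>' where "\<Omega>' = \<kappa> ` (N1 \<inter> V)"
  have \<Omega>': "open \<Omega>'" unfolding \<Omega>'_def by (rule chart_image_open[OF c N1(1)])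
  have \<Omega>'\<Omega>: "\<Omega>' \<subseteq> \<Omega>" using \<kappa>N0 by (auto simp: \<Omega>'_def N1_def)
  have pt: "\<exists>q. x = \<kappa> q \<and> inv_into V \<kappa> x = q \<and> q \<in> N1 \<and> inv_into W z (z q) = q \<and> z q \<in> ball 0 R" if "x \<in> \<Omega>'" for x
  proof -
    obtain q where q: "q \<in> N1" "q \<in> V" "x = \<kappa> q" using \<open>x \<in> \<Omega>'\<close> by (auto simp: \<Omega>'_def)
    then have "q \<in> W" "z q \<in> ball 0 R" by (auto simp: N1_def)
    then show ?thesis using q inv_into_f_f[OF inj q(2)] inv_into_f_f[OF inj_z] by blast
  qed
  have x0: "\<kappa> p\<^sub>0 \<in> \<Omega>'" using N1(2) fr(2) by (auto simp: \<Omega>'_def)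
  have inv0: "inv_into V \<kappa> (\<kappa> p\<^sub>0) = p\<^sub>0" by (rule inv_into_f_f[OF inj fr(2)])
  \<comment> \<open>The order of the indices changes: \<open>C l j\<close> and \<open>F l j\<close>
    name the coordinate \<open>l\<close> of \<open>X\<close> first, the locale names the component
    \<open>j\<close> of \<open>\<phi>\<close> first.\<close>
  interpret holomorphic_coefficients \<Omega>' "\<lambda>x. \<phi> (inv_into V \<kappa> x)" "\<lambda>x. z (inv_into V \<kappa> x)" 0 R
    "\<lambda>j l y. F l j (inv_into W z y)"
  proof (intro holomorphic_coefficients.intro holomorphic_coefficients_axioms.intro)
    show "independent_differentials \<Omega>' (\<lambda>x. \<phi> (inv_into V \<kappa> x))"
      by (rule independent_differentials_subset[OF fr(5) \<Omega>' \<Omega>'\<Omega>])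
    show "smooth_on \<Omega>' (\<lambda>x. z (inv_into V \<kappa> x))" by (rule smooth_on_subset[OF fr(6) \<Omega>'\<Omega>])
    show "(\<lambda>x. z (inv_into V \<kappa> x)) ` \<Omega>' \<subseteq> ball 0 R" using pt by fastforce
    show "holo_on (ball 0 R) (\<lambda>y. F l j (inv_into W z y))" for l j
      using YF(1) by (intro holR[OF _ YF(2) YA(4)]) (simp add: nbhd_def)
    fix x b l assume x: "x \<in> \<Omega>'" and b: "b \<in> (Basis :: (real^'k) set)"
    obtain q where q: "x = \<kappa> q" "inv_into V \<kappa> x = q" "q \<in> N1" "inv_into W z (z q) = q" using pt[OF x] by blast
    have "q \<in> N' l j" for j using q(3) by (auto simp: N1_def)
    then have "C l j x = F l j (inv_into W z (z (inv_into V \<kappa> x)))" for j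
      using YF(5) q by simp
    then show "ddir (\<lambda>x. z (inv_into V \<kappa> x) $ l) b x = (\<Sum>j\<in>UNIV. F l j (inv_into W z (z (inv_into V \<kappa> x))) *
        ddir (\<lambda>x. \<phi> (inv_into V \<kappa> x) $ j) b x)"
      using fr(8)[of x b l] x \<Omega>'\<Omega> b by auto
  qed
  have base: "z (inv_into V \<kappa> (\<kappa> p\<^sub>0)) = 0" "\<phi> (inv_into V \<kappa> (\<kappa> p\<^sub>0)) = 0" by (simp_all add: inv0 zp0 phi_p0)
  have "holo_on (ball 0 R) (\<lambda>y. f (inv_into W z y))"
    using Y by (intro holR[OF _ f YA(3)]) (simp add: nbhd_def)
  from factors_through_coordinates[OF x0 base(1) this] obtain h r \<rho> where h: "r > 0" "\<rho> > 0" "holo_on (ball 0 r) h"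
    "ball (\<kappa> p\<^sub>0) \<rho> \<subseteq> \<Omega>'"
    "\<And>x. x \<in> ball (\<kappa> p\<^sub>0) \<rho> \<Longrightarrow> \<phi> (inv_into V \<kappa> x) \<in> ball 0 r \<and> f (inv_into W z (z (inv_into V \<kappa> x))) = h (\<phi> (inv_into V \<kappa> x))"
    unfolding base by blast
  define N where "N = V \<inter> \<kappa> -` ball (\<kappa> p\<^sub>0) \<rho>"
  have qN: "\<kappa> q \<in> ball (\<kappa> p\<^sub>0) \<rho>" "inv_into V \<kappa> (\<kappa> q) = q" "q \<in> N1" "inv_into W z (z q) = q" "z q \<in> ball 0 R" if "q \<in> N" for q
  proof -
    show k: "\<kappa> q \<in> ball (\<kappa> p\<^sub>0) \<rho>" and i: "inv_into V \<kappa> (\<kappa> q) = q"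
      using that inv_into_f_f[OF inj] by (auto simp: N_def)
    have "\<kappa> q \<in> \<Omega>'" using k h(4) by blast
    from pt[OF this] show "q \<in> N1" "inv_into W z (z q) = q" "z q \<in> ball 0 R" using i by auto
  qed
  show ?thesis
  proof (rule that[OF h(1,3)])
    show "nbhd M p\<^sub>0 N"
      using chart_preimage_open[OF c open_ball] fr(2) h(2) by (auto simp: N_def nbhd_def)
    show "N \<subseteq> U \<inter> Y"
    proof
      fix q assume q: "q \<in> N"
      have qW: "q \<in> W" "q \<in> U" using qN(3)[OF q] N0(4) by (auto simp: N1_def)
      have "z q \<in> z ` (YA \<inter> W)" using qN(5)[OF q] R(2) by blast
      then have "q \<in> YA" using qW(1) inj_z by (auto simp: inj_on_def)
      then show "q \<in> U \<inter> Y" using qW(2) YA(3) by blast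
    qed
    show "\<phi> q \<in> ball 0 r \<and> f q = h (\<phi> q)" if "q \<in> N" for q
      using h(5)[OF qN(1)[OF that]] by (simp only: qN(2,4)[OF that])
  qed
qed

end

section \<open>Germs\<close>

text \<open>One treatment for functions on \<open>X\<close>, functions on \<open>\<C>^n\<close> and
  CR sections: \<open>ag\<close> need only be an equivalence on each set that is inherited by
  subsets, so equality tested on test functions is covered as well.\<close>

locale germs =
  fixes Y :: "'y::topological_space set" and S :: "'y set \<Rightarrow> 's set"
    and ag :: "'y set \<Rightarrow> 's \<Rightarrow> 's \<Rightarrow> bool" and p :: 'y
  assumes ag_refl: "ag V s s" and ag_sym: "ag V s t \<Longrightarrow> ag V t s"
    and ag_trans: "ag V s t \<Longrightarrow> ag V t u \<Longrightarrow> ag V s u" and ag_mono: "ag V s t \<Longrightarrow> V' \<subseteq> V \<Longrightarrow> ag V' s t"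
begin

abbreviation "LS \<equiv> local_sections Y S p"
abbreviation "R \<equiv> germ_rel Y S ag p"

lemma relI:
  "(U, s) \<in> LS \<Longrightarrow> (V, t) \<in> LS \<Longrightarrow> nbhd Y p N \<Longrightarrow> N \<subseteq> U \<inter> V \<Longrightarrow> ag N s t \<Longrightarrow> ((U, s), (V, t)) \<in> R"
  unfolding germ_rel_def by blast

lemma relE:
  assumes "((U, s), (V, t)) \<in> R"
  obtains N where "(U, s) \<in> LS" "(V, t) \<in> LS" "nbhd Y p N" "N \<subseteq> U \<inter> V" "ag N s t"
  using assms unfolding germ_rel_def by blast

lemma equiv_R: "equiv LS R"
proof (rule equivI)
  show "R \<subseteq> LS \<times> LS" by (auto simp: germ_rel_def)
  show "refl_on LS R"
  proof (rule refl_onI)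
    fix x assume x: "x \<in> LS"
    obtain U s where "x = (U, s)" by fastforce
    moreover have "nbhd Y p U" using x \<open>x = (U, s)\<close> by (simp add: local_sections_def)
    ultimately show "(x, x) \<in> R" using x ag_refl by (auto intro: relI)
  qed
  show "sym R"
  proof (rule symI)
    fix x y assume xy: "(x, y) \<in> R"
    obtain U s V t where e: "x = (U, s)" "y = (V, t)" by (metis surj_pair)
    obtain N where N: "(U, s) \<in> LS" "(V, t) \<in> LS" "nbhd Y p N" "N \<subseteq> U \<inter> V" "ag N s t"
      using xy unfolding e by (rule relE)
    show "(y, x) \<in> R" unfolding e
      by (rule relI[OF N(2,1,3) _ ag_sym[OF N(5)]]) (use N(4) in auto)
  qed
  show "trans R"
  proof (rule transI)
    fix x y w assume xy: "(x, y) \<in> R" and yw: "(y, w) \<in> R"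
    obtain U s V t T u where e: "x = (U, s)" "y = (V, t)" "w = (T, u)" by (metis surj_pair)
    obtain N where N: "(U, s) \<in> LS" "nbhd Y p N" "N \<subseteq> U \<inter> V" "ag N s t" using xy unfolding e by (rule relE)
    obtain N' where N': "(T, u) \<in> LS" "nbhd Y p N'" "N' \<subseteq> V \<inter> T" "ag N' t u" using yw unfolding e by (rule relE)
    show "(x, w) \<in> R" unfolding e
    proof (rule relI[OF N(1) N'(1) nbhd_Int[OF N(2) N'(2)]])
      show "ag (N \<inter> N') s u" by (rule ag_trans[OF ag_mono[OF N(4)] ag_mono[OF N'(4)]]) auto
    qed (use N(3) N'(3) in auto)
  qed
qed

lemma stalkI: "x \<in> LS \<Longrightarrow> R `` {x} \<in> stalk Y S ag p"
  unfolding stalk_def by (rule quotientI)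

lemma stalkE:
  assumes "G \<in> stalk Y S ag p"
  obtains U s where "(U, s) \<in> LS" "G = R `` {(U, s)}"
  using assms unfolding stalk_def by (auto elim!: quotientE)

lemma class_eq: "(x, y) \<in> R \<Longrightarrow> R `` {x} = R `` {y}"
  by (rule equiv_class_eq[OF equiv_R])

lemma class_eqD: "R `` {x} = R `` {y} \<Longrightarrow> y \<in> LS \<Longrightarrow> (x, y) \<in> R"
  by (rule eq_equiv_class[OF _ equiv_R])

lemma self_in_class: "x \<in> LS \<Longrightarrow> x \<in> R `` {x}"
  by (rule equiv_class_self[OF equiv_R])

text \<open>\<open>germ_map\<close> and \<open>germ_op\<close> take unions over all representatives,
  including pairs whose image is not known to be a local section of the target. Such images
  contribute the empty set, so it suffices that one representative has a good image.\<close>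

lemma class_empty: "x \<notin> LS \<Longrightarrow> R `` {x} = {}"
  by (auto simp: germ_rel_def)

lemma germ_op_class:
  assumes s: "(U, s) \<in> LS" and t: "(V, t) \<in> LS" and st: "(U \<inter> V, opn s t) \<in> LS"
    and cong: "\<And>N s' t'. ag N s s' \<Longrightarrow> ag N t t' \<Longrightarrow> ag N (opn s t) (opn s' t')"
  shows "germ_op R opn (R `` {(U, s)}) (R `` {(V, t)}) = R `` {(U \<inter> V, opn s t)}"
proof -
  have eq: "R `` {(U' \<inter> V', opn s' t')} = R `` {(U \<inter> V, opn s t)}"
    if r: "((U, s), (U', s')) \<in> R" "((V, t), (V', t')) \<in> R" and l: "(U' \<inter> V', opn s' t') \<in> LS" for U' s' V' t'
  proof -
    obtain N where N: "nbhd Y p N" "N \<subseteq> U \<inter> U'" "ag N s s'" using r(1) by (rule relE)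
    obtain N' where N': "nbhd Y p N'" "N' \<subseteq> V \<inter> V'" "ag N' t t'" using r(2) by (rule relE)
    have "ag (N \<inter> N') (opn s t) (opn s' t')"
      by (rule cong[OF ag_mono[OF N(3)] ag_mono[OF N'(3)]]) auto
    then have "((U \<inter> V, opn s t), (U' \<inter> V', opn s' t')) \<in> R"
      by (rule relI[OF st l nbhd_Int[OF N(1) N'(1)], rotated]) (use N(2) N'(2) in auto)
    from class_eq[OF this] show ?thesis by simp
  qed
  show ?thesis
  proof (intro equalityI subsetI)
    fix x assume "x \<in> germ_op R opn (R `` {(U, s)}) (R `` {(V, t)})"
    then obtain U' s' V' t' where h: "((U, s), (U', s')) \<in> R" "((V, t), (V', t')) \<in> R" "x \<in> R `` {(U' \<inter> V', opn s' t')}"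
      unfolding germ_op_def by fast
    moreover have "(U' \<inter> V', opn s' t') \<in> LS" using h(3) class_empty by blast
    ultimately show "x \<in> R `` {(U \<inter> V, opn s t)}" using eq by blast
  next
    fix x assume "x \<in> R `` {(U \<inter> V, opn s t)}"
    then show "x \<in> germ_op R opn (R `` {(U, s)}) (R `` {(V, t)})"
      unfolding germ_op_def using self_in_class[OF s] self_in_class[OF t] by fast
  qed
qed

end

lemma germ_map_class:
  assumes "germs ag" "germs ag'"
    and s: "(U, s) \<in> local_sections Y S p" and \<beta>s: "(\<alpha> U, \<beta> s) \<in> local_sections Y' S' p'"
    and cong: "\<And>V t N. nbhd Y p N \<Longrightarrow> N \<subseteq> U \<inter> V \<Longrightarrow> ag N s t \<Longrightarrow>
      \<exists>N'. nbhd Y' p' N' \<and> N' \<subseteq> \<alpha> U \<inter> \<alpha> V \<and> ag' N' (\<beta> s) (\<beta> t)"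
  shows "germ_map (germ_rel Y' S' ag' p') \<alpha> \<beta> (germ_rel Y S ag p `` {(U, s)})
    = germ_rel Y' S' ag' p' `` {(\<alpha> U, \<beta> s)}"
proof -
  interpret src: germs Y S ag p by (rule assms(1))
  interpret tgt: germs Y' S' ag' p' by (rule assms(2))
  have eq: "tgt.R `` {(\<alpha> V, \<beta> t)} = tgt.R `` {(\<alpha> U, \<beta> s)}"
    if r: "((U, s), (V, t)) \<in> src.R" and l: "(\<alpha> V, \<beta> t) \<in> tgt.LS" for V t
  proof -
    obtain N where "nbhd Y p N" "N \<subseteq> U \<inter> V" "ag N s t" using r by (rule src.relE)
    from cong[OF this] obtain N' where "nbhd Y' p' N'" "N' \<subseteq> \<alpha> U \<inter> \<alpha> V" "ag' N' (\<beta> s) (\<beta> t)" by blast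
    then have "((\<alpha> U, \<beta> s), (\<alpha> V, \<beta> t)) \<in> tgt.R" by (rule tgt.relI[OF \<beta>s l])
    from tgt.class_eq[OF this] show ?thesis by simp
  qed
  show ?thesis
  proof (intro equalityI subsetI)
    fix x assume "x \<in> germ_map tgt.R \<alpha> \<beta> (src.R `` {(U, s)})"
    then obtain V t where h: "((U, s), (V, t)) \<in> src.R" "x \<in> tgt.R `` {(\<alpha> V, \<beta> t)}"
      unfolding germ_map_def by fast
    moreover have "(\<alpha> V, \<beta> t) \<in> tgt.LS" using h(2) tgt.class_empty by blast
    ultimately show "x \<in> tgt.R `` {(\<alpha> U, \<beta> s)}" using eq by blast
  next
    fix x assume "x \<in> tgt.R `` {(\<alpha> U, \<beta> s)}"
    then show "x \<in> germ_map tgt.R \<alpha> \<beta> (src.R `` {(U, s)})"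
      unfolding germ_map_def using src.self_in_class[OF s] by fast
  qed
qed

lemma germs_fun_agree: "germs fun_agree"
  by standard (auto simp: fun_agree_def)

lemma germs_sec_agree: "germs (sec_agree B)"
proof
  show "sec_agree B V s s" for V s by (cases s) (auto simp: fun_agree_def)
  show "sec_agree B V s t \<Longrightarrow> sec_agree B V t s" for V s t
    by (cases s; cases t; auto simp: fun_agree_def; fastforce)
  show "sec_agree B V s t \<Longrightarrow> sec_agree B V t u \<Longrightarrow> sec_agree B V s u" for V s t u
    by (cases s; cases t; cases u; auto simp: fun_agree_def; fastforce)
  show "sec_agree B V' s t" if ag: "sec_agree B V s t" and sub: "V' \<subseteq> V" for V V' s t
  proof (cases s; cases t)
    fix u w assume st: "s = Ds u" "t = Ds w"
    have "u (V1, \<kappa>) \<psi> = w (V1, \<kappa>) \<psi>" if V1: "(V1, \<kappa>) \<in> B" and \<psi>: "\<psi> \<in> test_fun (\<kappa> ` (V' \<inter> V1))" for V1 \<kappa> \<psi>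
    proof -
      have "\<psi> \<in> test_fun (\<kappa> ` (V \<inter> V1))" by (rule test_fun_mono[OF \<psi>]) (use sub in auto)
      then show ?thesis using ag V1 st by auto
    qed
    then show ?thesis using st by auto
  qed (use ag sub in \<open>auto simp: fun_agree_def\<close>)
qed

section \<open>Sums, scalar multiples and products of sections\<close>

lemma distribution_on_add:
  assumes u: "distribution_on \<Omega> u" and w: "distribution_on \<Omega> w"
  shows "distribution_on \<Omega> (\<lambda>\<psi>. u \<psi> + w \<psi>)"
  unfolding distribution_on_def
proof (intro conjI ballI allI impI)
  show "u (\<lambda>x. \<psi> x + \<eta> x) + w (\<lambda>x. \<psi> x + \<eta> x) = u \<psi> + w \<psi> + (u \<eta> + w \<eta>)"
    if "\<psi> \<in> test_fun \<Omega>" "\<eta> \<in> test_fun \<Omega>" for \<psi> \<eta>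
    using u w that by (simp add: distribution_on_def)
  show "u (\<lambda>x. c * \<psi> x) + w (\<lambda>x. c * \<psi> x) = c * (u \<psi> + w \<psi>)" if "\<psi> \<in> test_fun \<Omega>" for c \<psi>
    using u w that by (simp add: distribution_on_def distrib_left)
  fix K assume K: "compact K \<and> K \<subseteq> \<Omega>"
  obtain C N where CN: "\<forall>\<psi>\<in>test_fun K. \<forall>b. (\<forall>bs\<in>lists Basis. length bs \<le> N \<longrightarrow> (\<forall>x. cmod (iter_deriv bs \<psi> x) \<le> b)) \<longrightarrow> cmod (u \<psi>) \<le> C * b"
    using u[unfolded distribution_on_def, THEN conjunct2, THEN conjunct2, THEN spec, of K, THEN mp, OF K]
    by (elim exE) (rule that)
  obtain C' N' where CN': "\<forall>\<psi>\<in>test_fun K. \<forall>b. (\<forall>bs\<in>lists Basis. length bs \<le> N' \<longrightarrow> (\<forall>x. cmod (iter_deriv bs \<psi> x) \<le> b)) \<longrightarrow> cmod (w \<psi>) \<le> C' * b"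
    using w[unfolded distribution_on_def, THEN conjunct2, THEN conjunct2, THEN spec, of K, THEN mp, OF K]
    by (elim exE) (rule that)
  show "\<exists>C N. \<forall>\<psi>\<in>test_fun K. \<forall>b. (\<forall>bs\<in>lists Basis. length bs \<le> N \<longrightarrow> (\<forall>x. cmod (iter_deriv bs \<psi> x) \<le> b)) \<longrightarrow> cmod (u \<psi> + w \<psi>) \<le> C * b"
  proof (intro exI ballI allI impI)
    fix \<psi> b assume \<psi>: "\<psi> \<in> test_fun K"
      and b: "\<forall>bs\<in>lists Basis. length bs \<le> max N N' \<longrightarrow> (\<forall>x. cmod (iter_deriv bs \<psi> x) \<le> b)"
    have "cmod (u \<psi>) \<le> C * b" "cmod (w \<psi>) \<le> C' * b" using CN CN' \<psi> b by auto
    then show "cmod (u \<psi> + w \<psi>) \<le> (C + C') * b"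
      using norm_triangle_ineq[of "u \<psi>" "w \<psi>"] by (simp add: distrib_right)
  qed
qed

context cr_submanifold_of
begin

text \<open>For distributions, the integral of a sum is split by means of integrability, which is
  available for test functions supported over \<open>U\<close>. The sum of the two sections is
  therefore shown to agree over \<open>U\<close> with the section of the sum, rather than to be
  equal to it.\<close>

lemma sec_add_section:
  assumes U: "openin (top_of_set M) U" and f: "cr_function U f" and g: "cr_function U g"
  shows "sec_add (sec_of_fun a f) (sec_of_fun a g) \<in> cr_sections X A M B a U"
    and "sec_agree B U (sec_of_fun a (\<lambda>q. f q + g q)) (sec_add (sec_of_fun a f) (sec_of_fun a g))"
proof -
  have sf: "smooth_fun B U f" and sg: "smooth_fun B U g" using f g by (auto simp: cr_function_def)
  have fg: "cr_function U (\<lambda>q. f q + g q)"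
    unfolding cr_function_def
  proof (intro conjI ballI)
    show "smooth_fun B U (\<lambda>q. f q + g q)" by (rule smooth_fun_add[OF U sf sg])
    fix q v assume q: "q \<in> U" and v: "v \<in> cr_bundle X A M B q"
    have "v (\<lambda>q. f q + g q) = v f + v g"
      by (rule ctangentD(1)[OF cr_bundle_ctangent[OF v] smooth_near_if[OF U sf q] smooth_near_if[OF U sg q]])
    moreover have "v f = 0" "v g = 0" using f g q v unfolding cr_function_def by blast+
    ultimately show "v (\<lambda>q. f q + g q) = 0" by simp
  qed
  have "Ds (\<lambda>\<kappa> \<psi>. mdistr_of_fun f \<kappa> \<psi> + mdistr_of_fun g \<kappa> \<psi>) \<in> cr_sections X A M B Distributional U"
  proof -
    have "mdistribution B U (mdistr_of_fun f)" "mdistribution B U (mdistr_of_fun g)"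
      by (rule mdistribution_of_fun[OF U sf], rule mdistribution_of_fun[OF U sg])
    then have "mdistribution B U (\<lambda>\<kappa> \<psi>. mdistr_of_fun f \<kappa> \<psi> + mdistr_of_fun g \<kappa> \<psi>)"
      unfolding mdistribution_def by (fastforce intro: distribution_on_add)
    moreover have "weakly_annihilates B U Z (mdistr_of_fun f)" "weakly_annihilates B U Z (mdistr_of_fun g)"
      if "Z \<in> bundle_sections M B (cr_bundle X A M B) U" for Z
      using cr_function_section[OF U f, of Distributional] cr_function_section[OF U g, of Distributional] that by auto
    ultimately show ?thesis by (fastforce simp: weakly_annihilates_def)
  qed
  then show "sec_add (sec_of_fun a f) (sec_of_fun a g) \<in> cr_sections X A M B a U"
    using cr_function_section[OF U fg, of a] by (cases a) auto
  have "mdistr_of_fun (\<lambda>q. f q + g q) (V, \<kappa>) \<psi> = mdistr_of_fun f (V, \<kappa>) \<psi> + mdistr_of_fun g (V, \<kappa>) \<psi>"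
    if V: "(V, \<kappa>) \<in> B" and \<psi>: "\<psi> \<in> test_fun (\<kappa> ` (U \<inter> V))" for V \<kappa> \<psi>
    using integrable_times_test_fun[OF chart_smooth(1,3)[OF U sf V] \<psi>]
      integrable_times_test_fun[OF chart_smooth(1,3)[OF U sg V] \<psi>]
    by (simp add: mdistr_of_fun_def distrib_right)
  then show "sec_agree B U (sec_of_fun a (\<lambda>q. f q + g q)) (sec_add (sec_of_fun a f) (sec_of_fun a g))"
    by (cases a) (auto simp: fun_agree_def)
qed

end

text \<open>A true equality, since the integral commutes with scalar factors without any
  integrability condition.\<close>

lemma sec_scale_of_fun: "sec_scale c (sec_of_fun a f) = sec_of_fun a (\<lambda>q. c * f q)"
  by (cases a) (auto simp: mdistr_of_fun_def mult.assoc fun_eq_iff)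

lemma sec_agree_add:
  "sec_agree B V (sec_of_fun a f) s \<Longrightarrow> sec_agree B V (sec_of_fun a g) t \<Longrightarrow>
    sec_agree B V (sec_add (sec_of_fun a f) (sec_of_fun a g)) (sec_add s t)"
  by (cases a; cases s; cases t; auto simp: fun_agree_def; fastforce)

lemma sec_agree_scale: "sec_agree B V s t \<Longrightarrow> sec_agree B V (sec_scale c s) (sec_scale c t)"
  by (cases s; cases t; auto simp: fun_agree_def; fastforce)

lemma sec_agree_mult:
  "a \<noteq> Distributional \<Longrightarrow> sec_agree B V (sec_of_fun a f) s \<Longrightarrow> sec_agree B V (sec_of_fun a g) t \<Longrightarrow>
    sec_agree B V (sec_mult (sec_of_fun a f) (sec_of_fun a g)) (sec_mult s t)"
  by (cases a; cases s; cases t) (auto simp: fun_agree_def)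

section \<open>Restriction and pullback as maps between stalks\<close>

context cr_embedding
begin

context
  fixes a :: regularity
begin

interpretation GX: germs X "\<lambda>U. {f. holo_fun A U f}" fun_agree p\<^sub>0 by (rule germs_fun_agree)
interpretation GC: germs "UNIV :: (complex^'n) set" "\<lambda>D. {g. holo_on D g}" fun_agree 0 by (rule germs_fun_agree)
interpretation GM: germs M "cr_sections X A M B a" "sec_agree B" p\<^sub>0 by (rule germs_sec_agree)

abbreviation "pullback \<equiv> pullback_map X A M B a p\<^sub>0 U \<phi>"
abbreviation "restriction \<equiv> restriction_map X A M B a p\<^sub>0"
abbreviation "cr_germs \<equiv> cr_stalk X A M B a p\<^sub>0"
abbreviation "X_germs \<equiv> holo_stalk X A p\<^sub>0"
abbreviation "C_germs \<equiv> Cn_stalk (0 :: complex^'n)"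

lemma section_class: "nbhd M p\<^sub>0 N \<Longrightarrow> cr_function N f \<Longrightarrow> (N, sec_of_fun a f) \<in> GM.LS"
  using cr_function_section by (auto simp: local_sections_def nbhd_def)

lemma GX_LS: "(Y, f) \<in> GX.LS \<longleftrightarrow> nbhd X p\<^sub>0 Y \<and> holo_fun A Y f"
  by (simp add: local_sections_def)

lemma GC_LS: "(D, g) \<in> GC.LS \<longleftrightarrow> open D \<and> 0 \<in> D \<and> holo_on D g"
  by (simp add: local_sections_def nbhd_def)

lemma restriction_class:
  assumes "(Y, f) \<in> GX.LS"
  shows "(M \<inter> Y, sec_of_fun a f) \<in> GM.LS"
    and "restriction (GX.R `` {(Y, f)}) = GM.R `` {(M \<inter> Y, sec_of_fun a f)}"
proof -
  have Y: "nbhd X p\<^sub>0 Y" "holo_fun A Y f" using assms GX_LS by auto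
  show l: "(M \<inter> Y, sec_of_fun a f) \<in> GM.LS"
  proof (rule section_class)
    show n: "nbhd M p\<^sub>0 (M \<inter> Y)" by (rule nbhd_restrict[OF Y(1) M_subset p0M])
    show "cr_function (M \<inter> Y) f"
      using Y(1) n by (intro cr_function_holo[OF _ Y(2)]) (auto simp: nbhd_def)
  qed
  show "restriction (GX.R `` {(Y, f)}) = GM.R `` {(M \<inter> Y, sec_of_fun a f)}"
    unfolding restriction_map_def cr_germ_rel_def
  proof (rule germ_map_class[OF germs_fun_agree germs_sec_agree assms])
    show "(M \<inter> Y, sec_of_fun a f) \<in> GM.LS" by (rule l)
    fix V t N assume N: "nbhd X p\<^sub>0 N" "N \<subseteq> Y \<inter> V" "fun_agree N f t"
    have "sec_agree B (M \<inter> N) (sec_of_fun a f) (sec_of_fun a t)"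
      by (rule sec_agree_of_fun) (use N(3) in \<open>auto simp: fun_agree_def\<close>)
    then show "\<exists>N'. nbhd M p\<^sub>0 N' \<and> N' \<subseteq> M \<inter> Y \<inter> (M \<inter> V) \<and> sec_agree B N' (sec_of_fun a f) (sec_of_fun a t)"
      using nbhd_restrict[OF N(1) M_subset p0M] N(2) by blast
  qed
qed

lemma pullback_nbhd:
  assumes "open D" "0 \<in> D"
  shows "nbhd M p\<^sub>0 (U \<inter> \<phi> -` D)"
proof -
  have "openin (top_of_set M) (U \<inter> (M \<inter> (W \<inter> \<phi> -` D)))"
    using U_open openin_restrict[OF phi_preimage_open[OF assms(1)] M_subset] by blast
  moreover have "U \<inter> (M \<inter> (W \<inter> \<phi> -` D)) = U \<inter> \<phi> -` D" using U(2) by blast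
  ultimately show ?thesis using assms(2) phi_p0 nbhd_mem[OF U(1)] by (simp add: nbhd_def)
qed

lemma pullback_cr_function:
  assumes D: "open D" "0 \<in> D" and g: "holo_on D g"
  shows "cr_function (U \<inter> \<phi> -` D) (g \<circ> \<phi>)"
  unfolding o_def
  by (rule cr_function_holo[OF phi_preimage_open[OF D(1)] pullback_holo[OF D(1) g]])
     (use pullback_nbhd[OF D] U(2) in \<open>auto simp: nbhd_def\<close>)

lemma pullback_class:
  assumes "(D, g) \<in> GC.LS"
  shows "(U \<inter> \<phi> -` D, sec_of_fun a (g \<circ> \<phi>)) \<in> GM.LS"
    and "pullback (GC.R `` {(D, g)}) = GM.R `` {(U \<inter> \<phi> -` D, sec_of_fun a (g \<circ> \<phi>))}"
proof -
  have D: "open D" "0 \<in> D" and g: "holo_on D g" using assms GC_LS by auto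
  show l: "(U \<inter> \<phi> -` D, sec_of_fun a (g \<circ> \<phi>)) \<in> GM.LS"
    by (rule section_class[OF pullback_nbhd[OF D] pullback_cr_function[OF D g]])
  show "pullback (GC.R `` {(D, g)}) = GM.R `` {(U \<inter> \<phi> -` D, sec_of_fun a (g \<circ> \<phi>))}"
    unfolding pullback_map_def cr_germ_rel_def
  proof (rule germ_map_class[OF germs_fun_agree germs_sec_agree assms])
    show "(U \<inter> \<phi> -` D, sec_of_fun a (g \<circ> \<phi>)) \<in> GM.LS" by (rule l)
    fix V t N assume N: "nbhd UNIV 0 N" "N \<subseteq> D \<inter> V" "fun_agree N g t"
    have "sec_agree B (U \<inter> \<phi> -` N) (sec_of_fun a (g \<circ> \<phi>)) (sec_of_fun a (t \<circ> \<phi>))"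
      by (rule sec_agree_of_fun) (use N(3) in \<open>auto simp: fun_agree_def\<close>)
    moreover have "nbhd M p\<^sub>0 (U \<inter> \<phi> -` N)" by (rule pullback_nbhd) (use N(1) in \<open>auto simp: nbhd_def\<close>)
    ultimately show "\<exists>N'. nbhd M p\<^sub>0 N' \<and> N' \<subseteq> U \<inter> \<phi> -` D \<inter> (U \<inter> \<phi> -` V) \<and>
        sec_agree B N' (sec_of_fun a (g \<circ> \<phi>)) (sec_of_fun a (t \<circ> \<phi>))"
      using N(2) by blast
  qed
qed

text \<open>Turns equality of germs of any regularity into equality of functions near
  \<open>p\<^sub>0\<close> when both germs come from smooth CR functions.\<close>

lemma section_rel_funD:
  assumes f: "cr_function N1 f" and g: "cr_function N2 g"
    and r: "((N1, sec_of_fun a f), (N2, sec_of_fun a g)) \<in> GM.R"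
  obtains N where "nbhd M p\<^sub>0 N" "N \<subseteq> N1 \<inter> N2" "\<And>q. q \<in> N \<Longrightarrow> f q = g q"
proof -
  obtain N where N: "nbhd M p\<^sub>0 N" "N \<subseteq> N1 \<inter> N2" "sec_agree B N (sec_of_fun a f) (sec_of_fun a g)"
    using r by (rule GM.relE)
  have "f q = g q" if "q \<in> N" for q
  proof (rule sec_agree_of_funD[OF _ _ _ N(3) that])
    show "openin (top_of_set M) N" using N(1) by (simp add: nbhd_def)
    show "smooth_fun B N f" "smooth_fun B N g"
      using f g N(2) by (auto simp: cr_function_def intro: smooth_fun_subset)
  qed
  then show ?thesis using that N by blast
qed

lemma restriction_in_stalk: "G \<in> X_germs \<Longrightarrow> restriction G \<in> cr_germs"
  unfolding holo_stalk_def cr_stalk_def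
  by (erule GX.stalkE) (auto simp: restriction_class intro!: GM.stalkI)

lemma pullback_in_stalk: "G \<in> C_germs \<Longrightarrow> pullback G \<in> cr_germs"
  unfolding Cn_stalk_def cr_stalk_def
  by (erule GC.stalkE) (auto simp: pullback_class intro!: GM.stalkI)

lemma pullback_inj: "inj_on pullback C_germs"
proof (rule inj_onI)
  fix G H assume G: "G \<in> C_germs" and H: "H \<in> C_germs"
    and eq: "pullback G = pullback H"
  obtain D g where g: "(D, g) \<in> GC.LS" "G = GC.R `` {(D, g)}" using G unfolding Cn_stalk_def by (rule GC.stalkE)
  obtain E h where h: "(E, h) \<in> GC.LS" "H = GC.R `` {(E, h)}" using H unfolding Cn_stalk_def by (rule GC.stalkE)
  have D: "open D" "0 \<in> D" "holo_on D g" and E: "open E" "0 \<in> E" "holo_on E h" using g(1) h(1) GC_LS by auto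
  have "GM.R `` {(U \<inter> \<phi> -` D, sec_of_fun a (g \<circ> \<phi>))} = GM.R `` {(U \<inter> \<phi> -` E, sec_of_fun a (h \<circ> \<phi>))}"
    using eq g h by (simp add: pullback_class)
  from GM.class_eqD[OF this pullback_class(1)[OF h(1)]]
  obtain N where N: "nbhd M p\<^sub>0 N" "N \<subseteq> (U \<inter> \<phi> -` D) \<inter> (U \<inter> \<phi> -` E)" "\<And>q. q \<in> N \<Longrightarrow> (g \<circ> \<phi>) q = (h \<circ> \<phi>) q"
    by (rule section_rel_funD[OF pullback_cr_function[OF D] pullback_cr_function[OF E]]) (rule that)
  have hol: "holo_on (D \<inter> E) (\<lambda>y. g y - h y)"
    by (intro holo_on_diff holo_on_subset[OF D(3)] holo_on_subset[OF E(3)]) auto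
  have DE: "0 \<in> D \<inter> E" using D(2) E(2) by simp
  have zero: "g (\<phi> q) - h (\<phi> q) = 0" if "q \<in> N" for q using N(3)[OF that] by simp
  obtain r where r: "r > 0" "ball 0 r \<subseteq> D \<inter> E" "\<And>y. y \<in> ball 0 r \<Longrightarrow> g y - h y = 0"
    by (rule pullback_injective[OF open_Int[OF D(1) E(1)] DE hol N(1) zero]) (assumption, rule that)
  have "((D, g), (E, h)) \<in> GC.R"
    by (rule GC.relI[OF g(1) h(1), of "ball 0 r"]) (use r in \<open>auto simp: nbhd_def fun_agree_def\<close>)
  then show "G = H" using g(2) h(2) GC.class_eq by simp
qed

text \<open>Surjectivity is used twice: \<open>G\<close> itself comes from a holomorphic function on
  \<open>X\<close>, and so do the coefficients needed to factor that function through
  \<open>\<phi>\<close>.\<close>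

lemma onto_imp_pullback_onto:
  assumes onto: "restriction ` X_germs = cr_germs"
    and G: "G \<in> cr_germs"
  shows "G \<in> pullback ` C_germs"
proof -
  have rep: "\<exists>Y f. (Y, f) \<in> GX.LS \<and> G = GM.R `` {(M \<inter> Y, sec_of_fun a f)}" if "G \<in> cr_germs" for G
  proof -
    obtain H where H: "H \<in> X_germs" "G = restriction H"
      using \<open>G \<in> cr_germs\<close>[folded onto] by blast
    obtain Y f where f: "(Y, f) \<in> GX.LS" "H = GX.R `` {(Y, f)}"
      using H(1) unfolding holo_stalk_def by (rule GX.stalkE)
    then show ?thesis using H(2) restriction_class(2)[OF f(1)] by auto
  qed
  have crY: "cr_function (M \<inter> Y) f" if "(Y, f) \<in> GX.LS" for Y f
    using that nbhd_restrict[OF _ M_subset p0M, of Y]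
    by (intro cr_function_holo[of Y]) (auto simp: GX_LS nbhd_def)
  \<comment> \<open>Surjectivity restated for functions: a smooth CR function defines a germ of
    regularity \<open>a\<close>, this germ has a holomorphic preimage, and equality of the germs is
    pointwise equality near \<open>p\<^sub>0\<close>.\<close>
  have extend: "\<exists>Y F N'. nbhd X p\<^sub>0 Y \<and> holo_fun A Y F \<and> nbhd M p\<^sub>0 N' \<and> N' \<subseteq> N \<inter> Y \<and> (\<forall>q\<in>N'. c q = F q)"
    if N: "nbhd M p\<^sub>0 N" and c: "cr_function N c" for N c
  proof -
    have l: "(N, sec_of_fun a c) \<in> GM.LS" by (rule section_class[OF N c])
    then have "GM.R `` {(N, sec_of_fun a c)} \<in> cr_germs"
      unfolding cr_stalk_def by (rule GM.stalkI)
    then obtain Y F where F: "(Y, F) \<in> GX.LS" "GM.R `` {(N, sec_of_fun a c)} = GM.R `` {(M \<inter> Y, sec_of_fun a F)}"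
      using rep by blast
    from GM.class_eqD[OF F(2) restriction_class(1)[OF F(1)]]
    obtain N' where "nbhd M p\<^sub>0 N'" "N' \<subseteq> N \<inter> (M \<inter> Y)" "\<And>q. q \<in> N' \<Longrightarrow> c q = F q"
      by (rule section_rel_funD[OF c crY[OF F(1)]]) (rule that)
    then show ?thesis using F(1) unfolding GX_LS by blast
  qed
  obtain Y f where f: "(Y, f) \<in> GX.LS" "G = GM.R `` {(M \<inter> Y, sec_of_fun a f)}" using rep[OF G] by blast
  have Y: "nbhd X p\<^sub>0 Y" "holo_fun A Y f" using f(1) GX_LS by auto
  obtain h r N where h: "r > 0" "holo_on (ball 0 r) h" "nbhd M p\<^sub>0 N" "N \<subseteq> U \<inter> Y"
    "\<And>q. q \<in> N \<Longrightarrow> \<phi> q \<in> ball 0 r \<and> f q = h (\<phi> q)"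
    by (rule holo_restriction_factors[OF extend Y]) (assumption, assumption, rule that)
  have hl: "(ball 0 r, h) \<in> GC.LS" using h(1,2) GC_LS by simp
  have "((M \<inter> Y, sec_of_fun a f), (U \<inter> \<phi> -` ball 0 r, sec_of_fun a (h \<circ> \<phi>))) \<in> GM.R"
  proof (rule GM.relI[OF restriction_class(1)[OF f(1)] pullback_class(1)[OF hl] h(3)])
    show "N \<subseteq> (M \<inter> Y) \<inter> (U \<inter> \<phi> -` ball 0 r)" using h(4,5) U(2) by blast
    show "sec_agree B N (sec_of_fun a f) (sec_of_fun a (h \<circ> \<phi>))"
      by (rule sec_agree_of_fun) (use h(5) in simp)
  qed
  then have "G = pullback (GC.R `` {(ball 0 r, h)})"
    using f(2) pullback_class(2)[OF hl] GM.class_eq by simp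
  moreover have "GC.R `` {(ball 0 r, h)} \<in> C_germs" unfolding Cn_stalk_def by (rule GC.stalkI[OF hl])
  ultimately show ?thesis by blast
qed

lemma pullback_onto_imp_onto:
  assumes onto: "pullback ` C_germs = cr_germs"
  shows "restriction ` X_germs = cr_germs"
proof (intro equalityI subsetI)
  fix G assume "G \<in> cr_germs"
  then obtain H where H: "H \<in> C_germs" "G = pullback H" using onto by blast
  obtain D g where g: "(D, g) \<in> GC.LS" "H = GC.R `` {(D, g)}" using H(1) unfolding Cn_stalk_def by (rule GC.stalkE)
  have D: "open D" "0 \<in> D" "holo_on D g" using g(1) GC_LS by auto
  \<comment> \<open>\<open>\<phi>\<close> is given by coordinates on the neighbourhood
    \<open>W\<close> in \<open>X\<close>, so the same formula extends the pullback off
    \<open>M\<close> to a holomorphic function.\<close>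
  have Y: "(W \<inter> \<phi> -` D, g \<circ> \<phi>) \<in> GX.LS"
    using phi_preimage_open[OF D(1)] pullback_holo[OF D(1,3)] p0W phi_p0 D(2)
    by (auto simp: GX_LS nbhd_def o_def)
  have "((U \<inter> \<phi> -` D, sec_of_fun a (g \<circ> \<phi>)), (M \<inter> (W \<inter> \<phi> -` D), sec_of_fun a (g \<circ> \<phi>))) \<in> GM.R"
    by (rule GM.relI[OF pullback_class(1)[OF g(1)] restriction_class(1)[OF Y] pullback_nbhd[OF D(1,2)] _ GM.ag_refl])
       (use U(2) in auto)
  then have "G = restriction (GX.R `` {(W \<inter> \<phi> -` D, g \<circ> \<phi>)})"
    using H(2) g(2) pullback_class(2)[OF g(1)] restriction_class(2)[OF Y] GM.class_eq by simp
  moreover have "GX.R `` {(W \<inter> \<phi> -` D, g \<circ> \<phi>)} \<in> X_germs"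
    unfolding holo_stalk_def by (rule GX.stalkI[OF Y])
  ultimately show "G \<in> restriction ` X_germs" by blast
qed (use restriction_in_stalk in blast)

text \<open>Serves both sums and products. \<open>sec\<close> asks for agreement instead of equality
  on account of sums of distributions. Its premise that \<open>op2\<close> of the two functions is a
  CR function holds here because these are pullbacks of holomorphic functions.\<close>

lemma pullback_op:
  assumes G: "G \<in> C_germs" and H: "H \<in> C_germs"
    and holo: "\<And>(D :: (complex^'n) set) f g. holo_on D f \<Longrightarrow> holo_on D g \<Longrightarrow> holo_on D (\<lambda>x. op2 (f x) (g x))"
    and sec: "\<And>N f g. openin (top_of_set M) N \<Longrightarrow> cr_function N f \<Longrightarrow> cr_function N g \<Longrightarrow>
        cr_function N (\<lambda>q. op2 (f q) (g q)) \<Longrightarrow> secop (sec_of_fun a f) (sec_of_fun a g) \<in> cr_sections X A M B a N \<and>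
        sec_agree B N (sec_of_fun a (\<lambda>q. op2 (f q) (g q))) (secop (sec_of_fun a f) (sec_of_fun a g))"
    and cong: "\<And>N f g s t. sec_agree B N (sec_of_fun a f) s \<Longrightarrow> sec_agree B N (sec_of_fun a g) t \<Longrightarrow>
        sec_agree B N (secop (sec_of_fun a f) (sec_of_fun a g)) (secop s t)"
  shows "pullback (germ_op GC.R (\<lambda>f g x. op2 (f x) (g x)) G H)
    = germ_op GM.R secop (pullback G) (pullback H)"
proof -
  obtain D g where g: "(D, g) \<in> GC.LS" "G = GC.R `` {(D, g)}" using G unfolding Cn_stalk_def by (rule GC.stalkE)
  obtain E h where h: "(E, h) \<in> GC.LS" "H = GC.R `` {(E, h)}" using H unfolding Cn_stalk_def by (rule GC.stalkE)
  have D: "open D" "0 \<in> D" "holo_on D g" and E: "open E" "0 \<in> E" "holo_on E h" using g(1) h(1) GC_LS by auto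
  have DE: "open (D \<inter> E)" "0 \<in> D \<inter> E" "holo_on (D \<inter> E) g" "holo_on (D \<inter> E) h"
    using D E by (auto intro: holo_on_subset)
  have gh: "(D \<inter> E, \<lambda>x. op2 (g x) (h x)) \<in> GC.LS" using DE(1,2) holo[OF DE(3,4)] by (simp add: GC_LS)
  have 1: "germ_op GC.R (\<lambda>f g x. op2 (f x) (g x)) G H = GC.R `` {(D \<inter> E, \<lambda>x. op2 (g x) (h x))}"
    unfolding g(2) h(2)
    by (rule GC.germ_op_class[OF g(1) h(1)]) (use gh in \<open>auto simp: fun_agree_def\<close>)
  let ?N = "U \<inter> \<phi> -` (D \<inter> E)"
  have N: "(U \<inter> \<phi> -` D) \<inter> (U \<inter> \<phi> -` E) = ?N" by auto
  note nb = pullback_nbhd[OF DE(1,2)]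
  have op: "openin (top_of_set M) ?N" using nb by (simp add: nbhd_def)
  have "cr_function ?N (\<lambda>q. op2 ((g \<circ> \<phi>) q) ((h \<circ> \<phi>) q))"
    using pullback_cr_function[OF DE(1,2) holo[OF DE(3,4)]] by (simp add: o_def)
  note sc = sec[OF op pullback_cr_function[OF DE(1,2,3)] pullback_cr_function[OF DE(1,2,4)] this]
  have l: "((U \<inter> \<phi> -` D) \<inter> (U \<inter> \<phi> -` E), secop (sec_of_fun a (g \<circ> \<phi>)) (sec_of_fun a (h \<circ> \<phi>))) \<in> GM.LS"
    unfolding N using sc nb by (simp add: local_sections_def o_def)
  have 2: "germ_op GM.R secop (pullback G) (pullback H)
    = GM.R `` {(?N, secop (sec_of_fun a (g \<circ> \<phi>)) (sec_of_fun a (h \<circ> \<phi>)))}"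
    unfolding g(2) h(2) pullback_class(2)[OF g(1)] pullback_class(2)[OF h(1)] N[symmetric]
    by (rule GM.germ_op_class[OF pullback_class(1)[OF g(1)] pullback_class(1)[OF h(1)]]) (rule l, rule cong)
  have "((?N, sec_of_fun a ((\<lambda>x. op2 (g x) (h x)) \<circ> \<phi>)), (?N, secop (sec_of_fun a (g \<circ> \<phi>)) (sec_of_fun a (h \<circ> \<phi>)))) \<in> GM.R"
    by (rule GM.relI[OF pullback_class(1)[OF gh] l[unfolded N] nb]) (use sc in \<open>auto simp: o_def\<close>)
  from GM.class_eq[OF this] show ?thesis unfolding 1 2 pullback_class(2)[OF gh] .
qed

lemma pullback_scale:
  assumes G: "G \<in> C_germs"
  shows "pullback (germ_map GC.R (\<lambda>D. D) (\<lambda>f x. c * f x) G)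
    = germ_map GM.R (\<lambda>U. U) (sec_scale c) (pullback G)"
proof -
  obtain D g where g: "(D, g) \<in> GC.LS" "G = GC.R `` {(D, g)}" using G unfolding Cn_stalk_def by (rule GC.stalkE)
  have cg: "(D, \<lambda>x. c * g x) \<in> GC.LS" using g(1) by (simp add: GC_LS holo_on_cmult)
  have 1: "germ_map GC.R (\<lambda>D. D) (\<lambda>f x. c * f x) G = GC.R `` {(D, \<lambda>x. c * g x)}"
    unfolding g(2)
  proof (rule germ_map_class[OF germs_fun_agree germs_fun_agree g(1)])
    show "(D, \<lambda>x. c * g x) \<in> GC.LS" by (rule cg)
    fix V t N assume "nbhd UNIV 0 N" "N \<subseteq> D \<inter> V" "fun_agree N g t"
    then show "\<exists>N'. nbhd UNIV 0 N' \<and> N' \<subseteq> D \<inter> V \<and> fun_agree N' (\<lambda>x. c * g x) (\<lambda>x. c * t x)"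
      by (intro exI[of _ N]) (simp add: fun_agree_def)
  qed
  have eq: "sec_scale c (sec_of_fun a (g \<circ> \<phi>)) = (sec_of_fun a ((\<lambda>x. c * g x) \<circ> \<phi>) :: ('x, 'k) gsection)"
    by (simp add: sec_scale_of_fun o_def)
  have 2: "germ_map GM.R (\<lambda>U. U) (sec_scale c) (GM.R `` {(U \<inter> \<phi> -` D, sec_of_fun a (g \<circ> \<phi>))})
      = GM.R `` {(U \<inter> \<phi> -` D, sec_scale c (sec_of_fun a (g \<circ> \<phi>)))}"
  proof (rule germ_map_class[OF germs_sec_agree germs_sec_agree pullback_class(1)[OF g(1)]])
    show "(U \<inter> \<phi> -` D, sec_scale c (sec_of_fun a (g \<circ> \<phi>))) \<in> GM.LS"
      unfolding eq by (rule pullback_class(1)[OF cg])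
    fix V t N assume "nbhd M p\<^sub>0 N" "N \<subseteq> U \<inter> \<phi> -` D \<inter> V" "sec_agree B N (sec_of_fun a (g \<circ> \<phi>)) t"
    then show "\<exists>N'. nbhd M p\<^sub>0 N' \<and> N' \<subseteq> U \<inter> \<phi> -` D \<inter> V \<and>
        sec_agree B N' (sec_scale c (sec_of_fun a (g \<circ> \<phi>))) (sec_scale c t)"
      using sec_agree_scale by blast
  qed
  show ?thesis unfolding 1 pullback_class(2)[OF cg] unfolding g(2) pullback_class(2)[OF g(1)] 2 eq ..
qed

theorem restriction_onto_iff_pullback_iso:
  "restriction ` X_germs = cr_germs \<longleftrightarrow>
     pullback_iso X A M B a p\<^sub>0 U \<phi>"
proof
  assume onto: "restriction ` X_germs = cr_germs"
  have "bij_betw pullback C_germs cr_germs"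
    unfolding bij_betw_def using pullback_inj pullback_in_stalk onto_imp_pullback_onto[OF onto] by blast
  moreover have "pullback (germ_op GC.R (\<lambda>f g x. f x + g x) G H)
      = germ_op GM.R sec_add (pullback G) (pullback H)"
    if "G \<in> C_germs" "H \<in> C_germs" for G H
    using that by (rule pullback_op) (auto intro: holo_on_add sec_add_section sec_agree_add)
  moreover have "pullback (germ_op GC.R (\<lambda>f g x. f x * g x) G H)
      = germ_op GM.R sec_mult (pullback G) (pullback H)"
    if a: "a \<noteq> Distributional" and "G \<in> C_germs" "H \<in> C_germs" for G H
    using that(2,3)
  proof (rule pullback_op)
    fix N f g assume N: "openin (top_of_set M) N" "cr_function N (\<lambda>q. f q * g q)"
    have "sec_mult (sec_of_fun a f) (sec_of_fun a g) = (sec_of_fun a (\<lambda>q. f q * g q) :: ('x, 'k) gsection)"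
      using a by (cases a) auto
    then show "sec_mult (sec_of_fun a f) (sec_of_fun a g) \<in> cr_sections X A M B a N \<and>
        sec_agree B N (sec_of_fun a (\<lambda>q. f q * g q)) (sec_mult (sec_of_fun a f) (sec_of_fun a g))"
      using cr_function_section[OF N, of a] GM.ag_refl by simp
  qed (auto intro: holo_on_mult sec_agree_mult[OF a])
  ultimately show "pullback_iso X A M B a p\<^sub>0 U \<phi>"
    unfolding pullback_iso_def Let_def phi_p0 Cn_germ_rel_def cr_germ_rel_def using pullback_scale by blast
next
  assume "pullback_iso X A M B a p\<^sub>0 U \<phi>"
  then have "pullback ` C_germs = cr_germs"
    unfolding pullback_iso_def Let_def phi_p0 bij_betw_def by blast
  then show "restriction ` X_germs = cr_germs"
    by (rule pullback_onto_imp_onto)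
qed

end

end

theorem theorem4p1:
  fixes X M U W :: "'x::{t2_space,second_countable_topology} set"
    and A :: "('x, complex^'v) chart set"
    and B :: "('x, real^'k) chart set"
    and z :: "'x \<Rightarrow> complex^'v"
    and \<sigma> :: "'n::finite \<Rightarrow> 'v"
    and p\<^sub>0 :: 'x
    and m d :: nat
    and a :: regularity
  assumes "cr_submanifold X A M B m d"
    and "CARD('n) = m + d"
    and "p\<^sub>0 \<in> M"
    and "holo_chart X A (W, z)" and "p\<^sub>0 \<in> W" and "z p\<^sub>0 = 0"
    and "inj \<sigma>"
    and "differentials_independent M B p\<^sub>0 (\<lambda>i q. z q $ \<sigma> i)"
    and "nbhd M p\<^sub>0 U" and "U \<subseteq> M \<inter> W"
  shows "restriction_map X A M B a p\<^sub>0 ` holo_stalk X A p\<^sub>0 = cr_stalk X A M B a p\<^sub>0 \<longleftrightarrow>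
         pullback_iso X A M B a p\<^sub>0 U (coord_proj z \<sigma>)"
proof -
  interpret cr_embedding X M A B m d U W z \<sigma> p\<^sub>0
    by unfold_locales (fact assms)+
  show ?thesis by (rule restriction_onto_iff_pullback_iso)
qed

end
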